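(* Let $K\in(0,M]$ and $k\in[M]$. Suppose that, with $g_i:=\log(f_{1i}/f_{0i})$, $$\sum_{i=1}^M\int_{\mathbb S}|g_i|\log^+(|g_i|)\,f_{1i}\,d\nu_i<\infty,\qquad \sum_{i=1}^M\int_{\mathbb S}|g_i|\log^+(|g_i|)\,f_{0i}\,d\nu_i<\infty .$$ Consider a policy of the form $(R,T^R_{si},\Delta^R_{si})$, where the threshold is $d=|\log\alpha|+\log\binom Mk$ and the sampling constraint $\frac1{T^R_{si}}\sum_{m=1}^{T^R_{si}}|R(m)|\le K$ is satisfied. Fix $A\subseteq[M]$ and suppose that, for all $i\in[M]$, the sampling rule $R$ satisfies $$\sum_{n=1}^\infty\mathsf P_A\big(\pi^R_i(n)<c_i^*(A)-\epsilon\big)<\infty\qquad\text{for all }\epsilon>0 .$$ Then, as $\alpha\to0$, $$\mathsf E_A[T^R_{si}]\sim\mathcal J_A(\alpha;k,K)\sim\frac{|\log\alpha|}{V(k,K,\boldsymbol F(A))}.$$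
   Context: Notation. $\mathbb N=\{1,2,\dots\}$, $\mathbb N_0=\mathbb N\cup\{0\}$, $[n]=\{1,\dots,n\}$; $\triangle$ is symmetric difference; $x\sim y$ means $\lim(x/y)=1$. Empty sums are $0$. Model. Let $M\in\mathbb N$ and let $(\mathbb S,\mathcal S)$ be a measurable space. There are $M$ sequences $\{X_i(n):n\in\mathbb N\}$, $i\in[M]$, of iid $\mathbb S$-valued random elements ("sources") and $M$ sequences $\{Z_i(n):n\in\mathbb N_0\}$, $i\in[M]$, of iid random variables uniform on $(0,1)$ (used for randomization); all of these are mutually independent. For $A\subseteq[M]$ (the set of "anomalous" sources), $\mathsf P_A$ (expectation $\mathsf E_A$) is the probability measure under which $X_i(n)$ has density $f_{1i}$ with respect to a $\sigma$-finite measure $\nu_i$ if $i\in A$, and density $f_{0i}$ if $i\notin A$. Standing assumption: for every $i\in[M]$, $I_i:=\int_{\mathbb S}\log(f_{1i}/f_{0i})f_{1i}\,d\nu_i\in(0,\infty)$ and $J_i:=\int_{\mathbb S}\log(f_{0i}/f_{1i})f_{0i}\,d\nu_i\in(0,\infty)$. Policies. A sampling rule is a sequence $R=\{R(n):n\in\mathbb N\}$ of random subsets of $[M]$ with $R(n)$ being $\mathcal F^R_{n-1}$-measurable, where $\mathcal F^R_0=\sigma(Z(0))$, $\mathcal F^R_n=\sigma(\mathcal F^R_{n-1},Z(n),\{X_i(n):i\in R(n)\})$ and $Z(n)=(Z_1(n),\dots,Z_M(n))$. $R_i(n):=\mathbf 1\{i\in R(n)\}$ and $\pi_i^R(n):=\frac1n\sum_{m=1}^nR_i(m)$.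 A policy is a triplet $(R,T,\Delta)$ with $R$ a sampling rule, $T$ an $\{\mathcal F^R_n\}$-stopping time, and $\Delta\subseteq[M]$ random and $\mathcal F^R_T$-measurable. $\mathcal C(K)$ is the class of policies with $\frac1T\sum_{m=1}^T|R(m)|\le K$. Error control. For $\alpha\in(0,1)$, $\mathcal C(\alpha;k,K)$ is the class of policies in $\mathcal C(K)$ with $\mathsf P_B(|B\triangle\Delta|\ge k)\le\alpha$ for all $B\subseteq[M]$, and $\mathcal J_A(\alpha;k,K):=\inf_{(R,T,\Delta)\in\mathcal C(\alpha;k,K)}\mathsf E_A[T]$. Sum-intersection rule. $\Lambda^R_i(n):=\sum_{m=1}^n\log\big(f_{1i}(X_i(m))/f_{0i}(X_i(m))\big)R_i(m)$; $\bar\Lambda^R_i(n)$ is the $i$-th smallest element of $\{|\Lambda^R_j(n)|:j\in[M]\}$; $T^R_{si}:=\inf\{n\ge1:\sum_{i=1}^k\bar\Lambda^R_i(n)\ge d\}$ and $\Delta^R_{si}:=\{i\in[M]:\Lambda^R_i(T^R_{si})>0\}$. The constant $V$ and vector $c'$. Let $\boldsymbol L=\{L_1\le\dots\le L_N\}$ be an ordered set of $N=|\boldsymbol L|\le M$ positive numbers (repetitions allowed), $L_0:=0$, $\widetilde L_i:=(N-i+1)/\sum_{j=i}^N(1/L_j)$, and $\kappa\in[N]$. With $\mathcal D(K):=\{c\in[0,1]^M:\sum_ic_i\le K\}$, $$V(\kappa,K,\boldsymbol L):=\max_{c\in\mathcal D(K)}\min_{U\subseteq[N],|U|=\kappa}\sum_{i\in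 U}c_iL_i .$$ The vector $c'(\kappa,K,\boldsymbol L)=(c'_1,\dots,c'_N,0,\dots,0)\in[0,1]^M$ (a maximizer in $V(\kappa,K,\boldsymbol L)$ with minimum $\ell^1$ norm) is given, in terms of the numbers $x,y,u,v$ below, by: $c'_iL_i=y\widetilde L_{u+1}$ if $u<\kappa$ and $c'_iL_i=L_\kappa$ if $u=\kappa$, for $u<i\le N$; if $v=0$, $c'_i=0$ for $1\le i\le u$; if $v\ge1$, $c'_i=1$ for $v\le i\le u$; if $v\ge2$, $c'_{v-1}=x$; if $v\ge3$, $c'_i=0$ for $i\le v-2$. Here $x,y,u,v$ are the output of the following algorithm, where $S_u:=\sum_{i=u+1}^N1/L_i$, $\rho_u:=\frac{\kappa-u}{N-u}\widetilde L_{u+1}$ for $u<\kappa$ and $\rho_\kappa:=0$. 1. $u^*:=\max\{u\in\{0,\dots,\kappa-1\}:\rho_u\ge L_u\}$. 2. If $K\ge\kappa+L_\kappa S_\kappa$, output $x=0,y=0,u=\kappa,v=1$. 3. If $K<L_{u^*+1}S_{u^*}$, output $x=0,v=0,u=u^*,y=K/(N-u^* )$. 4. Otherwise set $x=0$, $u=v=u^*+1$, $z=L_uS_u$, $\bar K=K-L_{u^*+1}S_{u^*}$, and while $\bar K>0$ repeat: (i) if $L_{v-1}\ge\rho_u$ or $u=\kappa$: if $\bar K\ge1$ replace $v$ by $v-1$ and $\bar K$ by $\bar K-1$, else set $x=\bar K$ and then $\bar K=0$; (ii) if (with current values) $L_{v-1}<\rho_u$ or $v=1$: let $w=L_{u+1}S_u-z$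 and $m=\min\{\bar K,w\}$, replace $z$ by $z+m$ and $\bar K$ by $\bar K-m$; if now $z\ge L_{u+1}S_u$, set $z=L_{u+1}S_{u+1}$ and replace $u$ by $u+1$. Finally $y=z/(N-u)$ (irrelevant when $u=\kappa$). $\boldsymbol F(A)=\{F_i(A):i\in[M]\}$ is the ordered set consisting of the $M$ numbers $I_i$, $i\in A$, and $J_j$, $j\notin A$, with $F_i(A)$ the $i$-th smallest. The vector $c^*(A)=(c^*_1(A),\dots,c^*_M(A))$ is the permutation of $c'(k,K,\boldsymbol F(A))$ given by $c^*_{(i)}(A):=c'_i(k,K,\boldsymbol F(A))$, $i\in[M]$, where $(i)$ is the source with the $i$-th smallest number in $\boldsymbol F(A)$. *)

theory Defs
  imports "HOL-Probability.Probability" "HOL-Library.While_Combinator"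
begin

section \<open>The model\<close>

text \<open>
  Sources are indexed by \<open>1, \<dots>, num_sources\<close>.  \<open>law Q A\<close> is the probability measure \<open>P\<^sub>A\<close> on the
  measurable space \<open>outcomes Q\<close>; the observations \<open>obs Q i n = X\<^sub>i(n)\<close> are used for \<open>n \<ge> 1\<close> and the
  randomizers \<open>aux Q i n = Z\<^sub>i(n)\<close> for \<open>n \<ge> 0\<close>.
\<close>

record ('s, 'w) anomaly_setup =
  num_sources :: nat
  obs_space :: "'s measure"
  ref :: "nat \<Rightarrow> 's measure"
  dens0 :: "nat \<Rightarrow> 's \<Rightarrow> real"
  dens1 :: "nat \<Rightarrow> 's \<Rightarrow> real"
  outcomes :: "'w measure"
  law :: "nat set \<Rightarrow> 'w measure"
  obs :: "nat \<Rightarrow> nat \<Rightarrow> 'w \<Rightarrow> 's"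
  aux :: "nat \<Rightarrow> nat \<Rightarrow> 'w \<Rightarrow> real"

abbreviation sources :: "('s, 'w) anomaly_setup \<Rightarrow> nat set" where
  "sources Q \<equiv> {1..num_sources Q}"

text \<open>
  \<open>divergence \<nu> p q\<close> is the extended-real integral of \<open>log (p / q) \<cdot> p\<close> with respect to \<open>\<nu>\<close>, written
  as positive part minus negative part.  The logarithm is \<open>\<infinity>\<close> where \<open>p > 0 = q\<close>, so a finite
  value entails that \<open>p > 0\<close> implies \<open>q > 0\<close> almost everywhere; where \<open>p = 0\<close> the value of
  \<open>log_ratio\<close> is irrelevant, since \<open>\<infinity> * 0 = 0\<close> in \<^typ>\<open>ennreal\<close>.
\<close>

definition log_ratio :: "real \<Rightarrow> real \<Rightarrow> ereal" where
  "log_ratio p q = (if q = 0 then \<infinity> else ereal (ln (p / q)))"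

definition divergence :: "'s measure \<Rightarrow> ('s \<Rightarrow> real) \<Rightarrow> ('s \<Rightarrow> real) \<Rightarrow> ereal" where
  "divergence \<nu> p q =
     enn2ereal (\<integral>\<^sup>+x. e2ennreal (log_ratio (p x) (q x)) * ennreal (p x) \<partial>\<nu>)
   - enn2ereal (\<integral>\<^sup>+x. e2ennreal (- log_ratio (p x) (q x)) * ennreal (p x) \<partial>\<nu>)"

definition info1 :: "('s, 'w) anomaly_setup \<Rightarrow> nat \<Rightarrow> ereal" where
  "info1 Q i = divergence (ref Q i) (dens1 Q i) (dens0 Q i)"

definition info0 :: "('s, 'w) anomaly_setup \<Rightarrow> nat \<Rightarrow> ereal" where
  "info0 Q i = divergence (ref Q i) (dens0 Q i) (dens1 Q i)"

text \<open>
  Mutual independence is stated through the generated sigma-algebras because the observations and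
  the randomizers take values in different types.
\<close>

locale anomaly_model =
  fixes Q :: "('s, 'w) anomaly_setup"
  assumes num_sources_pos: "1 \<le> num_sources Q"
    and sets_ref: "\<And>i. i \<in> sources Q \<Longrightarrow> sets (ref Q i) = sets (obs_space Q)"
    and sigma_finite_ref: "\<And>i. i \<in> sources Q \<Longrightarrow> sigma_finite_measure (ref Q i)"
    and dens_measurable:
      "\<And>i. i \<in> sources Q \<Longrightarrow> dens0 Q i \<in> borel_measurable (obs_space Q)"
      "\<And>i. i \<in> sources Q \<Longrightarrow> dens1 Q i \<in> borel_measurable (obs_space Q)"
    and dens_nonneg:
      "\<And>i x. i \<in> sources Q \<Longrightarrow> x \<in> space (obs_space Q) \<Longrightarrow> 0 \<le> dens0 Q i x"
      "\<And>i x. i \<in> sources Q \<Longrightarrow> x \<in> space (obs_space Q) \<Longrightarrow> 0 \<le> dens1 Q i x"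
    and info_pos_finite:
      "\<And>i. i \<in> sources Q \<Longrightarrow> 0 < info1 Q i \<and> info1 Q i < \<infinity>"
      "\<And>i. i \<in> sources Q \<Longrightarrow> 0 < info0 Q i \<and> info0 Q i < \<infinity>"
    and prob_law: "\<And>A. A \<subseteq> sources Q \<Longrightarrow> prob_space (law Q A)"
    and sets_law: "\<And>A. A \<subseteq> sources Q \<Longrightarrow> sets (law Q A) = sets (outcomes Q)"
    and obs_distributed:
      "\<And>A i n. A \<subseteq> sources Q \<Longrightarrow> i \<in> sources Q \<Longrightarrow> 1 \<le> n \<Longrightarrow>
         distributed (law Q A) (ref Q i) (obs Q i n)
           (\<lambda>x. ennreal (if i \<in> A then dens1 Q i x else dens0 Q i x))"
    and aux_measurable:
      "\<And>i n. i \<in> sources Q \<Longrightarrow> aux Q i n \<in> borel_measurable (outcomes Q)"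
    and aux_uniform:
      "\<And>A i n. A \<subseteq> sources Q \<Longrightarrow> i \<in> sources Q \<Longrightarrow>
         distr (law Q A) borel (aux Q i n) = uniform_measure lborel {0<..<1}"
    and mutually_indep:
      "\<And>A. A \<subseteq> sources Q \<Longrightarrow>
         prob_space.indep_sets (law Q A)
           (case_sum
             (\<lambda>(i, n). {obs Q i n -` B \<inter> space (outcomes Q) | B. B \<in> sets (obs_space Q)})
             (\<lambda>(i, n). {aux Q i n -` B \<inter> space (outcomes Q) | B. B \<in> sets borel}))
           ((sources Q \<times> {1..}) <+> (sources Q \<times> UNIV))"


section \<open>Policies\<close>

text \<open>
  A sampling rule \<open>R\<close> is used at times \<open>n \<ge> 1\<close>.  As \<open>R(n)\<close> is random, \<open>\<sigma>(X\<^sub>i(n) : i \<in> R(n))\<close> is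
  generated by the events \<open>{i \<in> R(n), X\<^sub>i(n) \<in> B}\<close>.
\<close>

type_synonym 'w rule = "nat \<Rightarrow> 'w \<Rightarrow> nat set"
type_synonym 'w policy = "'w rule \<times> ('w \<Rightarrow> enat) \<times> ('w \<Rightarrow> nat set)"

definition aux_events :: "('s, 'w) anomaly_setup \<Rightarrow> nat \<Rightarrow> 'w set set" where
  "aux_events Q n =
     {{\<omega> \<in> space (outcomes Q). aux Q i n \<omega> \<in> B} | i B. i \<in> sources Q \<and> B \<in> sets borel}"

definition obs_events :: "('s, 'w) anomaly_setup \<Rightarrow> 'w rule \<Rightarrow> nat \<Rightarrow> 'w set set" where
  "obs_events Q R n =
     {{\<omega> \<in> space (outcomes Q). i \<in> R n \<omega> \<and> obs Q i n \<omega> \<in> B} | i B.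
        i \<in> sources Q \<and> B \<in> sets (obs_space Q)}"

primrec history :: "('s, 'w) anomaly_setup \<Rightarrow> 'w rule \<Rightarrow> nat \<Rightarrow> 'w measure" where
  "history Q R 0 = sigma (space (outcomes Q)) (aux_events Q 0)"
| "history Q R (Suc n) =
     sigma (space (outcomes Q))
       (sets (history Q R n) \<union> aux_events Q (Suc n) \<union> obs_events Q R (Suc n))"

text \<open>
  The filtration is extended to time \<open>\<infinity>\<close>, so that the library's stopping times and their
  sigma-algebras apply to \<^typ>\<open>enat\<close>-valued times.
\<close>

definition info_filtration :: "('s, 'w) anomaly_setup \<Rightarrow> 'w rule \<Rightarrow> enat \<Rightarrow> 'w measure" where
  "info_filtration Q R t =
     (case t of enat n \<Rightarrow> history Q R n
      | \<infinity> \<Rightarrow> sigma (space (outcomes Q)) (\<Union>n. sets (history Q R n)))"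

lemma space_history: "space (history Q R n) = space (outcomes Q)"
  by (cases n) (simp_all add: space_measure_of_conv)

lemma sets_history_Suc: "sets (history Q R n) \<subseteq> sets (history Q R (Suc n))"
proof -
  have "sets (history Q R n) \<subseteq> Pow (space (outcomes Q))"
    using sets.space_closed[of "history Q R n"] by (simp only: space_history)
  moreover have "aux_events Q (Suc n) \<union> obs_events Q R (Suc n) \<subseteq> Pow (space (outcomes Q))"
    unfolding aux_events_def obs_events_def by blast
  ultimately have "sets (history Q R n) \<union> aux_events Q (Suc n) \<union> obs_events Q R (Suc n)
      \<subseteq> Pow (space (outcomes Q))"
    by blast
  from sets_measure_of[OF this] show ?thesis
    by (auto intro: sigma_sets.Basic)
qed

lemma filtration_info_filtration:
  "filtration (space (outcomes Q)) (info_filtration Q R)"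
proof
  have mono: "sets (history Q R m) \<subseteq> sets (history Q R n)" if "m \<le> n" for m n
    using that by (induction rule: dec_induct) (use sets_history_Suc in blast)+
  have top: "(\<Union>n. sets (history Q R n)) \<subseteq> Pow (space (outcomes Q))"
    using sets.space_closed[of "history Q R _"] unfolding space_history by blast
  show "space (info_filtration Q R t) = space (outcomes Q)" for t
    by (cases t) (simp_all add: info_filtration_def space_history space_measure_of_conv)
  show "sets (info_filtration Q R s) \<subseteq> sets (info_filtration Q R t)" if "s \<le> t" for s t
    using that mono sets_measure_of[OF top]
    by (cases s; cases t) (auto simp: info_filtration_def)
qed

definition sampling_rule :: "('s, 'w) anomaly_setup \<Rightarrow> 'w rule \<Rightarrow> bool" where
  "sampling_rule Q R \<longleftrightarrow>
     (\<forall>n\<ge>1. R n \<in> history Q R (n - 1) \<rightarrow>\<^sub>M count_space (Pow (sources Q)))"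

definition sampling_freq :: "'w rule \<Rightarrow> nat \<Rightarrow> nat \<Rightarrow> 'w \<Rightarrow> real" where
  "sampling_freq R i n \<omega> = (1 / real n) * (\<Sum>m=1..n. of_bool (i \<in> R m \<omega>))"

definition policies :: "('s, 'w) anomaly_setup \<Rightarrow> 'w policy set" where
  "policies Q =
     {(R, T, D). sampling_rule Q R \<and> stopping_time (info_filtration Q R) T \<and>
        D \<in> filtration.pre_sigma (space (outcomes Q)) (info_filtration Q R) T
              \<rightarrow>\<^sub>M count_space (Pow (sources Q))}"

text \<open>
  The sampling constraint is understood almost surely under every \<open>P\<^sub>B\<close>, and is void on
  \<open>{T = \<infinity>}\<close>.
\<close>

definition budget_policies :: "('s, 'w) anomaly_setup \<Rightarrow> real \<Rightarrow> 'w policy set" where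
  "budget_policies Q K =
     {(R, T, D). (R, T, D) \<in> policies Q \<and>
        (\<forall>B. B \<subseteq> sources Q \<longrightarrow>
           (AE \<omega> in law Q B. \<forall>n. T \<omega> = enat n \<longrightarrow>
              (1 / real n) * (\<Sum>m=1..n. real (card (R m \<omega>))) \<le> K))}"

definition admissible_policies ::
    "('s, 'w) anomaly_setup \<Rightarrow> real \<Rightarrow> nat \<Rightarrow> real \<Rightarrow> 'w policy set" where
  "admissible_policies Q \<alpha> k K =
     {(R, T, D). (R, T, D) \<in> budget_policies Q K \<and>
        (\<forall>B. B \<subseteq> sources Q \<longrightarrow>
           measure (law Q B)
             {\<omega> \<in> space (outcomes Q). k \<le> card ((B - D \<omega>) \<union> (D \<omega> - B))} \<le> \<alpha>)}"

definition expected_time ::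
    "('s, 'w) anomaly_setup \<Rightarrow> nat set \<Rightarrow> ('w \<Rightarrow> enat) \<Rightarrow> ennreal" where
  "expected_time Q A T = (\<integral>\<^sup>+\<omega>. ennreal_of_enat (T \<omega>) \<partial>law Q A)"

definition optimal_time ::
    "('s, 'w) anomaly_setup \<Rightarrow> nat set \<Rightarrow> real \<Rightarrow> nat \<Rightarrow> real \<Rightarrow> ennreal" where
  "optimal_time Q A \<alpha> k K =
     (\<Sqinter>(R, T, D) \<in> admissible_policies Q \<alpha> k K. expected_time Q A T)"


section \<open>The sum-intersection rule\<close>

text \<open>
  Under the standing assumptions the densities are positive at the observations almost surely
  under every \<open>P\<^sub>A\<close>, so the real logarithm may be used.
\<close>

definition llr :: "('s, 'w) anomaly_setup \<Rightarrow> nat \<Rightarrow> 's \<Rightarrow> real" where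
  "llr Q i x = ln (dens1 Q i x / dens0 Q i x)"

definition log_plus :: "real \<Rightarrow> real" where
  "log_plus x = max 0 (ln x)"

definition cum_llr ::
    "('s, 'w) anomaly_setup \<Rightarrow> 'w rule \<Rightarrow> nat \<Rightarrow> nat \<Rightarrow> 'w \<Rightarrow> real" where
  "cum_llr Q R i n \<omega> = (\<Sum>m=1..n. llr Q i (obs Q i m \<omega>) * of_bool (i \<in> R m \<omega>))"

definition ordered_abs_llr ::
    "('s, 'w) anomaly_setup \<Rightarrow> 'w rule \<Rightarrow> nat \<Rightarrow> nat \<Rightarrow> 'w \<Rightarrow> real" where
  "ordered_abs_llr Q R i n \<omega> =
     sort (map (\<lambda>j. \<bar>cum_llr Q R j n \<omega>\<bar>) [1..<Suc (num_sources Q)]) ! (i - 1)"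

text \<open>The infimum of the empty set of times is \<open>\<infinity>\<close>.\<close>

definition T_si :: "('s, 'w) anomaly_setup \<Rightarrow> nat \<Rightarrow> real \<Rightarrow> 'w rule \<Rightarrow> 'w \<Rightarrow> enat" where
  "T_si Q k d R \<omega> =
     Inf (enat ` {n. 1 \<le> n \<and> d \<le> (\<Sum>i=1..k. ordered_abs_llr Q R i n \<omega>)})"

text \<open>The value on \<open>{T_si = \<infinity>}\<close> is a convention.\<close>

definition D_si :: "('s, 'w) anomaly_setup \<Rightarrow> nat \<Rightarrow> real \<Rightarrow> 'w rule \<Rightarrow> 'w \<Rightarrow> nat set" where
  "D_si Q k d R \<omega> =
     (case T_si Q k d R \<omega> of
        enat n \<Rightarrow> {i \<in> sources Q. 0 < cum_llr Q R i n \<omega>}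
      | \<infinity> \<Rightarrow> {})"

definition threshold :: "('s, 'w) anomaly_setup \<Rightarrow> nat \<Rightarrow> real \<Rightarrow> real" where
  "threshold Q k \<alpha> = \<bar>ln \<alpha>\<bar> + ln (real (num_sources Q choose k))"


section \<open>The constant \<open>V\<close> and the vector \<open>c'\<close>\<close>

text \<open>
  An ordered set \<open>L\<^sub>1 \<le> \<dots> \<le> L\<^sub>N\<close> is a sorted list of length \<open>N\<close>; \<open>elem L i\<close> is \<open>L\<^sub>i\<close>, with \<open>L\<^sub>0 = 0\<close>.
\<close>

definition elem :: "real list \<Rightarrow> nat \<Rightarrow> real" where
  "elem L i = (0 # L) ! i"

definition budget_vectors :: "nat \<Rightarrow> real \<Rightarrow> (nat \<Rightarrow> real) set" where
  "budget_vectors M K = {c \<in> {1..M} \<rightarrow>\<^sub>E {0..1}. (\<Sum>i=1..M. c i) \<le> K}"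

text \<open>The outer supremum is a maximum, since \<open>budget_vectors M K\<close> is compact.\<close>

definition max_min_rate :: "nat \<Rightarrow> nat \<Rightarrow> real \<Rightarrow> real list \<Rightarrow> real" where
  "max_min_rate M \<kappa> K L =
     (\<Squnion>c\<in>budget_vectors M K.
        Min ((\<lambda>U. \<Sum>i\<in>U. c i * elem L i) ` {U. U \<subseteq> {1..length L} \<and> card U = \<kappa>}))"

definition harmonic_tail :: "real list \<Rightarrow> nat \<Rightarrow> real" where
  "harmonic_tail L i = real (length L - i + 1) / (\<Sum>j=i..length L. 1 / elem L j)"

definition inv_sum :: "real list \<Rightarrow> nat \<Rightarrow> real" where
  "inv_sum L u = (\<Sum>i=u+1..length L. 1 / elem L i)"

definition rho :: "nat \<Rightarrow> real list \<Rightarrow> nat \<Rightarrow> real" where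
  "rho \<kappa> L u =
     (if u < \<kappa> then real (\<kappa> - u) / real (length L - u) * harmonic_tail L (u + 1) else 0)"

definition u_star :: "nat \<Rightarrow> real list \<Rightarrow> nat" where
  "u_star \<kappa> L = Max {u \<in> {..<\<kappa>}. elem L u \<le> rho \<kappa> L u}"

text \<open>
  The loop state is \<open>(x, u, v, z, B)\<close>, with \<open>B\<close> the remaining budget; each iteration performs
  \<open>step_top\<close> and then \<open>step_level\<close> on the updated values.
\<close>

type_synonym alloc_state = "real \<times> nat \<times> nat \<times> real \<times> real"

definition step_top :: "nat \<Rightarrow> real list \<Rightarrow> alloc_state \<Rightarrow> alloc_state" where
  "step_top \<kappa> L = (\<lambda>(x, u, v, z, B).
     if rho \<kappa> L u \<le> elem L (v - 1) \<or> u = \<kappa>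
     then (if 1 \<le> B then (x, u, v - 1, z, B - 1) else (B, u, v, z, 0))
     else (x, u, v, z, B))"

definition step_level :: "nat \<Rightarrow> real list \<Rightarrow> alloc_state \<Rightarrow> alloc_state" where
  "step_level \<kappa> L = (\<lambda>(x, u, v, z, B).
     if elem L (v - 1) < rho \<kappa> L u \<or> v = 1
     then (let w = elem L (u + 1) * inv_sum L u - z;
               m = min B w;
               z' = z + m
           in if elem L (u + 1) * inv_sum L u \<le> z'
              then (x, u + 1, v, elem L (u + 1) * inv_sum L (u + 1), B - m)
              else (x, u, v, z', B - m))
     else (x, u, v, z, B))"

text \<open>The output is \<open>(x, y, u, v)\<close>.\<close>

definition alloc_params :: "nat \<Rightarrow> real \<Rightarrow> real list \<Rightarrow> real \<times> real \<times> nat \<times> nat" where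
  "alloc_params \<kappa> K L =
     (let us = u_star \<kappa> L in
      if real \<kappa> + elem L \<kappa> * inv_sum L \<kappa> \<le> K then (0, 0, \<kappa>, 1)
      else if K < elem L (us + 1) * inv_sum L us
      then (0, K / real (length L - us), us, 0)
      else
        (case while (\<lambda>(x, u, v, z, B). 0 < B) (\<lambda>s. step_level \<kappa> L (step_top \<kappa> L s))
                (0, us + 1, us + 1, elem L (us + 1) * inv_sum L (us + 1),
                 K - elem L (us + 1) * inv_sum L us) of
           (x, u, v, z, B) \<Rightarrow> (x, z / real (length L - u), u, v)))"

definition c_prime :: "nat \<Rightarrow> real \<Rightarrow> real list \<Rightarrow> nat \<Rightarrow> real" where
  "c_prime \<kappa> K L i =
     (case alloc_params \<kappa> K L of (x, y, u, v) \<Rightarrow>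
        if i = 0 \<or> length L < i then 0
        else if u < i then
          (if u < \<kappa> then y * harmonic_tail L (u + 1) / elem L i else elem L \<kappa> / elem L i)
        else if v = 0 then 0
        else if v \<le> i then 1
        else if i + 1 = v then x
        else 0)"


section \<open>The information numbers of a configuration\<close>

definition strength :: "('s, 'w) anomaly_setup \<Rightarrow> nat set \<Rightarrow> nat \<Rightarrow> real" where
  "strength Q A i = real_of_ereal (if i \<in> A then info1 Q i else info0 Q i)"

definition F_list :: "('s, 'w) anomaly_setup \<Rightarrow> nat set \<Rightarrow> real list" where
  "F_list Q A = sort (map (strength Q A) [1..<Suc (num_sources Q)])"

text \<open>
  \<open>\<sigma> i\<close> is the source \<open>(i)\<close> carrying the \<open>i\<close>-th smallest number.  Every way of breaking ties is
  allowed.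
\<close>

definition ranking :: "('s, 'w) anomaly_setup \<Rightarrow> nat set \<Rightarrow> (nat \<Rightarrow> nat) \<Rightarrow> bool" where
  "ranking Q A \<sigma> \<longleftrightarrow>
     bij_betw \<sigma> (sources Q) (sources Q) \<and>
     (\<forall>i\<in>sources Q. strength Q A (\<sigma> i) = elem (F_list Q A) i)"

definition c_star ::
    "('s, 'w) anomaly_setup \<Rightarrow> nat set \<Rightarrow> nat \<Rightarrow> real \<Rightarrow> (nat \<Rightarrow> nat) \<Rightarrow> nat \<Rightarrow> real" where
  "c_star Q A k K \<sigma> j = c_prime k K (F_list Q A) (inv_into (sources Q) \<sigma> j)"

end

theory Submission
  imports Defs
begin

text \<open>
  Write \<open>a = |ln \<alpha>|\<close>, let \<open>F\<^sub>i\<close> be the information number of source \<open>i\<close> under \<open>P\<^sub>A\<close>, \<open>N\<^sub>i(n)\<close> the number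
  of samples taken from source \<open>i\<close> up to time \<open>n\<close>, and \<open>V\<close> the max-min rate.  Both bounds on expected
  times rest on one estimate (\<open>deviation_control_sources\<close>): for every \<open>\<epsilon> > 0\<close> there is a constant \<open>C\<close>
  such that, for all sampling rules and all bounded stopping times \<open>\<tau>\<close>, the largest deviation up to
  time \<open>\<tau>\<close> of the log-likelihood ratio statistics from \<open>F\<^sub>i N\<^sub>i(n)\<close> has \<open>P\<^sub>A\<close>-mean at most
  \<open>\<epsilon> E[\<tau>] + C\<close>.  The increments have only a first moment, so they are truncated: the bounded part is
  a martingale, for which Doob's inequality gives a bound of order \<open>sqrt E[\<tau>]\<close>, and Wald's identity
  makes the remainder a small multiple of \<open>E[\<tau>]\<close>.

  \<^emph>\<open>Lower bound\<close> (\<open>lower_bound\<close>).  Let \<open>P\<^sub>B\<close> differ from \<open>P\<^sub>A\<close> in a set \<open>U\<close> of sources.  If a policy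
  makes an error with \<open>P\<^sub>B\<close>-probability at most \<open>\<alpha>\<close>, then by a change of measure (\<open>lr_history\<close>) the
  statistic of \<open>U\<close> is at least \<open>(1 - \<epsilon>) a\<close> on those decisions that are correct under \<open>P\<^sub>A\<close> and wrong
  under \<open>P\<^sub>B\<close>, up to an event whose \<open>P\<^sub>A\<close>-probability is a power of \<open>\<alpha>\<close>.  When the decision misses
  \<open>A\<close> by a set \<open>W\<close> with fewer than \<open>k\<close> elements, this applies to every \<open>U\<close> disjoint from \<open>W\<close> with
  \<open>k - card W\<close> elements, and every set of \<open>k\<close> sources contains such a \<open>U\<close>.  Hence the sum of
  \<open>F\<^sub>i N\<^sub>i(T)\<close> over any \<open>k\<close> sources is nearly \<open>a\<close> or larger.  The vector \<open>N\<^sub>i(T) / T\<close> respects the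
  budget, so for some \<open>k\<close> sources this sum is at most \<open>T V\<close>, which forces \<open>T\<close> to be about \<open>a / V\<close>.

  \<^emph>\<open>Upper bound\<close> (\<open>upper_bound\<close>).  Before the sum-intersection rule stops, at each time \<open>n\<close> some \<open>k\<close>
  sources have statistics with sum below the threshold \<open>d\<close>; if moreover all sampling frequencies are
  near \<open>c\<^sup>*\<close>, that sum is at least nearly \<open>n V\<close> minus the deviation.  This bounds the last such \<open>n\<close>;
  all later times before stopping have a bad sampling frequency, and the mean number of those is
  finite by hypothesis.  That the greedy algorithm computes a vector attaining \<open>V\<close> is a matter of
  linear programming duality (\<open>c_prime_optimal\<close>).

  The given rule may fail to stop under some \<open>P\<^sub>B\<close> with \<open>B \<noteq> A\<close>, so the infimum over admissible
  policies is bounded from above through another one: a deterministic rule whose frequencies are a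
  nearly optimal budget vector (\<open>regular_rule_admissible\<close>).  The sum-intersection rule then stops
  almost surely under every \<open>P\<^sub>B\<close>, and a change of measure bounds its error.
\<close>

section \<open>Sums of the \<open>k\<close> smallest values\<close>

text \<open>
  The threshold \<open>t\<close>, which separates the \<open>k\<close> smallest values from the others, is what makes
  comparisons with other weightings one-line computations.
\<close>

lemma smallest_sum_exists:
  fixes f :: "nat \<Rightarrow> real"
  assumes k: "1 \<le> k" "k \<le> M"
  obtains U t where "U \<subseteq> {1..M}" "card U = k"
    "(\<Sum>i=1..k. sort (map f [1..<Suc M]) ! (i - 1)) = (\<Sum>i\<in>U. f i)"
    "\<And>i. i \<in> U \<Longrightarrow> f i \<le> t" "\<And>i. i \<in> {1..M} - U \<Longrightarrow> t \<le> f i"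
proof -
  define ys where "ys = sort_key f [1..<Suc M]"
  have map_ys: "sort (map f [1..<Suc M]) = map f ys"
    by (rule properties_for_sort) (simp_all add: ys_def)
  have len: "length ys = M" and dist: "distinct ys" and set_ys: "set ys = {1..M}"
    by (auto simp: ys_def)
  have mono: "f (ys ! i) \<le> f (ys ! j)" if "i \<le> j" "j < M" for i j
    using that sorted_nth_mono[of "map f ys" i j] len by (simp add: ys_def)
  define U where "U = set (take k ys)"
  have cardU: "card U = k"
    using dist len k by (simp add: U_def distinct_card)
  have subU: "U \<subseteq> {1..M}"
    using set_take_subset[of k ys] set_ys by (auto simp: U_def)
  have sum1: "(\<Sum>i=1..k. sort (map f [1..<Suc M]) ! (i - 1)) = (\<Sum>i<k. f (ys ! i))"
    unfolding map_ys using k len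
    by (intro sum.reindex_bij_witness[of _ Suc "\<lambda>i. i - 1"]) auto
  have U_img: "U = (\<lambda>i. ys ! i) ` {..<k}"
    using k len nth_image[of k ys] by (simp add: U_def atLeast0LessThan)
  have inj: "inj_on (\<lambda>i. ys ! i) {..<k}"
    using dist len k by (auto simp: inj_on_def nth_eq_iff_index_eq)
  have sum2: "(\<Sum>i<k. f (ys ! i)) = (\<Sum>i\<in>U. f i)"
    unfolding U_img by (simp add: sum.reindex[OF inj])
  have lo: "f i \<le> f (ys ! (k - 1))" if "i \<in> U" for i
    using that k unfolding U_img by (auto intro!: mono)
  have hi: "f (ys ! (k - 1)) \<le> f i" if i: "i \<in> {1..M} - U" for i
  proof -
    obtain j where j: "j < M" "i = ys ! j"
      using i set_ys len by (metis DiffD1 in_set_conv_nth)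
    with i have "\<not> j < k" unfolding U_img by auto
    then show ?thesis using j by (auto intro!: mono)
  qed
  show thesis
    by (rule that[of U "f (ys ! (k - 1))"]) (use subU cardU sum1 sum2 lo hi in auto)
qed

text \<open>
  Fractional weights \<open>p\<close> of total mass \<open>k\<close> are the dual variables of the max-min problem.  Moving to
  them from the indicator of the \<open>k\<close> smallest values only shifts mass from values below the threshold
  \<open>t\<close> to values above it.
\<close>

lemma smallest_sum_le_weighted:
  fixes f p :: "nat \<Rightarrow> real"
  assumes k: "1 \<le> k" "k \<le> M" and p: "\<And>i. i \<in> {1..M} \<Longrightarrow> 0 \<le> p i \<and> p i \<le> 1"
    and sum_p: "(\<Sum>i=1..M. p i) = real k"
  shows "(\<Sum>i=1..k. sort (map f [1..<Suc M]) ! (i - 1)) \<le> (\<Sum>i=1..M. p i * f i)"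
proof -
  obtain U t where U: "U \<subseteq> {1..M}" "card U = k"
    "(\<Sum>i=1..k. sort (map f [1..<Suc M]) ! (i - 1)) = (\<Sum>i\<in>U. f i)"
    and lo: "\<And>i. i \<in> U \<Longrightarrow> f i \<le> t" and hi: "\<And>i. i \<in> {1..M} - U \<Longrightarrow> t \<le> f i"
    using smallest_sum_exists[OF k, of f] by metis
  have "(\<Sum>i=1..M. of_bool (i \<in> U)) = real k"
    using U(1,2) by (simp add: Int_absorb1)
  then have "0 = t * ((\<Sum>i=1..M. p i) - (\<Sum>i=1..M. of_bool (i \<in> U)))"
    using sum_p by simp
  also have "\<dots> = (\<Sum>i=1..M. (p i - of_bool (i \<in> U)) * t)"
    by (simp only: sum_subtractf[symmetric] sum_distrib_left mult.commute)
  also have "\<dots> \<le> (\<Sum>i=1..M. (p i - of_bool (i \<in> U)) * f i)"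
  proof (rule sum_mono)
    fix i assume i: "i \<in> {1..M}"
    show "(p i - of_bool (i \<in> U)) * t \<le> (p i - of_bool (i \<in> U)) * f i"
      using p[OF i] lo[of i] hi[of i] i
      by (cases "i \<in> U") (auto intro: mult_left_mono_neg mult_left_mono)
  qed
  also have "\<dots> = (\<Sum>i=1..M. p i * f i) - (\<Sum>i\<in>U. f i)"
  proof -
    have "(\<Sum>i=1..M. of_bool (i \<in> U) * f i) = (\<Sum>i\<in>U. f i)"
      using U(1) by (intro sum.mono_neutral_cong_right) auto
    then show ?thesis by (simp add: left_diff_distrib sum_subtractf)
  qed
  finally show ?thesis using U(3) by simp
qed

lemma smallest_sum_le:
  fixes f :: "nat \<Rightarrow> real"
  assumes k: "1 \<le> k" "k \<le> M" and U: "U \<subseteq> {1..M}" "card U = k"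
  shows "(\<Sum>i=1..k. sort (map f [1..<Suc M]) ! (i - 1)) \<le> (\<Sum>i\<in>U. f i)"
proof -
  have "(\<Sum>i=1..M. of_bool (i \<in> U) * f i) = (\<Sum>i\<in>U. f i)"
    using U(1) by (intro sum.mono_neutral_cong_right) auto
  moreover have "(\<Sum>i=1..M. of_bool (i \<in> U)) = real k"
    using U by (simp add: Int_absorb1)
  ultimately show ?thesis
    using smallest_sum_le_weighted[OF k, of "\<lambda>i. of_bool (i \<in> U)" f] by simp
qed

lemma smallest_sum_eq_Min:
  fixes f :: "nat \<Rightarrow> real"
  assumes k: "1 \<le> k" "k \<le> M"
  shows "(\<Sum>i=1..k. sort (map f [1..<Suc M]) ! (i - 1))
    = Min ((\<lambda>U. \<Sum>i\<in>U. f i) ` {U. U \<subseteq> {1..M} \<and> card U = k})"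
proof (rule Min_eqI[symmetric])
  show "finite ((\<lambda>U. \<Sum>i\<in>U. f i) ` {U. U \<subseteq> {1..M} \<and> card U = k})"
    by (rule finite_imageI, rule finite_subset[of _ "Pow {1..M}"]) auto
  show "\<And>y. y \<in> (\<lambda>U. \<Sum>i\<in>U. f i) ` {U. U \<subseteq> {1..M} \<and> card U = k} \<Longrightarrow>
      (\<Sum>i=1..k. sort (map f [1..<Suc M]) ! (i - 1)) \<le> y"
    using smallest_sum_le[OF k, of _ f] by auto
  obtain U t where "U \<subseteq> {1..M}" "card U = k"
    "(\<Sum>i=1..k. sort (map f [1..<Suc M]) ! (i - 1)) = (\<Sum>i\<in>U. f i)"
    using smallest_sum_exists[OF k, of f] by metis
  then show "(\<Sum>i=1..k. sort (map f [1..<Suc M]) ! (i - 1))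
      \<in> (\<lambda>U. \<Sum>i\<in>U. f i) ` {U. U \<subseteq> {1..M} \<and> card U = k}"
    by auto
qed

section \<open>Optimality of the greedy allocation\<close>

text \<open>
  In terms of the levels \<open>w\<^sub>i = c\<^sub>i L\<^sub>i\<close>, raising the common level of the sources \<open>u + 1, \<dots>, N\<close> by one
  unit costs \<open>S u\<close> and gains \<open>\<kappa> - u\<close>, so \<open>rho \<kappa> L u\<close> is its gain per unit of budget; for a single
  source \<open>i \<le> u\<close> the gain per unit of budget is \<open>L\<^sub>i\<close>.  The algorithm always spends on the better of
  the two, and its marginal gain \<open>\<theta>\<close> is a Lagrange multiplier for the budget.
\<close>

locale allocation =
  fixes \<kappa> :: nat and K :: real and L :: "real list"
  assumes sorted_L: "sorted L" and pos_L: "\<And>l. l \<in> set L \<Longrightarrow> 0 < l"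
    and kappa: "1 \<le> \<kappa>" "\<kappa> \<le> length L" and K_pos: "0 < K"
begin

abbreviation "N \<equiv> length L"
abbreviation "E \<equiv> elem L"
abbreviation "S \<equiv> inv_sum L"
abbreviation "r \<equiv> rho \<kappa> L"

lemma E_0 [simp]: "E 0 = 0"
  by (simp add: elem_def)

lemma E_pos: "1 \<le> i \<Longrightarrow> i \<le> N \<Longrightarrow> 0 < E i"
  using pos_L[of "L ! (i - 1)"] by (cases i) (auto simp: elem_def)

lemma E_nonneg: "i \<le> N \<Longrightarrow> 0 \<le> E i"
  using E_pos[of i] by (cases i) auto

lemma E_mono: "i \<le> j \<Longrightarrow> j \<le> N \<Longrightarrow> E i \<le> E j"
  using sorted_nth_mono[OF sorted_L, of "i - 1" "j - 1"] E_nonneg[of j]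
  by (cases i; cases j) (auto simp: elem_def)

lemma S_Suc: "u < N \<Longrightarrow> S u = 1 / E (u + 1) + S (u + 1)"
  unfolding inv_sum_def by (simp add: sum.atLeast_Suc_atMost)

lemma S_nonneg: "0 \<le> S u"
  unfolding inv_sum_def by (intro sum_nonneg) (auto intro!: E_nonneg)

lemma S_pos: "u < N \<Longrightarrow> 0 < S u"
  using S_Suc[of u] S_nonneg[of "u + 1"] E_pos[of "u + 1"] by (simp add: add_pos_nonneg)

lemma harmonic_tail_eq: "u < N \<Longrightarrow> harmonic_tail L (u + 1) = real (N - u) / S u"
  unfolding harmonic_tail_def inv_sum_def by (simp add: Suc_diff_Suc)

lemma rho_eq: "u < \<kappa> \<Longrightarrow> r u = real (\<kappa> - u) / S u"
  using kappa harmonic_tail_eq[of u] by (simp add: rho_def)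

lemma rho_S: "u \<le> \<kappa> \<Longrightarrow> u < N \<Longrightarrow> r u * S u = real (\<kappa> - u)"
  using rho_eq[of u] S_pos[of u] by (cases "u = \<kappa>") (auto simp: rho_def)

lemma rho_pos: "u < \<kappa> \<Longrightarrow> 0 < r u"
  using rho_eq[of u] S_pos[of u] kappa by simp

lemma rho_nonneg: "0 \<le> r u"
  using rho_pos[of u] by (cases "u < \<kappa>") (auto simp: rho_def)

text \<open>
  Marginal gains decrease along the algorithm, as concavity of the optimal value in the budget
  requires.
\<close>

lemma rho_Suc_le:
  assumes "u < \<kappa>" "r u \<le> E (u + 1)"
  shows "r (u + 1) \<le> r u"
proof (cases "u + 1 = \<kappa>")
  case True
  then show ?thesis using rho_pos[OF assms(1)] by (simp add: rho_def)
next
  case False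
  with assms have u: "u + 1 < \<kappa>" by simp
  have e: "0 < E (u + 1)" using u kappa by (intro E_pos) auto
  have "r u * S (u + 1) = real (\<kappa> - u) - r u / E (u + 1)"
    using rho_S[of u] S_Suc[of u] u kappa by (simp add: algebra_simps)
  moreover have "r u / E (u + 1) \<le> 1" using assms(2) e by simp
  ultimately have "real (\<kappa> - (u + 1)) \<le> r u * S (u + 1)" using u by simp
  then show ?thesis
    using rho_eq[OF u] S_pos[of "u + 1"] u kappa by (simp add: divide_le_eq)
qed

text \<open>
  Weak duality: the minimum over \<open>\<kappa>\<close>-sets is replaced by the weights \<open>p\<close>, the budget constraint is
  priced at \<open>\<theta>\<close>, and each coordinate is then maximized over \<open>[0, 1]\<close> on its own.
\<close>

lemma max_min_rate_le:
  fixes p :: "nat \<Rightarrow> real"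
  assumes M: "N \<le> M" and p: "\<And>i. i \<in> {1..N} \<Longrightarrow> 0 \<le> p i \<and> p i \<le> 1"
    and sum_p: "(\<Sum>i=1..N. p i) = real \<kappa>" and \<theta>: "0 \<le> \<theta>"
  shows "max_min_rate M \<kappa> K L \<le> \<theta> * K + (\<Sum>i=1..N. max 0 (p i * E i - \<theta>))"
  unfolding max_min_rate_def
proof (rule cSUP_least)
  have "(\<lambda>i\<in>{1..M}. 0) \<in> budget_vectors M K"
    using K_pos by (simp add: budget_vectors_def)
  then show "budget_vectors M K \<noteq> {}" by blast
  fix c assume "c \<in> budget_vectors M K"
  then have c: "\<And>i. i \<in> {1..M} \<Longrightarrow> 0 \<le> c i" "\<And>i. i \<in> {1..M} \<Longrightarrow> c i \<le> 1"
    and sum_c: "(\<Sum>i=1..M. c i) \<le> K"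
    by (auto simp: budget_vectors_def PiE_def Pi_def)
  have "(\<Sum>i=1..N. c i) \<le> (\<Sum>i=1..M. c i)"
    using M c by (intro sum_mono2) auto
  with sum_c have sum_cN: "(\<Sum>i=1..N. c i) \<le> K" by simp
  have "Min ((\<lambda>U. \<Sum>i\<in>U. c i * E i) ` {U. U \<subseteq> {1..N} \<and> card U = \<kappa>})
      \<le> (\<Sum>i=1..N. p i * (c i * E i))"
    using smallest_sum_le_weighted[OF kappa p sum_p, of "\<lambda>i. c i * E i"]
    by (simp only: smallest_sum_eq_Min[OF kappa])
  also have "\<dots> \<le> (\<Sum>i=1..N. \<theta> * c i + max 0 (p i * E i - \<theta>))"
  proof (rule sum_mono)
    fix i assume "i \<in> {1..N}"
    with M have "0 \<le> c i" "c i \<le> 1" using c by auto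
    then have "c i * (p i * E i - \<theta>) \<le> max 0 (p i * E i - \<theta>)"
      by (cases "0 \<le> p i * E i - \<theta>")
        (auto simp: max_def mult_left_le_one_le mult_nonneg_nonpos)
    then show "p i * (c i * E i) \<le> \<theta> * c i + max 0 (p i * E i - \<theta>)"
      by (simp add: algebra_simps)
  qed
  also have "\<dots> \<le> \<theta> * K + (\<Sum>i=1..N. max 0 (p i * E i - \<theta>))"
    using mult_left_mono[OF sum_cN \<theta>] by (simp add: sum.distrib sum_distrib_left)
  finally show "Min ((\<lambda>U. \<Sum>i\<in>U. c i * E i) ` {U. U \<subseteq> {1..N} \<and> card U = \<kappa>})
      \<le> \<theta> * K + (\<Sum>i=1..N. max 0 (p i * E i - \<theta>))" .
qed

lemma sum_split3:
  fixes f :: "nat \<Rightarrow> real"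
  assumes "1 \<le> u" "u \<le> N"
  shows "(\<Sum>i=1..N. f i) = (\<Sum>i=1..<u. f i) + f u + (\<Sum>i=u+1..N. f i)"
proof -
  have "{1..N} = ({1..<u} \<union> {u}) \<union> {u+1..N}" using assms by auto
  then have "(\<Sum>i=1..N. f i) = (\<Sum>i\<in>({1..<u} \<union> {u}) \<union> {u+1..N}. f i)" by simp
  also have "\<dots> = (\<Sum>i\<in>{1..<u} \<union> {u}. f i) + (\<Sum>i=u+1..N. f i)"
    by (intro sum.union_disjoint) auto
  also have "(\<Sum>i\<in>{1..<u} \<union> {u}. f i) = (\<Sum>i=1..<u. f i) + f u"
    by (subst sum.union_disjoint) auto
  finally show ?thesis .
qed

text \<open>
  The dual solution that belongs to a state \<open>(u, v)\<close> of the algorithm with marginal gain \<open>\<theta>\<close>.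
  Sources below \<open>u\<close> get full weight, sources above \<open>u\<close> the weight \<open>\<theta> / L\<^sub>i\<close> that makes their
  coefficient vanish, and source \<open>u\<close>, the one whose level ties with the common level, takes up what
  is left.  The bounds \<open>rho u \<le> \<theta> \<le> rho (u - 1)\<close> say exactly that this remainder lies between
  \<open>\<theta> / L\<^sub>u\<close> and \<open>1\<close>.
\<close>

lemma max_min_rate_le_threshold:
  assumes M: "N \<le> M" and uv: "1 \<le> v" "v \<le> u" "u \<le> \<kappa>"
    and theta: "E (v - 1) \<le> \<theta>" "\<theta> \<le> E v" "r u \<le> \<theta>" "\<theta> \<le> r (u - 1)"
  shows "max_min_rate M \<kappa> K L \<le> \<theta> * K + (\<Sum>i=v..<u. E i - \<theta>)
           + ((real (\<kappa> - (u - 1)) - \<theta> * S u) * E u - \<theta>)"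
proof -
  define q where "q = real (\<kappa> - (u - 1)) - \<theta> * S u"
  define p where "p = (\<lambda>i. if i < u then 1 else if i = u then q else \<theta> / E i)"
  have \<theta>: "0 \<le> \<theta>" using rho_nonneg[of u] theta(3) by simp
  have u: "1 \<le> u" "u \<le> N" "u - 1 < \<kappa>" "u - 1 < N" using uv kappa by auto
  have Eu: "0 < E u" using E_pos u by simp
  have \<theta>_le: "\<theta> \<le> E i" if "v \<le> i" "i \<le> N" for i
    using theta(2) E_mono[OF that] by simp
  have q_le: "q \<le> 1"
  proof (cases "u < N")
    case True
    then have "real (\<kappa> - u) \<le> \<theta> * S u"
      using rho_S[of u] uv mult_right_mono[OF theta(3) S_nonneg[of u]] by simp
    then show ?thesis using u uv by (simp add: q_def of_nat_diff)
  next
    case False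
    then have "u = N" "\<kappa> = N" using u uv kappa by auto
    then show ?thesis using u by (simp add: q_def inv_sum_def)
  qed
  have "\<theta> * S (u - 1) \<le> real (\<kappa> - (u - 1))"
    using rho_S[of "u - 1"] u mult_right_mono[OF theta(4) S_nonneg[of "u - 1"]] by simp
  then have q_ge: "\<theta> / E u \<le> q"
    using S_Suc[of "u - 1"] u by (simp add: q_def algebra_simps)
  have q_0: "0 \<le> q" using q_ge \<theta> Eu by (meson divide_nonneg_pos order_trans)
  have p: "0 \<le> p i \<and> p i \<le> 1" if "i \<in> {1..N}" for i
    using that \<theta> q_le q_0 \<theta>_le[of i] E_pos[of i] uv by (auto simp: p_def)
  have tail: "(\<Sum>i=u+1..N. p i) = \<theta> * S u"
    by (simp add: p_def inv_sum_def sum_distrib_left)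
  have "(\<Sum>i=1..N. p i) = (\<Sum>i=1..<u. p i) + p u + (\<Sum>i=u+1..N. p i)"
    using u by (intro sum_split3)
  also have "\<dots> = real \<kappa>"
    unfolding tail using u uv by (simp add: p_def q_def of_nat_diff)
  finally have sum_p: "(\<Sum>i=1..N. p i) = real \<kappa>" .
  have "(\<Sum>i=1..N. max 0 (p i * E i - \<theta>)) = (\<Sum>i=1..<u. max 0 (p i * E i - \<theta>))
      + max 0 (p u * E u - \<theta>) + (\<Sum>i=u+1..N. max 0 (p i * E i - \<theta>))"
    using u by (intro sum_split3)
  also have "(\<Sum>i=u+1..N. max 0 (p i * E i - \<theta>)) = 0"
  proof (rule sum.neutral, rule ballI)
    fix i assume i: "i \<in> {u+1..N}"
    then have "E i \<noteq> 0" using E_pos[of i] by simp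
    then show "max 0 (p i * E i - \<theta>) = 0" using i by (simp add: p_def)
  qed
  also have "max 0 (p u * E u - \<theta>) = q * E u - \<theta>"
    using q_ge Eu by (simp add: p_def divide_le_eq)
  also have "(\<Sum>i=1..<u. max 0 (p i * E i - \<theta>)) = (\<Sum>i=v..<u. E i - \<theta>)"
  proof (rule sum.mono_neutral_cong_right)
    show "\<forall>i\<in>{1..<u} - {v..<u}. max 0 (p i * E i - \<theta>) = 0"
    proof
      fix i assume "i \<in> {1..<u} - {v..<u}"
      then have "E i \<le> E (v - 1)" "i < u" using u uv by (auto intro!: E_mono)
      then show "max 0 (p i * E i - \<theta>) = 0" using theta(1) by (simp add: p_def)
    qed
    show "max 0 (p i * E i - \<theta>) = E i - \<theta>" if "i \<in> {v..<u}" for i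
      using that \<theta>_le[of i] u by (simp add: p_def)
  qed (use uv in auto)
  finally show ?thesis
    using max_min_rate_le[OF M p sum_p \<theta>] by (simp add: q_def algebra_simps)
qed

text \<open>
  The multiplier \<open>\<theta>\<close> certifies that the budget spent so far is spent optimally.  With budget left, the
  common level equals \<open>L\<^sub>u\<close>, so \<open>z = L\<^sub>u S\<^sub>u\<close>; a level strictly between \<open>L\<^sub>u\<close> and \<open>L\<^bsub>u+1\<^esub>\<close>, or a
  fractional \<open>x\<close>, can only occur once the budget is exhausted, and then \<open>\<theta>\<close> is determined.
\<close>

definition loop_inv :: "alloc_state \<Rightarrow> bool" where
  "loop_inv = (\<lambda>(x, u, v, z, B).
     1 \<le> v \<and> v \<le> u \<and> u \<le> \<kappa> \<and> 0 \<le> B \<and> 0 \<le> x \<and> x \<le> 1 \<and>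
     K = B + x + real (u - v + 1) + z \<and>
     (\<exists>\<theta>. E (v - 1) \<le> \<theta> \<and> \<theta> \<le> E v \<and> r u \<le> \<theta> \<and> \<theta> \<le> r (u - 1) \<and>
        (x = 0 \<or> B = 0 \<and> \<theta> = E (v - 1)) \<and>
        (z = E u * S u \<or> B = 0 \<and> u < \<kappa> \<and> \<theta> = r u \<and> E u * S u \<le> z)))"

text \<open>
  Every iteration that does not exhaust the budget moves \<open>u\<close> up towards \<open>\<kappa>\<close> or \<open>v\<close> down.
\<close>

definition alloc_measure :: "alloc_state \<Rightarrow> nat" where
  "alloc_measure = (\<lambda>(x, u, v, z, B). if B \<le> 0 then 0 else Suc (\<kappa> - u + v))"

lemma step_level_inv:
  assumes loop_inv: "loop_inv (0, u, v, E u * S u, B)" and less: "E (v - 1) < r u" and ge: "r u \<le> E v"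
  shows "loop_inv (step_level \<kappa> L (0, u, v, E u * S u, B))"
    and "alloc_measure (step_level \<kappa> L (0, u, v, E u * S u, B)) < Suc (\<kappa> - u + v)"
proof -
  have uv: "1 \<le> v" "v \<le> u" "u \<le> \<kappa>" and B: "0 \<le> B"
    and K: "K = B + real (u - v + 1) + E u * S u"
    and rr: "r u \<le> r (u - 1)"
    using loop_inv by (auto simp: loop_inv_def)
  have "v - 1 \<le> N" using uv kappa by simp
  then have "r u \<noteq> 0" using less E_nonneg[of "v - 1"] by simp
  then have u: "u < \<kappa>" using uv by (auto simp: rho_def split: if_splits)
  then have uN: "u < N" using kappa by simp
  define w where "w = E (u + 1) * S u - E u * S u"
  have w: "0 \<le> w" using E_mono[of u "u + 1"] uN S_nonneg[of u]
    by (simp add: w_def mult_right_mono)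
  have e1: "0 < E (u + 1)" using E_pos uN by simp
  have ESuc: "E (u + 1) * S (u + 1) = E (u + 1) * S u - 1"
    using S_Suc[OF uN] e1 by (simp add: algebra_simps)
  have r_le: "r u \<le> E (u + 1)"
    using ge E_mono[of v "u + 1"] uv uN by simp
  have step: "step_level \<kappa> L (0, u, v, E u * S u, B) =
     (if w \<le> B then (0, u + 1, v, E (u + 1) * S (u + 1), B - w) else (0, u, v, E u * S u + B, 0))"
    using less by (simp add: step_level_def w_def Let_def min_def)
  show "loop_inv (step_level \<kappa> L (0, u, v, E u * S u, B))"
  proof (cases "w \<le> B")
    case True
    have "K = B - w + real (u + 1 - v + 1) + E (u + 1) * S (u + 1)"
      using K ESuc uv by (simp add: w_def of_nat_diff)
    then show ?thesis
      unfolding step loop_inv_def prod.case using True uv u less ge rho_Suc_le[OF u r_le]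
      by (simp only: if_True prod.case) (intro conjI exI[of _ "r u"]; simp)
  next
    case False
    then show ?thesis
      unfolding step loop_inv_def prod.case using uv u less ge K B rr
      by (simp only: if_False prod.case) (intro conjI exI[of _ "r u"]; simp)
  qed
  show "alloc_measure (step_level \<kappa> L (0, u, v, E u * S u, B)) < Suc (\<kappa> - u + v)"
    unfolding step using u by (auto simp: alloc_measure_def)
qed

text \<open>
  The bound on \<open>K\<close> excludes the state \<open>u = \<kappa>\<close>, \<open>v = 1\<close> with budget left, in which nothing useful
  remains to be bought; this is what keeps the index \<open>v - 1\<close> and the level step within range.
\<close>

lemma step_inv:
  assumes loop_inv: "loop_inv s" and pos: "case s of (x, u, v, z, B) \<Rightarrow> 0 < B"
    and K_small: "K < real \<kappa> + E \<kappa> * S \<kappa>"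
  shows "loop_inv (step_level \<kappa> L (step_top \<kappa> L s))
    \<and> alloc_measure (step_level \<kappa> L (step_top \<kappa> L s)) < alloc_measure s"
proof -
  obtain x u v z B where s: "s = (x, u, v, z, B)" by (cases s)
  have B: "0 < B" using pos by (simp add: s)
  from loop_inv B obtain \<theta> where uv: "1 \<le> v" "v \<le> u" "u \<le> \<kappa>"
    and K: "K = B + real (u - v + 1) + z" and x: "x = 0" and z: "z = E u * S u"
    and \<theta>: "E (v - 1) \<le> \<theta>" "\<theta> \<le> E v" "r u \<le> \<theta>" "\<theta> \<le> r (u - 1)"
    by (auto simp: loop_inv_def s)
  have meas: "alloc_measure s = Suc (\<kappa> - u + v)" using B by (simp add: s alloc_measure_def)
  have not_last: "\<not> (u = \<kappa> \<and> v = 1)"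
    using K_small K B z kappa by auto
  show ?thesis
  proof (cases "r u \<le> E (v - 1) \<or> u = \<kappa>")
    case True
    have top: "r u \<le> E (v - 1)"
      using True E_nonneg[of "v - 1"] uv kappa by (auto simp: rho_def)
    have v: "2 \<le> v"
    proof (rule ccontr)
      assume "\<not> 2 \<le> v"
      with uv have "v = 1" by simp
      with top not_last uv rho_pos[of u] show False by auto
    qed
    show ?thesis
    proof (cases "1 \<le> B")
      case True
      have st: "step_top \<kappa> L s = (0, u, v - 1, E u * S u, B - 1)"
        using True top x z by (simp add: step_top_def s)
      have E2: "E (v - 1 - 1) \<le> E (v - 1)"
        using uv kappa by (intro E_mono) auto
      have loop_inv': "loop_inv (0, u, v - 1, E u * S u, B - 1)"
      proof -
        have "K = B - 1 + 0 + real (u - (v - 1) + 1) + E u * S u"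
          using K z v uv by (simp add: of_nat_diff)
        moreover have "\<exists>\<theta>. E (v - 1 - 1) \<le> \<theta> \<and> \<theta> \<le> E (v - 1) \<and> r u \<le> \<theta> \<and> \<theta> \<le> r (u - 1)"
          using E2 top \<theta> by (intro exI[of _ "E (v - 1)"]) auto
        ultimately show ?thesis
          using v uv True unfolding loop_inv_def by auto
      qed
      have m': "alloc_measure (0, u, v - 1, E u * S u, B - 1) < Suc (\<kappa> - u + v)"
        using v by (auto simp: alloc_measure_def)
      show ?thesis
      proof (cases "E (v - 1 - 1) < r u")
        case less: True
        from step_level_inv[OF loop_inv' less top] v uv
        show ?thesis unfolding st meas by simp
      next
        case False
        have "v - 1 \<noteq> 1"
        proof
          assume v1: "v - 1 = 1"
          with False rho_pos[of u] uv have "u = \<kappa>" by fastforce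
          with v1 K z K_small True kappa show False by (simp add: of_nat_diff)
        qed
        with False have "step_level \<kappa> L (0, u, v - 1, E u * S u, B - 1) = (0, u, v - 1, E u * S u, B - 1)"
          by (simp add: step_level_def)
        with loop_inv' m' show ?thesis unfolding st meas by simp
      qed
    next
      case False
      have st: "step_top \<kappa> L s = (B, u, v, E u * S u, 0)"
        using False top x z by (simp add: step_top_def s)
      have "step_level \<kappa> L (B, u, v, E u * S u, 0) = (B, u, v, E u * S u, 0)"
        using top v by (simp add: step_level_def)
      moreover have "loop_inv (B, u, v, E u * S u, 0)"
        unfolding loop_inv_def prod.case using uv False B K z \<theta> top
        by (intro conjI exI[of _ "E (v - 1)"]; simp)
      ultimately show ?thesis unfolding st meas by (simp add: alloc_measure_def)
    qed
  next
    case False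
    have st: "step_top \<kappa> L s = (0, u, v, E u * S u, B)"
      using False x z by (auto simp: step_top_def s)
    have "loop_inv (0, u, v, E u * S u, B)" using loop_inv by (simp add: s x z)
    moreover have "E (v - 1) < r u" using False by auto
    moreover have "r u \<le> E v" using \<theta> by simp
    ultimately show ?thesis
      using step_level_inv[of u v B] B unfolding st meas by simp
  qed
qed

text \<open>
  Compared with the level \<open>l\<close>, sources up to \<open>u\<close> contribute non-positive differences and the others
  none, so leaving out a source up to \<open>u\<close> cannot decrease the sum.
\<close>

lemma sum_ge_level:
  fixes w :: "nat \<Rightarrow> real"
  assumes U: "U \<subseteq> {1..N}" "card U = \<kappa>" and u: "u \<le> \<kappa>"
    and low: "\<And>i. i \<in> {1..u} \<Longrightarrow> w i \<le> l" and high: "\<And>i. i \<in> {u+1..N} \<Longrightarrow> w i = l"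
  shows "(\<Sum>i=1..u. w i) + real (\<kappa> - u) * l \<le> (\<Sum>i\<in>U. w i)"
proof -
  have fin: "finite U" using U(1) finite_subset by blast
  have "(\<Sum>i=1..u. w i - l) = - (\<Sum>i=1..u. l - w i)"
    by (simp add: sum_negf[symmetric])
  also have "\<dots> \<le> - (\<Sum>i\<in>U \<inter> {1..u}. l - w i)"
    using low by (intro le_imp_neg_le sum_mono2) auto
  also have "(\<Sum>i\<in>U \<inter> {1..u}. l - w i) = (\<Sum>i\<in>U. l - w i)"
  proof (rule sum.mono_neutral_left)
    show "\<forall>i\<in>U - U \<inter> {1..u}. l - w i = 0"
    proof
      fix i assume "i \<in> U - U \<inter> {1..u}"
      then have "i \<in> {u+1..N}" using U(1) by auto
      then show "l - w i = 0" using high[of i] by simp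
    qed
  qed (use fin in auto)
  also have "- (\<Sum>i\<in>U. l - w i) = (\<Sum>i\<in>U. w i) - real \<kappa> * l"
    using U(2) by (simp add: sum_subtractf)
  finally show ?thesis
    using u by (simp add: sum_subtractf of_nat_diff algebra_simps)
qed

text \<open>
  Complementary slackness: the value of the computed vector equals the dual bound for the multiplier
  kept in the invariant.
\<close>

lemma final_state_optimal:
  assumes M: "N \<le> M" and loop_inv: "loop_inv (x, u, v, z, B)" and B: "\<not> 0 < B"
    and params: "alloc_params \<kappa> K L = (x, z / real (N - u), u, v)"
    and U: "U \<subseteq> {1..N}" "card U = \<kappa>"
  shows "max_min_rate M \<kappa> K L \<le> (\<Sum>i\<in>U. c_prime \<kappa> K L i * E i)"
proof -
  from loop_inv B obtain \<theta> where uv: "1 \<le> v" "v \<le> u" "u \<le> \<kappa>" and x: "0 \<le> x" "x \<le> 1"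
    and K: "K = x + real (u - v + 1) + z"
    and \<theta>: "E (v - 1) \<le> \<theta>" "\<theta> \<le> E v" "r u \<le> \<theta>" "\<theta> \<le> r (u - 1)"
    and x\<theta>: "x = 0 \<or> \<theta> = E (v - 1)"
    and z: "z = E u * S u \<or> u < \<kappa> \<and> \<theta> = r u \<and> E u * S u \<le> z"
    by (auto simp: loop_inv_def)
  have u: "1 \<le> u" "u \<le> N" using uv kappa by auto
  define l where "l = (if u < \<kappa> then z / S u else E \<kappa>)"
  define w where "w = (\<lambda>i. c_prime \<kappa> K L i * E i)"
  have l_ge: "E u \<le> l"
  proof (cases "u < \<kappa>")
    case True
    then have "0 < S u" using kappa by (intro S_pos) simp
    with z True show ?thesis by (auto simp: l_def le_divide_eq)
  next
    case False
    with uv show ?thesis by (simp add: l_def)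
  qed
  have high: "w i = l" if "i \<in> {u+1..N}" for i
  proof -
    have "u < N" "E i \<noteq> 0" using that E_pos[of i] by auto
    then show ?thesis
      using that params harmonic_tail_eq[of u] unfolding w_def l_def
      by (auto simp: c_prime_def)
  qed
  have w_low: "w i = (if v \<le> i then E i else if i + 1 = v then x * E i else 0)" if "i \<in> {1..u}" for i
    using that params u uv by (auto simp: w_def c_prime_def)
  have low: "w i \<le> l" if i: "i \<in> {1..u}" for i
  proof -
    have "0 \<le> E i" "E i \<le> E u" using i u by (auto intro!: E_nonneg E_mono)
    moreover have "x * E i \<le> E i" using x \<open>0 \<le> E i\<close> by (simp add: mult_left_le_one_le)
    ultimately show ?thesis using l_ge by (auto simp: w_low[OF i])
  qed
  have "(\<Sum>i=1..u. w i) = (\<Sum>i\<in>{v..u} \<union> {v-1}. if v \<le> i then E i else x * E i)"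
  proof (rule sum.mono_neutral_cong)
    show "w i = 0" if "i \<in> {1..u} - ({v..u} \<union> {v-1})" for i
    proof -
      have "i \<in> {1..u}" using that by simp
      then show ?thesis using w_low[of i] that by auto
    qed
    show "(if v \<le> i then E i else x * E i) = 0" if "i \<in> {v..u} \<union> {v-1} - {1..u}" for i
    proof -
      have "i = 0" using that uv by auto
      then show ?thesis by simp
    qed
    show "w i = (if v \<le> i then E i else x * E i)" if "i \<in> {1..u} \<inter> ({v..u} \<union> {v-1})" for i
    proof -
      have "i \<in> {1..u}" using that by simp
      then show ?thesis using w_low[of i] that uv by auto
    qed
  qed auto
  also have "\<dots> = (\<Sum>i=v..u. E i) + x * E (v - 1)"
    using uv by (subst sum.union_disjoint) auto
  also have "(\<Sum>i=v..u. E i) = (\<Sum>i=v..<u. E i) + E u"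
    using uv by (simp add: sum.last_plus atLeastLessThanSuc_atLeastAtMost[symmetric])
  finally have sum_low: "(\<Sum>i=1..u. w i) = (\<Sum>i=v..<u. E i) + E u + x * E (v - 1)" .
  define q where "q = real (\<kappa> - (u - 1)) - \<theta> * S u"
  have "max_min_rate M \<kappa> K L \<le> \<theta> * K + (\<Sum>i=v..<u. E i - \<theta>) + (q * E u - \<theta>)"
    unfolding q_def by (rule max_min_rate_le_threshold[OF M uv \<theta>])
  also have "\<dots> = x * \<theta> + (\<theta> * z + q * E u) + (\<Sum>i=v..<u. E i)"
    using uv by (simp add: K sum_subtractf of_nat_diff algebra_simps)
  also have "x * \<theta> = x * E (v - 1)" using x\<theta> by auto
  also have "\<theta> * z + q * E u = real (\<kappa> - u) * l + E u"
    using z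
  proof
    assume z: "z = E u * S u"
    have l: "real (\<kappa> - u) * l = real (\<kappa> - u) * E u"
      using z S_pos[of u] kappa by (auto simp: l_def)
    have "\<theta> * z + q * E u = real (\<kappa> - (u - 1)) * E u"
      by (simp add: z q_def algebra_simps)
    also have "\<dots> = real (\<kappa> - u) * E u + E u"
      using u uv by (simp add: of_nat_diff algebra_simps)
    finally show ?thesis unfolding l .
  next
    assume z: "u < \<kappa> \<and> \<theta> = r u \<and> E u * S u \<le> z"
    then have "\<theta> * S u = real (\<kappa> - u)" using rho_S[of u] kappa by simp
    moreover have "\<theta> * z = real (\<kappa> - u) * l" using z rho_eq[of u] by (simp add: l_def)
    moreover have "q = 1" using calculation(1) u uv by (simp add: q_def of_nat_diff)
    ultimately show ?thesis by simp
  qed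
  finally have "max_min_rate M \<kappa> K L \<le> (\<Sum>i=1..u. w i) + real (\<kappa> - u) * l"
    using sum_low by simp
  also have "\<dots> \<le> (\<Sum>i\<in>U. w i)"
    by (rule sum_ge_level[OF U uv(3) low high])
  finally show ?thesis by (simp add: w_def)
qed

text \<open>
  Each outcome of the algorithm is matched with a dual solution of the same value.
\<close>

theorem c_prime_optimal:
  assumes M: "N \<le> M" and U: "U \<subseteq> {1..N}" "card U = \<kappa>"
  shows "max_min_rate M \<kappa> K L \<le> (\<Sum>i\<in>U. c_prime \<kappa> K L i * E i)"
proof -
  define us where "us = u_star \<kappa> L"
  have "us \<in> {u \<in> {..<\<kappa>}. E u \<le> r u}"
    unfolding us_def u_star_def using kappa rho_nonneg[of 0] by (intro Max_in) (auto intro!: exI[of _ 0])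
  then have us: "us < \<kappa>" "E us \<le> r us" by auto
  have usN: "us < N" using us kappa by simp
  have e1: "0 < E (us + 1)" using usN by (intro E_pos) auto
  \<comment> \<open>Maximality of \<open>us\<close> means that beyond it a full source is better than the common level.\<close>
  have r_le: "r us \<le> E (us + 1)"
  proof (cases "us + 1 < \<kappa>")
    case True
    have "\<not> E (us + 1) \<le> r (us + 1)"
    proof
      assume "E (us + 1) \<le> r (us + 1)"
      then have "us + 1 \<le> us"
        unfolding us_def u_star_def using True by (intro Max_ge) (auto simp: us_def u_star_def)
      then show False by simp
    qed
    then have "r (us + 1) * S (us + 1) \<le> E (us + 1) * S (us + 1)"
      using S_nonneg by (intro mult_right_mono) auto
    then have "real (\<kappa> - (us + 1)) \<le> E (us + 1) * S (us + 1)"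
      using rho_S[of "us + 1"] True kappa by simp
    also have "\<dots> = E (us + 1) * S us - 1"
      using S_Suc[OF usN] e1 by (simp add: algebra_simps)
    finally have "real (\<kappa> - us) \<le> E (us + 1) * S us" using us by (simp add: of_nat_diff)
    then show ?thesis using rho_eq[OF us(1)] S_pos[OF usN] by (simp add: divide_le_eq)
  next
    case False
    then have "\<kappa> - us = 1" using us by simp
    moreover have "1 / S us \<le> E (us + 1)"
      using S_Suc[OF usN] S_nonneg[of "us + 1"] e1 S_pos[OF usN]
      by (simp add: divide_le_eq algebra_simps)
    ultimately show ?thesis using rho_eq[OF us(1)] by simp
  qed
  consider (full) "real \<kappa> + E \<kappa> * S \<kappa> \<le> K"
    | (low) "\<not> real \<kappa> + E \<kappa> * S \<kappa> \<le> K" "K < E (us + 1) * S us"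
    | (loop) "\<not> real \<kappa> + E \<kappa> * S \<kappa> \<le> K" "\<not> K < E (us + 1) * S us"
    by blast
  then show ?thesis
  proof cases
    case full
    then have params: "alloc_params \<kappa> K L = (0, 0, \<kappa>, 1)" by (simp add: alloc_params_def)
    \<comment> \<open>More budget would be useless, so the multiplier is \<open>0\<close>.\<close>
    define p where "p = (\<lambda>i. if i \<le> \<kappa> then 1 else 0 :: real)"
    have "(\<Sum>i=1..N. p i) = (\<Sum>i=1..\<kappa>. 1)"
      unfolding p_def using kappa by (intro sum.mono_neutral_cong_right) auto
    then have sum_p: "(\<Sum>i=1..N. p i) = real \<kappa>" by simp
    have "max_min_rate M \<kappa> K L \<le> 0 * K + (\<Sum>i=1..N. max 0 (p i * E i - 0))"
      by (rule max_min_rate_le[OF M _ sum_p]) (auto simp: p_def)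
    also have "\<dots> = (\<Sum>i=1..N. max 0 (p i * E i))" by simp
    also have "\<dots> = (\<Sum>i=1..\<kappa>. E i)"
      using kappa E_nonneg by (intro sum.mono_neutral_cong_right) (auto simp: p_def)
    also have "\<dots> = (\<Sum>i=1..\<kappa>. c_prime \<kappa> K L i * E i)"
      using kappa by (intro sum.cong) (auto simp: c_prime_def params)
    also have "\<dots> = (\<Sum>i=1..\<kappa>. c_prime \<kappa> K L i * E i) + real (\<kappa> - \<kappa>) * E \<kappa>" by simp
    also have "\<dots> \<le> (\<Sum>i\<in>U. c_prime \<kappa> K L i * E i)"
    proof (rule sum_ge_level[OF U order_refl])
      show "c_prime \<kappa> K L i * E i \<le> E \<kappa>" if "i \<in> {1..\<kappa>}" for i
        using that kappa E_mono[of i \<kappa>] by (auto simp: c_prime_def params)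
      show "c_prime \<kappa> K L i * E i = E \<kappa>" if "i \<in> {\<kappa>+1..N}" for i
        using that kappa E_pos[of i] by (auto simp: c_prime_def params)
    qed
    finally show ?thesis .
  next
    case low
    then have params: "alloc_params \<kappa> K L = (0, K / real (N - us), us, 0)"
      by (simp add: alloc_params_def us_def Let_def)
    \<comment> \<open>The budget does not lift the common level to \<open>L\<close> at \<open>us + 1\<close>; the multiplier is \<open>rho us\<close>.\<close>
    define p where "p = (\<lambda>i. if i \<le> us then 1 else r us / E i)"
    have p: "0 \<le> p i \<and> p i \<le> 1" if i: "i \<in> {1..N}" for i
    proof (cases "i \<le> us")
      case False
      then have "r us \<le> E i" using i r_le E_mono[of "us + 1" i] by simp
      then show ?thesis using False i E_pos[of i] rho_nonneg[of us] by (simp add: p_def)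
    qed (simp add: p_def)
    have split: "(\<Sum>i=1..N. f i) = (\<Sum>i=1..us. f i) + (\<Sum>i=us+1..N. f i)" for f :: "nat \<Rightarrow> real"
      using usN by (metis Suc_eq_plus1 add.commute le_add1 less_imp_le sum.ub_add_nat le_add_diff_inverse)
    have "(\<Sum>i=us+1..N. p i) = r us * S us"
      by (simp add: p_def inv_sum_def sum_distrib_left)
    also have "\<dots> = real (\<kappa> - us)" using rho_S[of us] us usN by simp
    finally have sum_p: "(\<Sum>i=1..N. p i) = real \<kappa>"
      using us unfolding split by (simp add: p_def of_nat_diff)
    have "max_min_rate M \<kappa> K L \<le> r us * K + (\<Sum>i=1..N. max 0 (p i * E i - r us))"
      by (rule max_min_rate_le[OF M p sum_p rho_nonneg])
    also have "(\<Sum>i=1..N. max 0 (p i * E i - r us)) = 0"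
    proof (rule sum.neutral, rule ballI)
      fix i assume i: "i \<in> {1..N}"
      then have "E i \<noteq> 0" using E_pos[of i] by simp
      then show "max 0 (p i * E i - r us) = 0"
        using us usN E_mono[of i us] by (auto simp: p_def)
    qed
    also have "r us * K + 0 = (\<Sum>i=1..us. c_prime \<kappa> K L i * E i) + real (\<kappa> - us) * (K / S us)"
      using usN rho_eq[OF us(1)] by (simp add: c_prime_def params)
    also have "\<dots> \<le> (\<Sum>i\<in>U. c_prime \<kappa> K L i * E i)"
    proof (rule sum_ge_level[OF U])
      show "us \<le> \<kappa>" using us by simp
      show "c_prime \<kappa> K L i * E i \<le> K / S us" if "i \<in> {1..us}" for i
        using that K_pos S_nonneg[of us] by (auto simp: c_prime_def params)
      show "c_prime \<kappa> K L i * E i = K / S us" if "i \<in> {us+1..N}" for i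
        using that us usN E_pos[of i] harmonic_tail_eq[of us] by (auto simp: c_prime_def params)
    qed
    finally show ?thesis .
  next
    case loop
    define s0 where "s0 = (0::real, us + 1, us + 1, E (us + 1) * S (us + 1), K - E (us + 1) * S us)"
    define body where "body = (\<lambda>s. step_level \<kappa> L (step_top \<kappa> L s))"
    define fin where "fin = while (\<lambda>(x, u, v, z, B). 0 < B) body s0"
    have "E (us + 1) * S us = E (us + 1) * S (us + 1) + 1"
      using S_Suc[OF usN] e1 by (simp add: algebra_simps)
    then have inv0: "loop_inv s0"
      using loop us r_le rho_Suc_le[OF us(1) r_le]
      by (auto simp: loop_inv_def s0_def intro!: exI[of _ "r us"])
    have fin: "loop_inv fin \<and> \<not> (case fin of (x, u, v, z, B) \<Rightarrow> 0 < B)"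
      unfolding fin_def
    proof (rule while_rule[where P = loop_inv and r = "inv_image less_than alloc_measure"])
      show "loop_inv s0" by (rule inv0)
      show "loop_inv (body s)" if "loop_inv s" "case s of (x, u, v, z, B) \<Rightarrow> 0 < B" for s
        using step_inv[OF that] loop by (simp add: body_def)
      show "(body s, s) \<in> inv_image less_than alloc_measure"
        if "loop_inv s" "case s of (x, u, v, z, B) \<Rightarrow> 0 < B" for s
        using step_inv[OF that] loop by (simp add: body_def)
    qed auto
    obtain x u v z B where f: "fin = (x, u, v, z, B)" by (cases fin)
    have "alloc_params \<kappa> K L = (x, z / real (N - u), u, v)"
      using loop f unfolding alloc_params_def fin_def s0_def body_def us_def by (simp add: Let_def)
    then show ?thesis
      using final_state_optimal[OF M _ _ _ U] fin by (auto simp: f)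
  qed
qed

end

section \<open>Information numbers and log-likelihood ratios\<close>

text \<open>
  A finite positive value of the extended divergence means that both its positive and its negative
  part are finite, since \<open>\<infinity> - \<infinity> = \<infinity>\<close> for extended reals.  The infinite values of \<open>log_ratio\<close> then
  live on a null set, and the real logarithm has the same integral.
\<close>

lemma divergence_finite:
  fixes p q :: "'a \<Rightarrow> real"
  assumes [measurable]: "p \<in> borel_measurable \<nu>" "q \<in> borel_measurable \<nu>"
    and nonneg: "\<And>x. x \<in> space \<nu> \<Longrightarrow> 0 \<le> p x" "\<And>x. x \<in> space \<nu> \<Longrightarrow> 0 \<le> q x"
    and fin: "0 < divergence \<nu> p q" "divergence \<nu> p q < \<infinity>"
  shows "AE x in \<nu>. 0 < p x \<longrightarrow> 0 < q x"
    and "integrable \<nu> (\<lambda>x. p x * ln (p x / q x))"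
    and "(\<integral>x. p x * ln (p x / q x) \<partial>\<nu>) = real_of_ereal (divergence \<nu> p q)"
proof -
  define a where "a = (\<integral>\<^sup>+x. e2ennreal (log_ratio (p x) (q x)) * ennreal (p x) \<partial>\<nu>)"
  define b where "b = (\<integral>\<^sup>+x. e2ennreal (- log_ratio (p x) (q x)) * ennreal (p x) \<partial>\<nu>)"
  have div: "divergence \<nu> p q = enn2ereal a - enn2ereal b"
    by (simp add: divergence_def a_def b_def)
  have [measurable]: "(\<lambda>x. log_ratio (p x) (q x)) \<in> borel_measurable \<nu>"
    unfolding log_ratio_def by measurable
  have ab: "a \<noteq> \<infinity>" "b \<noteq> \<infinity>"
    using fin unfolding div by (cases "enn2ereal a"; cases "enn2ereal b"; auto)+
  have "AE x in \<nu>. e2ennreal (log_ratio (p x) (q x)) * ennreal (p x) \<noteq> \<infinity>"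
    using ab(1) unfolding a_def by (intro nn_integral_PInf_AE) auto
  then show pos: "AE x in \<nu>. 0 < p x \<longrightarrow> 0 < q x"
  proof (rule AE_mp[OF _ AE_I2])
    fix x assume x: "x \<in> space \<nu>"
    show "e2ennreal (log_ratio (p x) (q x)) * ennreal (p x) \<noteq> \<infinity> \<longrightarrow> 0 < p x \<longrightarrow> 0 < q x"
      using nonneg[OF x]
      by (auto simp: log_ratio_def less_le ennreal_top_mult e2ennreal_infty)
  qed
  have a: "a = (\<integral>\<^sup>+x. ennreal (p x * ln (p x / q x)) \<partial>\<nu>)"
    unfolding a_def
  proof (rule nn_integral_cong_AE, rule AE_mp[OF pos AE_I2], rule impI)
    fix x assume "x \<in> space \<nu>" "0 < p x \<longrightarrow> 0 < q x"
    then show "e2ennreal (log_ratio (p x) (q x)) * ennreal (p x) = ennreal (p x * ln (p x / q x))"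
      using nonneg[of x] by (cases "p x = 0") (auto simp: log_ratio_def ennreal_mult' mult.commute e2ennreal_ereal)
  qed
  have b: "b = (\<integral>\<^sup>+x. ennreal (- (p x * ln (p x / q x))) \<partial>\<nu>)"
    unfolding b_def
  proof (rule nn_integral_cong_AE, rule AE_mp[OF pos AE_I2], rule impI)
    fix x assume "x \<in> space \<nu>" "0 < p x \<longrightarrow> 0 < q x"
    then show "e2ennreal (- log_ratio (p x) (q x)) * ennreal (p x) = ennreal (- (p x * ln (p x / q x)))"
      using nonneg[of x] ennreal_mult'[of "p x" "- ln (p x / q x)"]
      by (cases "p x = 0") (auto simp: log_ratio_def mult.commute e2ennreal_ereal)
  qed
  show int: "integrable \<nu> (\<lambda>x. p x * ln (p x / q x))"
    using ab unfolding real_integrable_def a b by simp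
  show "(\<integral>x. p x * ln (p x / q x) \<partial>\<nu>) = real_of_ereal (divergence \<nu> p q)"
    unfolding real_lebesgue_integral_def[OF int] a[symmetric] b[symmetric] div
    using ab by (cases a; cases b) (auto simp: enn2ereal_ennreal infinity_ennreal_def)
qed

text \<open>
  The log-likelihood ratio of the true density of source \<open>i\<close> under \<open>P\<^sub>A\<close> against its alternative; its
  mean under \<open>P\<^sub>A\<close> is positive for every source, anomalous or not.
\<close>

definition gain :: "('s, 'w) anomaly_setup \<Rightarrow> nat set \<Rightarrow> nat \<Rightarrow> 's \<Rightarrow> real" where
  "gain Q A i x = (if i \<in> A then llr Q i x else - llr Q i x)"

definition walk :: "('s, 'w) anomaly_setup \<Rightarrow> nat set \<Rightarrow> 'w rule \<Rightarrow> nat \<Rightarrow> nat \<Rightarrow> 'w \<Rightarrow> real" where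
  "walk Q A R i n \<omega> = (\<Sum>m=1..n. gain Q A i (obs Q i m \<omega>) * of_bool (i \<in> R m \<omega>))"

text \<open>
  The log-likelihood ratio of \<open>P\<^sub>A\<close> against \<open>P\<^sub>B\<close> for the data sampled up to time \<open>n\<close>: only sources in
  the symmetric difference contribute, and the randomizers cancel.
\<close>

definition log_lr :: "('s, 'w) anomaly_setup \<Rightarrow> nat set \<Rightarrow> nat set \<Rightarrow> 'w rule \<Rightarrow> nat \<Rightarrow> 'w \<Rightarrow> real" where
  "log_lr Q A B R n \<omega> = (\<Sum>i\<in>(A - B) \<union> (B - A). walk Q A R i n \<omega>)"

lemma walk_eq_cum_llr:
  "walk Q A R i n \<omega> = (if i \<in> A then cum_llr Q R i n \<omega> else - cum_llr Q R i n \<omega>)"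
  by (simp add: walk_def cum_llr_def gain_def sum_negf[symmetric])

section \<open>Histories and their independence of future observations\<close>

definition coord_sets :: "('s, 'w) anomaly_setup \<Rightarrow> nat \<times> nat + nat \<times> nat \<Rightarrow> 'w set set" where
  "coord_sets Q = case_sum
     (\<lambda>(i, n). {obs Q i n -` B \<inter> space (outcomes Q) | B. B \<in> sets (obs_space Q)})
     (\<lambda>(i, n). {aux Q i n -` B \<inter> space (outcomes Q) | B. B \<in> sets borel})"

text \<open>
  All data up to time \<open>n\<close>, sampled or not.  It contains every history and depends on no sampling rule,
  so independence of the future can be read off the model.
\<close>

definition past :: "('s, 'w) anomaly_setup \<Rightarrow> nat \<Rightarrow> 'w set set" where
  "past Q n = sigma_sets (space (outcomes Q))
     (\<Union>j \<in> (sources Q \<times> {1..n}) <+> (sources Q \<times> {..n}). coord_sets Q j)"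

lemma sampling_ruleD:
  assumes "sampling_rule Q R" "1 \<le> n"
  shows "R n \<in> history Q R (n - 1) \<rightarrow>\<^sub>M count_space (Pow (sources Q))"
    and "\<omega> \<in> space (outcomes Q) \<Longrightarrow> R n \<omega> \<subseteq> sources Q"
proof -
  show *: "R n \<in> history Q R (n - 1) \<rightarrow>\<^sub>M count_space (Pow (sources Q))"
    using assms by (simp add: sampling_rule_def)
  show "R n \<omega> \<subseteq> sources Q" if "\<omega> \<in> space (outcomes Q)"
    using measurable_space[OF *, of \<omega>] that by (simp add: space_history)
qed

lemma sampling_rule_sets:
  assumes "sampling_rule Q R"
  shows "{\<omega> \<in> space (outcomes Q). P (R (Suc n) \<omega>)} \<in> sets (history Q R n)"
proof -
  have R: "R (Suc n) \<in> history Q R n \<rightarrow>\<^sub>M count_space (Pow (sources Q))"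
    using sampling_ruleD(1)[OF assms, of "Suc n"] by simp
  have "R (Suc n) -` {S \<in> Pow (sources Q). P S} \<inter> space (history Q R n) \<in> sets (history Q R n)"
    by (rule measurable_sets[OF R]) auto
  also have "R (Suc n) -` {S \<in> Pow (sources Q). P S} \<inter> space (history Q R n)
      = {\<omega> \<in> space (outcomes Q). P (R (Suc n) \<omega>)}"
    using sampling_ruleD(2)[OF assms, of "Suc n"] by (auto simp: space_history)
  finally show ?thesis .
qed

lemma sets_history_mono: "m \<le> n \<Longrightarrow> sets (history Q R m) \<subseteq> sets (history Q R n)"
  by (induction rule: dec_induct) (use sets_history_Suc in blast)+

lemma sets_history_Suc_eq:
  "sets (history Q R (Suc n)) = sigma_sets (space (outcomes Q))
     (sets (history Q R n) \<union> aux_events Q (Suc n) \<union> obs_events Q R (Suc n))"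
proof -
  have "sets (history Q R n) \<subseteq> Pow (space (outcomes Q))"
    using sets.space_closed[of "history Q R n"] by (simp only: space_history)
  moreover have "aux_events Q (Suc n) \<union> obs_events Q R (Suc n) \<subseteq> Pow (space (outcomes Q))"
    unfolding aux_events_def obs_events_def by blast
  ultimately show ?thesis by (simp add: sets_measure_of)
qed

lemma sets_history_0: "sets (history Q R 0) = sigma_sets (space (outcomes Q)) (aux_events Q 0)"
  by (simp, rule sets_measure_of) (auto simp: aux_events_def)

lemma Int_stable_vimage_sets: "Int_stable {f -` B \<inter> Y |B. B \<in> sets N}"
proof (rule Int_stableI)
  fix a b assume "a \<in> {f -` B \<inter> Y |B. B \<in> sets N}" "b \<in> {f -` B \<inter> Y |B. B \<in> sets N}"
  then obtain B C where "B \<in> sets N" "C \<in> sets N" "a = f -` B \<inter> Y" "b = f -` C \<inter> Y"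
    by blast
  then have "a \<inter> b = f -` (B \<inter> C) \<inter> Y" "B \<inter> C \<in> sets N" by auto
  then show "a \<inter> b \<in> {f -` B \<inter> Y |B. B \<in> sets N}" by blast
qed

lemma Int_stable_coord_sets: "Int_stable (coord_sets Q j)"
  by (cases j) (simp_all add: coord_sets_def Int_stable_vimage_sets split: prod.split)

context anomaly_model
begin

lemma space_law: "A \<subseteq> sources Q \<Longrightarrow> space (law Q A) = space (outcomes Q)"
  by (rule sets_eq_imp_space_eq) (rule sets_law)

lemma measurable_law: "A \<subseteq> sources Q \<Longrightarrow> measurable (law Q A) N = measurable (outcomes Q) N"
  by (rule measurable_cong_sets) (simp_all add: sets_law)

lemma space_ref: "i \<in> sources Q \<Longrightarrow> space (ref Q i) = space (obs_space Q)"
  by (rule sets_eq_imp_space_eq) (rule sets_ref)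

lemma measurable_ref: "i \<in> sources Q \<Longrightarrow> measurable (ref Q i) N = measurable (obs_space Q) N"
  by (rule measurable_cong_sets) (simp_all add: sets_ref)

lemma obs_measurable:
  assumes "i \<in> sources Q" "1 \<le> n"
  shows "obs Q i n \<in> outcomes Q \<rightarrow>\<^sub>M obs_space Q"
proof -
  have "obs Q i n \<in> law Q {} \<rightarrow>\<^sub>M ref Q i"
    using obs_distributed[of "{}" i n] assms by (auto simp: distributed_def)
  also have "law Q {} \<rightarrow>\<^sub>M ref Q i = outcomes Q \<rightarrow>\<^sub>M obs_space Q"
    using sets_law[of "{}"] sets_ref[OF assms(1)] by (intro measurable_cong_sets) auto
  finally show ?thesis .
qed

lemma llr_measurable: "i \<in> sources Q \<Longrightarrow> llr Q i \<in> borel_measurable (obs_space Q)"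
  unfolding llr_def using dens_measurable by measurable

lemma gain_measurable: "i \<in> sources Q \<Longrightarrow> gain Q A i \<in> borel_measurable (obs_space Q)"
  unfolding gain_def using llr_measurable by measurable

lemma coord_sets_events:
  assumes "j \<in> (sources Q \<times> {1..}) <+> (sources Q \<times> UNIV)"
  shows "coord_sets Q j \<subseteq> sets (outcomes Q)"
  using assms measurable_sets[OF obs_measurable] measurable_sets[OF aux_measurable]
  by (auto simp: coord_sets_def)

lemma aux_events_subset: "n \<le> m \<Longrightarrow>
  aux_events Q n \<subseteq> (\<Union>j \<in> (sources Q \<times> {1..m}) <+> (sources Q \<times> {..m}). coord_sets Q j)"
proof
  fix G assume "n \<le> m" "G \<in> aux_events Q n"
  then obtain i B where i: "i \<in> sources Q" and B: "B \<in> sets borel"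
    and G: "G = {\<omega> \<in> space (outcomes Q). aux Q i n \<omega> \<in> B}" and n: "n \<le> m"
    unfolding aux_events_def by blast
  have "G = aux Q i n -` B \<inter> space (outcomes Q)" unfolding G by auto
  then have "G \<in> coord_sets Q (Inr (i, n))" unfolding coord_sets_def using B by auto
  moreover have "Inr (i, n) \<in> (sources Q \<times> {1..m}) <+> (sources Q \<times> {..m})"
    using i n by auto
  ultimately show "G \<in> (\<Union>j \<in> (sources Q \<times> {1..m}) <+> (sources Q \<times> {..m}). coord_sets Q j)"
    by (rule UN_I[rotated])
qed

lemma sets_history_subset_past:
  assumes R: "sampling_rule Q R"
  shows "sets (history Q R n) \<subseteq> past Q n"
proof (induction n)
  case 0
  show ?case
    unfolding sets_history_0 past_def by (rule sigma_sets_subseteq) (rule aux_events_subset, simp)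
next
  case (Suc n)
  let ?gen = "\<lambda>n. \<Union>j \<in> (sources Q \<times> {1..n}) <+> (sources Q \<times> {..n}). coord_sets Q j"
  have gen: "?gen n \<subseteq> Pow (space (outcomes Q))" for n
    by (auto simp: coord_sets_def)
  interpret P: sigma_algebra "space (outcomes Q)" "past Q (Suc n)"
    unfolding past_def by (rule sigma_algebra_sigma_sets[OF gen])
  have mono: "past Q n \<subseteq> past Q (Suc n)"
    unfolding past_def by (rule sigma_sets_subseteq) (intro UN_mono, auto)
  have hist: "sets (history Q R n) \<subseteq> past Q (Suc n)" using Suc mono by blast
  have gen_past: "?gen (Suc n) \<subseteq> past Q (Suc n)"
    unfolding past_def by (rule sigma_sets_superset_generator)
  have aux: "aux_events Q (Suc n) \<subseteq> past Q (Suc n)"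
    by (rule order_trans[OF aux_events_subset gen_past]) simp
  have "obs_events Q R (Suc n) \<subseteq> past Q (Suc n)"
  proof
    fix G assume "G \<in> obs_events Q R (Suc n)"
    then obtain i B where i: "i \<in> sources Q" and B: "B \<in> sets (obs_space Q)"
      and G: "G = {\<omega> \<in> space (outcomes Q). i \<in> R (Suc n) \<omega> \<and> obs Q i (Suc n) \<omega> \<in> B}"
      unfolding obs_events_def by blast
    have "obs Q i (Suc n) -` B \<inter> space (outcomes Q) \<in> past Q (Suc n)"
      by (rule subsetD[OF gen_past], rule UN_I[of "Inl (i, Suc n)"])
        (use i B in \<open>auto simp: coord_sets_def\<close>)
    moreover have "{\<omega> \<in> space (outcomes Q). i \<in> R (Suc n) \<omega>} \<in> past Q (Suc n)"
      using sampling_rule_sets[OF R, of "\<lambda>S. i \<in> S" n] hist by blast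
    moreover have "G = {\<omega> \<in> space (outcomes Q). i \<in> R (Suc n) \<omega>}
        \<inter> (obs Q i (Suc n) -` B \<inter> space (outcomes Q))"
      unfolding G by auto
    ultimately show "G \<in> past Q (Suc n)" by blast
  qed
  with hist aux show ?case
    unfolding sets_history_Suc_eq by (intro P.sigma_sets_subset) blast
qed

lemma past_subset: "past Q n \<subseteq> sets (outcomes Q)"
  unfolding past_def
proof (rule sets.sigma_sets_subset, rule UN_least)
  fix j assume "j \<in> (sources Q \<times> {1..n}) <+> (sources Q \<times> {..n})"
  then have "j \<in> (sources Q \<times> {1..}) <+> (sources Q \<times> UNIV)" by auto
  then show "coord_sets Q j \<subseteq> sets (outcomes Q)" by (rule coord_sets_events)
qed

lemma sets_history_subset: "sampling_rule Q R \<Longrightarrow> sets (history Q R n) \<subseteq> sets (outcomes Q)"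
  using sets_history_subset_past past_subset by blast

lemma measurable_history:
  assumes "sampling_rule Q R" "f \<in> measurable (history Q R n) N"
  shows "f \<in> measurable (outcomes Q) N"
proof (rule measurableI)
  show "f x \<in> space N" if "x \<in> space (outcomes Q)" for x
    using measurable_space[OF assms(2)] that by (simp add: space_history)
  show "f -` X \<inter> space (outcomes Q) \<in> sets (outcomes Q)" if "X \<in> sets N" for X
    using measurable_sets[OF assms(2) that] sets_history_subset[OF assms(1)]
    by (auto simp: space_history)
qed

lemma measurable_history_mono:
  assumes "m \<le> n" "f \<in> measurable (history Q R m) N"
  shows "f \<in> measurable (history Q R n) N"
proof (rule measurableI)
  show "f x \<in> space N" if "x \<in> space (history Q R n)" for x
    using measurable_space[OF assms(2)] that by (simp add: space_history)
  show "f -` X \<inter> space (history Q R n) \<in> sets (history Q R n)" if "X \<in> sets N" for X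
    using measurable_sets[OF assms(2) that] sets_history_mono[OF assms(1)]
    by (auto simp: space_history)
qed

lemma indep_coord_sets:
  assumes A: "A \<subseteq> sources Q" and J: "J \<subseteq> (sources Q \<times> {1..}) <+> (sources Q \<times> UNIV)"
  shows "prob_space.indep_sets (law Q A) (coord_sets Q) J"
proof -
  interpret prob_space "law Q A" by (rule prob_law[OF A])
  show ?thesis
    using mutually_indep[OF A] unfolding coord_sets_def by (rule indep_sets_mono_index[OF J])
qed

lemma indep_history:
  assumes A: "A \<subseteq> sources Q" and R: "sampling_rule Q R"
  shows "prob_space.indep_sets (law Q A) (case_option (sets (history Q R n)) (coord_sets Q))
    (insert None (Some ` ((sources Q \<times> {Suc n}) <+> (sources Q \<times> {Suc n}))))"
proof -
  interpret prob_space "law Q A" by (rule prob_law[OF A])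
  let ?past = "(sources Q \<times> {1..n}) <+> (sources Q \<times> {..n})"
  let ?J = "insert None (Some ` ((sources Q \<times> {Suc n}) <+> (sources Q \<times> {Suc n})))"
  let ?I = "case_option ?past (\<lambda>j. {j})"
  have "indep_sets (\<lambda>j. sigma_sets (space (law Q A)) (\<Union>i\<in>?I j. coord_sets Q i)) ?J"
  proof (rule indep_sets_collect_sigma)
    show "indep_sets (coord_sets Q) (\<Union>j\<in>?J. ?I j)"
      by (rule indep_coord_sets[OF A]) auto
    show "disjoint_family_on ?I ?J"
      by (auto simp: disjoint_family_on_def)
  qed (rule Int_stable_coord_sets)
  then show ?thesis
  proof (rule indep_sets_mono_sets)
    fix j assume "j \<in> ?J"
    then show "case_option (sets (history Q R n)) (coord_sets Q) j
        \<subseteq> sigma_sets (space (law Q A)) (\<Union>i\<in>?I j. coord_sets Q i)"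
      using sets_history_subset_past[OF R, of n]
      by (cases j) (auto simp: past_def space_law[OF A] sigma_sets.Basic)
  qed
qed

text \<open>
  The index \<open>None\<close> stands for the past.  Time \<open>0\<close>, at which there are randomizers but no
  observations, is covered by an empty set of observed sources.
\<close>

lemma nn_integral_factor:
  fixes h :: "'w \<Rightarrow> ennreal" and \<phi> :: "nat \<Rightarrow> 's \<Rightarrow> ennreal" and \<psi> :: "nat \<Rightarrow> real \<Rightarrow> ennreal"
  assumes A: "A \<subseteq> sources Q" and O: "O1 \<subseteq> sources Q" "O1 = {} \<or> 1 \<le> n"
    and indep: "prob_space.indep_sets (law Q A) (case_option (sets H) (coord_sets Q))
      (insert None (Some ` ((O1 \<times> {n}) <+> (sources Q \<times> {n}))))"
    and space_H: "space H = space (outcomes Q)"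
    and h: "h \<in> borel_measurable H"
    and \<phi>: "\<And>i. i \<in> O1 \<Longrightarrow> \<phi> i \<in> borel_measurable (obs_space Q)"
    and \<psi>: "\<And>i. \<psi> i \<in> borel_measurable borel"
  shows "(\<integral>\<^sup>+\<omega>. h \<omega> * (\<Prod>i\<in>O1. \<phi> i (obs Q i n \<omega>)) * (\<Prod>i\<in>sources Q. \<psi> i (aux Q i n \<omega>)) \<partial>law Q A)
    = (\<integral>\<^sup>+\<omega>. h \<omega> \<partial>law Q A) * (\<Prod>i\<in>O1. \<integral>\<^sup>+\<omega>. \<phi> i (obs Q i n \<omega>) \<partial>law Q A)
      * (\<Prod>i\<in>sources Q. \<integral>\<^sup>+\<omega>. \<psi> i (aux Q i n \<omega>) \<partial>law Q A)"
proof -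
  interpret prob_space "law Q A" by (rule prob_law[OF A])
  define N where "N = (O1 \<times> {n}) <+> (sources Q \<times> {n})"
  define X where "X = case_option h (case_sum (\<lambda>(i, n). \<lambda>\<omega>. \<phi> i (obs Q i n \<omega>)) (\<lambda>(i, n). \<lambda>\<omega>. \<psi> i (aux Q i n \<omega>)))"
  have finO: "finite O1" using O finite_subset by blast
  have finN: "finite N" using finO by (simp add: N_def)
  have X_sets: "{X j -` B \<inter> space (law Q A) |B. B \<in> sets borel} \<subseteq> case_option (sets H) (coord_sets Q) j"
    if j: "j \<in> insert None (Some ` N)" for j
  proof
    fix G assume "G \<in> {X j -` B \<inter> space (law Q A) |B. B \<in> sets borel}"
    then obtain B where B: "B \<in> sets borel" and G: "G = X j -` B \<inter> space (outcomes Q)"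
      by (auto simp: space_law[OF A])
    consider "j = None" | i where "i \<in> O1" "j = Some (Inl (i, n))"
      | i where "i \<in> sources Q" "j = Some (Inr (i, n))"
      using j by (auto simp: N_def)
    then show "G \<in> case_option (sets H) (coord_sets Q) j"
    proof cases
      case 1
      then show ?thesis using measurable_sets[OF h B] by (simp add: G X_def space_H)
    next
      case (2 i)
      with O have i: "i \<in> sources Q" "1 \<le> n" by auto
      have "obs Q i n \<omega> \<in> space (obs_space Q)" if "\<omega> \<in> space (outcomes Q)" for \<omega>
        using measurable_space[OF obs_measurable[OF i]] that by simp
      then have G2: "G = obs Q i n -` (\<phi> i -` B \<inter> space (obs_space Q)) \<inter> space (outcomes Q)"
        using 2 by (auto simp: G X_def)
      have "G \<in> coord_sets Q (Inl (i, n))"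
        unfolding coord_sets_def using G2 measurable_sets[OF \<phi>[OF 2(1)] B] by (simp del: vimage_Int) blast
      then show ?thesis using 2 by simp
    next
      case (3 i)
      have "G = aux Q i n -` (\<psi> i -` B) \<inter> space (outcomes Q)"
        using 3 by (auto simp: G X_def)
      moreover have "\<psi> i -` B \<in> sets borel"
        using measurable_sets[OF \<psi> B, of i] by simp
      ultimately show ?thesis
        using 3 by (auto simp: coord_sets_def)
    qed
  qed
  have isets: "indep_sets (\<lambda>j. {X j -` B \<inter> space (law Q A) |B. B \<in> sets borel}) (insert None (Some ` N))"
    by (rule indep_sets_mono_sets[OF indep[folded N_def] X_sets])
  have "indep_vars (\<lambda>_. borel) X (insert None (Some ` N))"
    unfolding indep_vars_def2
  proof (intro conjI ballI isets)
    fix j assume "j \<in> insert None (Some ` N)"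
    then have "{X j -` B \<inter> space (law Q A) |B. B \<in> sets borel} \<subseteq> events"
      using isets by (simp only: indep_sets_def)
    then show "random_variable borel (X j)"
      by (intro measurableI) auto
  qed
  then have "(\<integral>\<^sup>+\<omega>. (\<Prod>j\<in>insert None (Some ` N). X j \<omega>) \<partial>law Q A)
      = (\<Prod>j\<in>insert None (Some ` N). \<integral>\<^sup>+\<omega>. X j \<omega> \<partial>law Q A)"
    using finN by (intro indep_vars_nn_integral) auto
  moreover have prod: "(\<Prod>j\<in>insert None (Some ` N). g j)
      = g None * (\<Prod>i\<in>O1. g (Some (Inl (i, n)))) * (\<Prod>i\<in>sources Q. g (Some (Inr (i, n))))"
    for g :: "(nat \<times> nat + nat \<times> nat) option \<Rightarrow> ennreal"
  proof -
    have "(\<Prod>j\<in>insert None (Some ` N). g j) = g None * (\<Prod>j\<in>N. g (Some j))"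
      using finN by (subst prod.insert) (auto simp: prod.reindex)
    also have "(\<Prod>j\<in>N. g (Some j)) = (\<Prod>j\<in>O1 \<times> {n}. g (Some (Inl j))) * (\<Prod>j\<in>sources Q \<times> {n}. g (Some (Inr j)))"
      using finO unfolding N_def by (subst prod.Plus) auto
    also have "(\<Prod>j\<in>O1 \<times> {n}. g (Some (Inl j))) = (\<Prod>i\<in>O1. g (Some (Inl (i, n))))"
      by (intro prod.reindex_bij_witness[of _ "\<lambda>i. (i, n)" fst]) auto
    also have "(\<Prod>j\<in>sources Q \<times> {n}. g (Some (Inr j))) = (\<Prod>i\<in>sources Q. g (Some (Inr (i, n))))"
      by (intro prod.reindex_bij_witness[of _ "\<lambda>i. (i, n)" fst]) auto
    finally show ?thesis by (simp add: mult.assoc)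
  qed
  ultimately show ?thesis
    unfolding prod by (simp add: X_def)
qed

end

section \<open>Change of measure on the history of a sampling rule\<close>

definition dens :: "('s, 'w) anomaly_setup \<Rightarrow> nat set \<Rightarrow> nat \<Rightarrow> 's \<Rightarrow> real" where
  "dens Q A i = (if i \<in> A then dens1 Q i else dens0 Q i)"

text \<open>
  Which observations enter the history at time \<open>n\<close> depends on the past through \<open>R n\<close>.  Fixing the
  value \<open>S\<close> of \<open>R n\<close> turns such an event into a product of independent events.
\<close>

definition cylinder :: "('s, 'w) anomaly_setup \<Rightarrow> 'w rule \<Rightarrow> nat \<Rightarrow> 'w set \<Rightarrow> nat set
    \<Rightarrow> (nat \<Rightarrow> 's set) \<Rightarrow> (nat \<Rightarrow> real set) \<Rightarrow> 'w set" where
  "cylinder Q R n G S B C = {\<omega> \<in> G. R n \<omega> = S \<and> (\<forall>i\<in>S. obs Q i n \<omega> \<in> B i)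
     \<and> (\<forall>i\<in>sources Q. aux Q i n \<omega> \<in> C i)}"

definition cylinders :: "('s, 'w) anomaly_setup \<Rightarrow> 'w rule \<Rightarrow> nat \<Rightarrow> 'w set set" where
  "cylinders Q R n = {cylinder Q R (Suc n) G S B C | G S B C.
     G \<in> sets (history Q R n) \<and> S \<subseteq> sources Q \<and> (\<forall>i. B i \<in> sets (obs_space Q)) \<and> (\<forall>i. C i \<in> sets borel)}"

lemma cylindersI:
  assumes "G \<in> sets (history Q R n)" "S \<subseteq> sources Q"
    and "\<And>i. B i \<in> sets (obs_space Q)" "\<And>i. C i \<in> sets borel"
  shows "cylinder Q R (Suc n) G S B C \<in> cylinders Q R n"
  unfolding cylinders_def using assms by blast

lemma Int_stable_cylinders: "Int_stable (cylinders Q R n)"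
proof (rule Int_stableI)
  fix a b assume "a \<in> cylinders Q R n" "b \<in> cylinders Q R n"
  then obtain G S B C G' S' B' C' where
    a: "a = cylinder Q R (Suc n) G S B C" "G \<in> sets (history Q R n)" "S \<subseteq> sources Q"
      "\<And>i. B i \<in> sets (obs_space Q)" "\<And>i. C i \<in> sets borel"
    and b: "b = cylinder Q R (Suc n) G' S' B' C'" "G' \<in> sets (history Q R n)" "S' \<subseteq> sources Q"
      "\<And>i. B' i \<in> sets (obs_space Q)" "\<And>i. C' i \<in> sets borel"
    unfolding cylinders_def by auto
  have "a \<inter> b = cylinder Q R (Suc n) (if S = S' then G \<inter> G' else {}) S (\<lambda>i. B i \<inter> B' i) (\<lambda>i. C i \<inter> C' i)"
    unfolding a b cylinder_def by auto
  moreover have "(if S = S' then G \<inter> G' else {}) \<in> sets (history Q R n)"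
    using a b by auto
  ultimately show "a \<inter> b \<in> cylinders Q R n"
    unfolding cylinders_def using a(3-5) b(4,5) by blast
qed

lemma emeasure_eq_on_sigma_sets:
  assumes sets: "sets M = sets L" "sets N = sets L" and E: "Int_stable E" "E \<subseteq> sets L"
    and eq: "\<And>X. X \<in> E \<Longrightarrow> emeasure M X = emeasure N X"
    and cover: "countable C" "C \<subseteq> E" "\<Union>C = space L" "\<And>X. X \<in> C \<Longrightarrow> emeasure N X \<noteq> \<infinity>"
    and G: "G \<in> sigma_sets (space L) E"
  shows "emeasure M G = emeasure N G"
proof -
  have sub: "E \<subseteq> Pow (space L)" using E(2) sets.space_closed by blast
  let ?R = "\<lambda>D. distr D (sigma (space L) E) (\<lambda>x. x)"
  have em: "emeasure (?R D) X = emeasure D X" if D: "sets D = sets L" and X: "X \<in> sigma_sets (space L) E" for D X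
  proof -
    have spD: "space D = space L" by (rule sets_eq_imp_space_eq[OF D])
    have "(\<lambda>x. x) \<in> D \<rightarrow>\<^sub>M sigma (space L) E"
      using sub sets.sigma_sets_subset[OF E(2)] sigma_sets_into_sp[OF sub]
      by (intro measurableI) (auto simp: spD D space_measure_of_conv Int_absorb2)
    moreover have "X \<subseteq> space L" using X sub sigma_sets_into_sp by metis
    ultimately show ?thesis
      using X sub by (subst emeasure_distr) (auto simp: spD Int_absorb2)
  qed
  have "?R M = ?R N"
  proof (rule measure_eqI_generator_eq_countable[OF E(1) sub, where A = C])
    show "emeasure (?R M) X = emeasure (?R N) X" if "X \<in> E" for X
      using em[OF sets(1)] em[OF sets(2)] eq[OF that] that by (simp add: sigma_sets.Basic)
    show "emeasure (?R M) X \<noteq> \<infinity>" if "X \<in> C" for X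
    proof -
      have "X \<in> E" using that cover(2) by blast
      then show ?thesis using em[OF sets(1)] eq[of X] cover(4)[OF that] by (simp add: sigma_sets.Basic)
    qed
  qed (use sub cover in auto)
  then show ?thesis using em[OF sets(1) G] em[OF sets(2) G] by simp
qed

context anomaly_model
begin

lemma dens_nonneg': "i \<in> sources Q \<Longrightarrow> x \<in> space (obs_space Q) \<Longrightarrow> 0 \<le> dens Q A i x"
  using dens_nonneg by (simp add: dens_def)

lemma dens_measurable': "i \<in> sources Q \<Longrightarrow> dens Q A i \<in> borel_measurable (obs_space Q)"
  using dens_measurable by (simp add: dens_def)

text \<open>
  For \<open>i \<notin> A\<close> this is \<open>ln (inverse x) = - ln x\<close>, where \<open>ln 0 = 0\<close> takes care of vanishing densities.
\<close>

lemma gain_eq: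
  "gain Q A i x = ln (dens Q A i x / dens Q (- A) i x)"
proof (cases "i \<in> A")
  case False
  then show ?thesis
    using ln_inverse[of "dens1 Q i x / dens0 Q i x"] by (simp add: gain_def llr_def dens_def)
qed (simp add: gain_def llr_def dens_def)

lemma divergence_dens:
  "divergence (ref Q i) (dens Q A i) (dens Q (- A) i) = (if i \<in> A then info1 Q i else info0 Q i)"
  by (simp add: dens_def info1_def info0_def)

lemma dens_facts:
  assumes i: "i \<in> sources Q"
  shows dens_AE: "AE x in ref Q i. 0 < dens Q A i x \<longrightarrow> 0 < dens Q (- A) i x"
    and dens_integrable: "integrable (ref Q i) (\<lambda>x. dens Q A i x * ln (dens Q A i x / dens Q (- A) i x))"
    and dens_integral: "(\<integral>x. dens Q A i x * ln (dens Q A i x / dens Q (- A) i x) \<partial>ref Q i) = strength Q A i"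
proof -
  have m: "dens Q B i \<in> borel_measurable (ref Q i)" for B
    using dens_measurable'[OF i] by (simp add: measurable_ref[OF i])
  have nn: "0 \<le> dens Q B i x" if "x \<in> space (ref Q i)" for x B
    using that dens_nonneg'[OF i] by (simp add: space_ref[OF i])
  have d: "0 < divergence (ref Q i) (dens Q A i) (dens Q (- A) i)"
    "divergence (ref Q i) (dens Q A i) (dens Q (- A) i) < \<infinity>"
    using info_pos_finite[OF i] by (auto simp: divergence_dens)
  note * = divergence_finite[OF m m nn nn d]
  show "AE x in ref Q i. 0 < dens Q A i x \<longrightarrow> 0 < dens Q (- A) i x" by (rule *(1))
  show "integrable (ref Q i) (\<lambda>x. dens Q A i x * ln (dens Q A i x / dens Q (- A) i x))" by (rule *(2))
  show "(\<integral>x. dens Q A i x * ln (dens Q A i x / dens Q (- A) i x) \<partial>ref Q i) = strength Q A i"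
    using *(3) by (simp add: divergence_dens strength_def)
qed

lemma strength_pos: "i \<in> sources Q \<Longrightarrow> 0 < strength Q A i"
  using info_pos_finite[of i] by (auto simp: strength_def zero_less_real_of_ereal)

lemma obs_distributed':
  assumes "A \<subseteq> sources Q" "i \<in> sources Q" "1 \<le> n"
  shows "distributed (law Q A) (ref Q i) (obs Q i n) (\<lambda>x. ennreal (dens Q A i x))"
  using obs_distributed[OF assms] by (simp add: dens_def if_distrib[of "\<lambda>f. f _"] cong: if_cong)

lemma gain_integrable:
  assumes A: "A \<subseteq> sources Q" "i \<in> sources Q" "1 \<le> n"
  shows "integrable (law Q A) (\<lambda>\<omega>. gain Q A i (obs Q i n \<omega>))"
    and "(\<integral>\<omega>. gain Q A i (obs Q i n \<omega>) \<partial>law Q A) = strength Q A i"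
proof -
  note D = obs_distributed'[OF A]
  have g: "gain Q A i \<in> borel_measurable (ref Q i)"
    using gain_measurable[OF A(2)] by (simp add: measurable_ref[OF A(2)])
  have nn: "\<And>x. x \<in> space (ref Q i) \<Longrightarrow> 0 \<le> dens Q A i x"
    using dens_nonneg'[OF A(2)] by (simp add: space_ref[OF A(2)])
  have eq: "dens Q A i x * gain Q A i x = dens Q A i x * ln (dens Q A i x / dens Q (- A) i x)" for x
    by (simp add: gain_eq)
  have "integrable (ref Q i) (\<lambda>x. dens Q A i x * gain Q A i x)"
    using dens_integrable[OF A(2)] by (subst Bochner_Integration.integrable_cong[OF refl eq])
  then show "integrable (law Q A) (\<lambda>\<omega>. gain Q A i (obs Q i n \<omega>))"
    using distributed_integrable[OF D g nn] by simp
  have "(\<integral>\<omega>. gain Q A i (obs Q i n \<omega>) \<partial>law Q A) = (\<integral>x. dens Q A i x * gain Q A i x \<partial>ref Q i)"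
    using distributed_integral[OF D g nn] by simp
  also have "\<dots> = strength Q A i"
    using dens_integral[OF A(2)] by (subst Bochner_Integration.integral_cong[OF refl eq])
  finally show "(\<integral>\<omega>. gain Q A i (obs Q i n \<omega>) \<partial>law Q A) = strength Q A i" .
qed

lemma nn_integral_obs_same:
  assumes A: "A \<subseteq> sources Q" and B: "B \<subseteq> sources Q" and i: "i \<in> sources Q" "1 \<le> n"
    and same: "i \<in> A \<longleftrightarrow> i \<in> B" and \<phi>: "\<phi> \<in> borel_measurable (obs_space Q)"
  shows "(\<integral>\<^sup>+\<omega>. \<phi> (obs Q i n \<omega>) \<partial>law Q A) = (\<integral>\<^sup>+\<omega>. \<phi> (obs Q i n \<omega>) \<partial>law Q B)"
proof -
  have "\<phi> \<in> borel_measurable (ref Q i)" using \<phi> by (simp add: measurable_ref[OF i(1)])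
  moreover have "dens Q A i = dens Q B i" using same by (simp add: dens_def)
  ultimately show ?thesis
    using distributed_nn_integral[OF obs_distributed'[OF A i], of \<phi>]
      distributed_nn_integral[OF obs_distributed'[OF B i], of \<phi>] by simp
qed

text \<open>
  The densities vanish simultaneously up to null sets, because both divergences are finite; so the
  likelihood ratio \<open>exp (- gain)\<close> is an exact density here, without a singular part.
\<close>

lemma nn_integral_obs_change:
  assumes A: "A \<subseteq> sources Q" and B: "B \<subseteq> sources Q" and i: "i \<in> sources Q" "1 \<le> n"
    and diff: "i \<in> A \<longleftrightarrow> i \<notin> B" and \<phi>: "\<phi> \<in> borel_measurable (obs_space Q)"
  shows "(\<integral>\<^sup>+\<omega>. ennreal (exp (- gain Q A i (obs Q i n \<omega>))) * \<phi> (obs Q i n \<omega>) \<partial>law Q A)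
    = (\<integral>\<^sup>+\<omega>. \<phi> (obs Q i n \<omega>) \<partial>law Q B)"
proof -
  have [measurable]: "\<phi> \<in> borel_measurable (ref Q i)" "gain Q A i \<in> borel_measurable (ref Q i)"
    using \<phi> gain_measurable[OF i(1)] by (simp_all add: measurable_ref[OF i(1)])
  have B_A: "dens Q B i = dens Q (- A) i" using diff by (simp add: dens_def)
  have "(\<integral>\<^sup>+\<omega>. ennreal (exp (- gain Q A i (obs Q i n \<omega>))) * \<phi> (obs Q i n \<omega>) \<partial>law Q A)
      = (\<integral>\<^sup>+x. ennreal (dens Q A i x) * (ennreal (exp (- gain Q A i x)) * \<phi> x) \<partial>ref Q i)"
    by (rule distributed_nn_integral[OF obs_distributed'[OF A i], symmetric]) measurable
  also have "\<dots> = (\<integral>\<^sup>+x. ennreal (dens Q B i x) * \<phi> x \<partial>ref Q i)"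
  proof (rule nn_integral_cong_AE)
    have "AE x in ref Q i. 0 < dens Q A i x \<longrightarrow> 0 < dens Q (- A) i x" by (rule dens_AE[OF i(1)])
    moreover have "AE x in ref Q i. 0 < dens Q (- A) i x \<longrightarrow> 0 < dens Q A i x"
      using dens_AE[OF i(1), of "- A"] by simp
    moreover have "AE x in ref Q i. x \<in> space (obs_space Q)"
      using AE_space[of "ref Q i"] by (simp add: space_ref[OF i(1)])
    ultimately show "AE x in ref Q i. ennreal (dens Q A i x) * (ennreal (exp (- gain Q A i x)) * \<phi> x)
        = ennreal (dens Q B i x) * \<phi> x"
    proof (eventually_elim, goal_cases)
      case (1 x)
      show ?case
      proof (cases "dens Q A i x = 0")
        case True
        then have "dens Q B i x = 0"
          using 1 dens_nonneg'[OF i(1) 1(3), of "- A"] by (simp add: B_A)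
        with True show ?thesis by simp
      next
        case False
        then have p: "0 < dens Q A i x" "0 < dens Q (- A) i x"
          using 1 dens_nonneg'[OF i(1) 1(3), of A] by auto
        then have "dens Q A i x * exp (- gain Q A i x) = dens Q B i x"
          by (simp add: gain_eq B_A exp_minus)
        then show ?thesis
          using p by (simp add: mult.assoc[symmetric] ennreal_mult[symmetric])
      qed
    qed
  qed
  also have "\<dots> = (\<integral>\<^sup>+\<omega>. \<phi> (obs Q i n \<omega>) \<partial>law Q B)"
    by (rule distributed_nn_integral[OF obs_distributed'[OF B i]]) measurable
  finally show ?thesis .
qed

lemma nn_integral_aux_same:
  assumes A: "A \<subseteq> sources Q" and B: "B \<subseteq> sources Q" and i: "i \<in> sources Q"
    and \<psi>[measurable]: "\<psi> \<in> borel_measurable borel"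
  shows "(\<integral>\<^sup>+\<omega>. \<psi> (aux Q i n \<omega>) \<partial>law Q A) = (\<integral>\<^sup>+\<omega>. \<psi> (aux Q i n \<omega>) \<partial>law Q B)"
proof -
  have m: "aux Q i n \<in> borel_measurable (law Q D)" if "D \<subseteq> sources Q" for D
    using aux_measurable[OF i] by (simp add: measurable_law[OF that])
  have "(\<integral>\<^sup>+\<omega>. \<psi> (aux Q i n \<omega>) \<partial>law Q D) = (\<integral>\<^sup>+x. \<psi> x \<partial>uniform_measure lborel {0<..<1})"
    if D: "D \<subseteq> sources Q" for D
    using nn_integral_distr[OF m[OF D], of \<psi>] by (simp add: aux_uniform[OF D i])
  then show ?thesis using A B by simp
qed

text \<open>
  Observations at times when the source is not sampled are not measurable for the history, but their
  products with the sampling indicator are.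
\<close>

lemma sampled_sum_measurable:
  assumes R: "sampling_rule Q R" and i: "i \<in> sources Q"
    and g: "g \<in> borel_measurable (obs_space Q)"
  shows "(\<lambda>\<omega>. \<Sum>m=1..n. (g (obs Q i m \<omega>) :: real) * of_bool (i \<in> R m \<omega>)) \<in> borel_measurable (history Q R n)"
proof (rule borel_measurable_sum)
  fix m assume m: "m \<in> {1..n}"
  then obtain m' where m': "m = Suc m'" by (cases m) auto
  have "(\<lambda>\<omega>. g (obs Q i m \<omega>) * of_bool (i \<in> R m \<omega>)) \<in> borel_measurable (history Q R m)"
  proof (rule measurableI)
    fix Y :: "real set" assume Y: "Y \<in> sets borel"
    define B where "B = g -` Y \<inter> space (obs_space Q)"
    have B: "B \<in> sets (obs_space Q)" unfolding B_def using g Y by (rule measurable_sets)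
    have obs: "obs Q i m \<omega> \<in> space (obs_space Q)" if "\<omega> \<in> space (outcomes Q)" for \<omega>
      using measurable_space[OF obs_measurable[OF i]] m that by simp
    have "{\<omega> \<in> space (outcomes Q). i \<in> R m \<omega> \<and> obs Q i m \<omega> \<in> B} \<in> sets (history Q R m)"
      unfolding m' sets_history_Suc_eq using i B m'
      by (intro sigma_sets.Basic) (auto simp: obs_events_def)
    moreover have "{\<omega> \<in> space (outcomes Q). i \<notin> R m \<omega>} \<in> sets (history Q R m)"
      using sampling_rule_sets[OF R, of "\<lambda>S. i \<notin> S" m'] sets_history_mono[of m' m] m' by auto
    moreover have "(\<lambda>\<omega>. g (obs Q i m \<omega>) * of_bool (i \<in> R m \<omega>)) -` Y \<inter> space (history Q R m)
       = {\<omega> \<in> space (outcomes Q). i \<in> R m \<omega> \<and> obs Q i m \<omega> \<in> B}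
         \<union> (if 0 \<in> Y then {\<omega> \<in> space (outcomes Q). i \<notin> R m \<omega>} else {})"
      using obs by (auto simp: space_history B_def split: if_splits) (auto simp: of_bool_def split: if_splits)
    ultimately show "(\<lambda>\<omega>. g (obs Q i m \<omega>) * of_bool (i \<in> R m \<omega>)) -` Y \<inter> space (history Q R m)
       \<in> sets (history Q R m)" by auto
  qed simp
  then show "(\<lambda>\<omega>. g (obs Q i m \<omega>) * of_bool (i \<in> R m \<omega>)) \<in> borel_measurable (history Q R n)"
    using m by (intro measurable_history_mono[of m n]) auto
qed

lemma walk_measurable:
  "sampling_rule Q R \<Longrightarrow> i \<in> sources Q \<Longrightarrow> walk Q A R i n \<in> borel_measurable (history Q R n)"
  using sampled_sum_measurable[OF _ _ gain_measurable, of R i i A n] by (simp add: walk_def[abs_def])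

lemma log_lr_measurable:
  assumes "sampling_rule Q R" "A \<subseteq> sources Q" "B \<subseteq> sources Q"
  shows "log_lr Q A B R n \<in> borel_measurable (history Q R n)"
  unfolding log_lr_def[abs_def] using assms
  by (intro borel_measurable_sum walk_measurable) auto

lemma log_lr_Suc:
  "log_lr Q A B R (Suc n) \<omega> = log_lr Q A B R n \<omega>
     + (\<Sum>i\<in>(A - B) \<union> (B - A). gain Q A i (obs Q i (Suc n) \<omega>) * of_bool (i \<in> R (Suc n) \<omega>))"
  by (simp add: log_lr_def walk_def sum.distrib)

lemma sets_history_Suc_cylinders:
  assumes R: "sampling_rule Q R"
  shows "sets (history Q R (Suc n)) \<subseteq> sigma_sets (space (outcomes Q)) (cylinders Q R n)"
proof -
  let ?\<Omega> = "space (outcomes Q)"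
  have sub: "cylinders Q R n \<subseteq> Pow ?\<Omega>"
    using sets.sets_into_space[of _ "history Q R n"]
    by (fastforce simp: cylinders_def cylinder_def space_history)
  interpret C: sigma_algebra ?\<Omega> "sigma_sets ?\<Omega> (cylinders Q R n)"
    by (rule sigma_algebra_sigma_sets[OF sub])
  have top: "?\<Omega> \<in> sets (history Q R n)"
    using sets.top[of "history Q R n"] by (simp add: space_history)
  have RS: "R (Suc n) \<omega> \<subseteq> sources Q" if "\<omega> \<in> ?\<Omega>" for \<omega>
    using sampling_ruleD(2)[OF R _ that] by simp
  have obs: "obs Q i (Suc n) \<omega> \<in> space (obs_space Q)" if "\<omega> \<in> ?\<Omega>" "i \<in> sources Q" for \<omega> i
    using measurable_space[OF obs_measurable[OF that(2)]] that by simp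
  have union: "(\<Union>S\<in>{S. S \<subseteq> sources Q \<and> P S}. cylinder Q R (Suc n) G S B C)
      = {\<omega> \<in> G. P (R (Suc n) \<omega>) \<and> (\<forall>i\<in>R (Suc n) \<omega>. obs Q i (Suc n) \<omega> \<in> B i)
          \<and> (\<forall>i\<in>sources Q. aux Q i (Suc n) \<omega> \<in> C i)}" if "G \<subseteq> ?\<Omega>" for P G B C
    unfolding cylinder_def using that RS by blast
  have obs': "obs Q i (Suc n) \<omega> \<in> space (obs_space Q)" if "\<omega> \<in> ?\<Omega>" "i \<in> R (Suc n) \<omega>" for \<omega> i
    using obs RS that by blast
  have cyl: "(\<Union>S\<in>{S. S \<subseteq> sources Q \<and> P S}. cylinder Q R (Suc n) G S B C)
      \<in> sigma_sets ?\<Omega> (cylinders Q R n)"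
    if "G \<in> sets (history Q R n)" "\<And>i. B i \<in> sets (obs_space Q)" "\<And>i. C i \<in> sets borel" for P G B C
  proof (rule C.finite_UN)
    show "finite {S. S \<subseteq> sources Q \<and> P S}" by (rule finite_subset[of _ "Pow (sources Q)"]) auto
    show "cylinder Q R (Suc n) G S B C \<in> sigma_sets ?\<Omega> (cylinders Q R n)"
      if S: "S \<in> {S. S \<subseteq> sources Q \<and> P S}" for S
      using that(1) \<open>G \<in> _\<close> \<open>\<And>i. B i \<in> _\<close> \<open>\<And>i. C i \<in> _\<close>
      by (intro sigma_sets.Basic) (auto simp: cylinders_def)
  qed
  show ?thesis
    unfolding sets_history_Suc_eq
  proof (intro C.sigma_sets_subset Un_least subsetI)
    fix G assume G: "G \<in> sets (history Q R n)"
    then have G_sub: "G \<subseteq> ?\<Omega>" using sets.sets_into_space[OF G] by (simp add: space_history)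
    have "G = (\<Union>S\<in>{S. S \<subseteq> sources Q \<and> True}.
        cylinder Q R (Suc n) G S (\<lambda>_. space (obs_space Q)) (\<lambda>_. UNIV))"
      unfolding union[OF G_sub] using obs' G_sub by auto
    with cyl[OF G, of "\<lambda>_. space (obs_space Q)" "\<lambda>_. UNIV" "\<lambda>_. True"]
    show "G \<in> sigma_sets ?\<Omega> (cylinders Q R n)" by simp
  next
    fix G assume "G \<in> aux_events Q (Suc n)"
    then obtain i B where i: "i \<in> sources Q" and B: "B \<in> sets borel"
      and G: "G = {\<omega> \<in> ?\<Omega>. aux Q i (Suc n) \<omega> \<in> B}"
      unfolding aux_events_def by blast
    have "G = (\<Union>S\<in>{S. S \<subseteq> sources Q \<and> True}.
        cylinder Q R (Suc n) ?\<Omega> S (\<lambda>_. space (obs_space Q)) (\<lambda>j. if j = i then B else UNIV))"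
      unfolding union[OF order_refl] G using obs' i by (auto split: if_splits)
    with cyl[OF top, of "\<lambda>_. space (obs_space Q)" "\<lambda>j. if j = i then B else UNIV" "\<lambda>_. True"] B
    show "G \<in> sigma_sets ?\<Omega> (cylinders Q R n)" by simp
  next
    fix G assume "G \<in> obs_events Q R (Suc n)"
    then obtain i B where i: "i \<in> sources Q" and B: "B \<in> sets (obs_space Q)"
      and G: "G = {\<omega> \<in> ?\<Omega>. i \<in> R (Suc n) \<omega> \<and> obs Q i (Suc n) \<omega> \<in> B}"
      unfolding obs_events_def by blast
    have "G = (\<Union>S\<in>{S. S \<subseteq> sources Q \<and> i \<in> S}.
        cylinder Q R (Suc n) ?\<Omega> S (\<lambda>j. if j = i then B else space (obs_space Q)) (\<lambda>_. UNIV))"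
      unfolding union[OF order_refl] G using obs' i by (auto split: if_splits)
    with cyl[OF top, of "\<lambda>j. if j = i then B else space (obs_space Q)" "\<lambda>_. UNIV" "\<lambda>S. i \<in> S"] B
    show "G \<in> sigma_sets ?\<Omega> (cylinders Q R n)" by simp
  qed
qed


text \<open>
  At time \<open>0\<close> only the randomizers have been seen, and their law does not depend on the configuration.
\<close>

lemma lr_history_0:
  assumes A: "A \<subseteq> sources Q" and B: "B \<subseteq> sources Q" and G: "G \<in> sets (history Q R 0)"
  shows "emeasure (law Q A) G = emeasure (law Q B) G"
proof -
  let ?\<Omega> = "space (outcomes Q)"
  define E where "E = {{\<omega> \<in> ?\<Omega>. \<forall>i\<in>sources Q. aux Q i 0 \<omega> \<in> C i} | C. \<forall>i. C i \<in> sets (borel :: real measure)}"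
  have E_events: "E \<subseteq> sets (outcomes Q)"
  proof
    fix G assume "G \<in> E"
    then obtain C where C: "\<And>i. C i \<in> sets (borel :: real measure)"
      and G: "G = {\<omega> \<in> ?\<Omega>. \<forall>i\<in>sources Q. aux Q i 0 \<omega> \<in> C i}" unfolding E_def by blast
    have "G = ?\<Omega> \<inter> (\<Inter>i\<in>sources Q. aux Q i 0 -` C i \<inter> ?\<Omega>)" unfolding G by auto
    also have "\<dots> \<in> sets (outcomes Q)"
    proof (rule sets.Int[OF sets.top], rule sets.finite_INT)
      show "aux Q i 0 -` C i \<inter> ?\<Omega> \<in> sets (outcomes Q)" if "i \<in> sources Q" for i
        using measurable_sets[OF aux_measurable[OF that] C] .
    qed (use num_sources_pos in auto)
    finally show "G \<in> sets (outcomes Q)" .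
  qed
  have stable: "Int_stable E"
  proof (rule Int_stableI)
    fix a b assume "a \<in> E" "b \<in> E"
    then obtain C C' where C: "\<And>i. C i \<in> sets (borel :: real measure)" "\<And>i. C' i \<in> sets (borel :: real measure)"
      and "a = {\<omega> \<in> ?\<Omega>. \<forall>i\<in>sources Q. aux Q i 0 \<omega> \<in> C i}"
        "b = {\<omega> \<in> ?\<Omega>. \<forall>i\<in>sources Q. aux Q i 0 \<omega> \<in> C' i}" unfolding E_def by blast
    then have "a \<inter> b = {\<omega> \<in> ?\<Omega>. \<forall>i\<in>sources Q. aux Q i 0 \<omega> \<in> C i \<inter> C' i}" by auto
    moreover have "\<forall>i. C i \<inter> C' i \<in> sets borel" using C by auto
    ultimately show "a \<inter> b \<in> E" unfolding E_def by (intro CollectI exI[of _ "\<lambda>i. C i \<inter> C' i"] conjI)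
  qed
  have eq_E: "emeasure (law Q A) G = emeasure (law Q B) G" if "G \<in> E" for G
  proof -
    from that obtain C where G: "G = {\<omega> \<in> ?\<Omega>. \<forall>i\<in>sources Q. aux Q i 0 \<omega> \<in> C i}"
      and "\<forall>i. C i \<in> sets (borel :: real measure)" unfolding E_def by auto
    then have C: "\<And>i. C i \<in> sets (borel :: real measure)" by blast
    have "emeasure (law Q D) G = (\<Prod>i\<in>sources Q. \<integral>\<^sup>+\<omega>. indicator (C i) (aux Q i 0 \<omega>) \<partial>law Q D)"
      if D: "D \<subseteq> sources Q" for D
    proof -
      interpret prob_space "law Q D" by (rule prob_law[OF D])
      have indep: "indep_sets (case_option (sets (sigma ?\<Omega> {})) (coord_sets Q))
          (insert None (Some ` (({} \<times> {0}) <+> (sources Q \<times> {0}))))"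
      proof -
        let ?J = "insert None (Some ` (({} \<times> {0}) <+> (sources Q \<times> {0})))"
        let ?I = "case_option {} (\<lambda>j. {j}) :: (nat \<times> nat + nat \<times> nat) option \<Rightarrow> _"
        have "indep_sets (\<lambda>j. sigma_sets (space (law Q D)) (\<Union>i\<in>?I j. coord_sets Q i)) ?J"
        proof (rule indep_sets_collect_sigma)
          show "indep_sets (coord_sets Q) (\<Union>j\<in>?J. ?I j)"
            by (rule indep_coord_sets[OF D]) auto
          show "disjoint_family_on ?I ?J" by (auto simp: disjoint_family_on_def)
        qed (rule Int_stable_coord_sets)
        then show ?thesis
          by (rule indep_sets_mono_sets) (auto simp: space_law[OF D] sigma_sets.Basic)
      qed
      have "emeasure (law Q D) G = (\<integral>\<^sup>+\<omega>. indicator G \<omega> \<partial>law Q D)"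
        using E_events \<open>G \<in> E\<close> by (subst nn_integral_indicator) (auto simp: sets_law[OF D])
      also have "\<dots> = (\<integral>\<^sup>+\<omega>. 1 * (\<Prod>i\<in>({}::nat set). 1) * (\<Prod>i\<in>sources Q. indicator (C i) (aux Q i 0 \<omega>)) \<partial>law Q D)"
        by (intro nn_integral_cong)
          (auto simp: G space_law[OF D] indicator_def prod_zero_iff intro!: prod.neutral)
      also have "\<dots> = (\<integral>\<^sup>+\<omega>. 1 \<partial>law Q D) * (\<Prod>i\<in>({}::nat set). \<integral>\<^sup>+\<omega>. 1 \<partial>law Q D)
          * (\<Prod>i\<in>sources Q. \<integral>\<^sup>+\<omega>. indicator (C i) (aux Q i 0 \<omega>) \<partial>law Q D)"
        by (rule nn_integral_factor[OF D _ _ indep]) (use C in \<open>auto simp: space_measure_of_conv\<close>)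
      finally show ?thesis using emeasure_space_1 by simp
    qed
    note * = this
    show ?thesis
      unfolding *[OF A] *[OF B]
      by (intro prod.cong refl nn_integral_aux_same[OF A B]) (use C in auto)
  qed
  have aux_E: "aux_events Q 0 \<subseteq> E"
  proof
    fix G assume "G \<in> aux_events Q 0"
    then obtain i C where "i \<in> sources Q" "C \<in> sets borel"
      "G = {\<omega> \<in> ?\<Omega>. aux Q i 0 \<omega> \<in> C}" unfolding aux_events_def by blast
    then show "G \<in> E" unfolding E_def
      by (intro CollectI exI[of _ "\<lambda>j. if j = i then C else UNIV"]) auto
  qed
  have G_sig: "G \<in> sigma_sets ?\<Omega> E"
    using G sigma_sets_subseteq[OF aux_E, of ?\<Omega>] unfolding sets_history_0 by blast
  show ?thesis
  proof (rule emeasure_eq_on_sigma_sets[OF sets_law[OF A] sets_law[OF B] stable E_events eq_E _ _ _ _ G_sig])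
    show "{?\<Omega>} \<subseteq> E" unfolding E_def by (auto intro!: exI[of _ "\<lambda>_. UNIV"])
    show "emeasure (law Q B) X \<noteq> \<infinity>" if "X \<in> {?\<Omega>}" for X
      using prob_space.emeasure_space_1[OF prob_law[OF B]] that by (simp add: space_law[OF B])
  qed auto
qed

text \<open>
  On the history of a sampling rule, \<open>P\<^sub>B\<close> has density \<open>exp (- log_lr)\<close> with respect to \<open>P\<^sub>A\<close>.  By
  induction on time it suffices to treat cylinders, on which the likelihood ratio factors into the
  one for the past and those of the newly sampled observations.
\<close>

lemma lr_history:
  assumes A: "A \<subseteq> sources Q" and B: "B \<subseteq> sources Q" and R: "sampling_rule Q R"
    and "G \<in> sets (history Q R n)"
  shows "(\<integral>\<^sup>+\<omega>. ennreal (exp (- log_lr Q A B R n \<omega>)) * indicator G \<omega> \<partial>law Q A) = emeasure (law Q B) G"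
  using assms(4)
proof (induction n arbitrary: G)
  case 0
  have "G \<in> sets (law Q A)"
    using sets_history_subset[OF R] 0 unfolding sets_law[OF A] by blast
  then show ?case
    using lr_history_0[OF A B 0] by (simp add: log_lr_def walk_def)
next
  case (Suc n)
  let ?\<Omega> = "space (outcomes Q)"
  let ?U = "(A - B) \<union> (B - A)"
  define L where "L = (\<lambda>n \<omega>. ennreal (exp (- log_lr Q A B R n \<omega>)))"
  define D where "D = density (law Q A) (L (Suc n))"
  have Lm: "L m \<in> borel_measurable (history Q R m)" for m
    unfolding L_def using log_lr_measurable[OF R A B, of m] by measurable
  have Lm_A: "L m \<in> borel_measurable (law Q A)" for m
    using measurable_history[OF R Lm] by (simp add: measurable_law[OF A])
  have finU: "finite ?U" using A B finite_subset by blast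
  have L_Suc: "L (Suc n) \<omega> = L n \<omega> * (\<Prod>i\<in>sources Q. if i \<in> ?U \<inter> R (Suc n) \<omega> then ennreal (exp (- gain Q A i (obs Q i (Suc n) \<omega>))) else 1)"
    for \<omega>
  proof -
    have "(\<Prod>i\<in>sources Q. if i \<in> ?U \<inter> R (Suc n) \<omega> then ennreal (exp (- gain Q A i (obs Q i (Suc n) \<omega>))) else 1)
        = (\<Prod>i\<in>?U. ennreal (exp (- gain Q A i (obs Q i (Suc n) \<omega>) * of_bool (i \<in> R (Suc n) \<omega>))))"
      using A B by (intro prod.mono_neutral_cong_right) auto
    also have "\<dots> = ennreal (exp (\<Sum>i\<in>?U. - gain Q A i (obs Q i (Suc n) \<omega>) * of_bool (i \<in> R (Suc n) \<omega>)))"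
      using finU by (simp add: prod_ennreal exp_sum)
    finally show ?thesis
      by (simp add: L_def log_lr_Suc exp_add[symmetric] exp_diff ennreal_mult[symmetric] sum_negf mult_exp_exp)
  qed
  have hist_sub: "sets (history Q R m) \<subseteq> sets (outcomes Q)" for m by (rule sets_history_subset[OF R])
  have cyl_events: "cylinders Q R n \<subseteq> sets (outcomes Q)"
  proof
    fix X assume "X \<in> cylinders Q R n"
    then obtain G S C C' where X: "X = cylinder Q R (Suc n) G S C C'" and G: "G \<in> sets (history Q R n)"
      and S: "S \<subseteq> sources Q" and C: "\<And>i. C i \<in> sets (obs_space Q)" "\<And>i. C' i \<in> sets borel"
      unfolding cylinders_def by auto
    have finS: "finite S" using S finite_subset by blast
    have "X = G \<inter> {\<omega> \<in> ?\<Omega>. R (Suc n) \<omega> = S} \<inter> {\<omega> \<in> ?\<Omega>. \<forall>i\<in>S. obs Q i (Suc n) \<omega> \<in> C i}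
        \<inter> {\<omega> \<in> ?\<Omega>. \<forall>i\<in>sources Q. aux Q i (Suc n) \<omega> \<in> C' i}"
      using sets.sets_into_space[OF G] unfolding X cylinder_def by (auto simp: space_history)
    moreover have "{\<omega> \<in> ?\<Omega>. R (Suc n) \<omega> = S} \<in> sets (outcomes Q)"
      using sampling_rule_sets[OF R, of "\<lambda>x. x = S" n] hist_sub by blast
    moreover have "{\<omega> \<in> ?\<Omega>. \<forall>i\<in>S. obs Q i (Suc n) \<omega> \<in> C i} \<in> sets (outcomes Q)"
      using finS S measurable_sets[OF obs_measurable C(1)]
      by (intro sets.sets_Collect_finite_All) (auto simp: vimage_def Int_def conj_commute)
    moreover have "{\<omega> \<in> ?\<Omega>. \<forall>i\<in>sources Q. aux Q i (Suc n) \<omega> \<in> C' i} \<in> sets (outcomes Q)"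
      using measurable_sets[OF aux_measurable C(2)]
      by (intro sets.sets_Collect_finite_All) (auto simp: vimage_def Int_def conj_commute)
    moreover have "G \<in> sets (outcomes Q)" using G hist_sub by blast
    ultimately show "X \<in> sets (outcomes Q)" by (simp only: sets.Int)
  qed
  have eq_cyl: "emeasure D X = emeasure (law Q B) X" if "X \<in> cylinders Q R n" for X
  proof -
    from that obtain G S C C' where X: "X = cylinder Q R (Suc n) G S C C'" and G: "G \<in> sets (history Q R n)"
      and S: "S \<subseteq> sources Q" and C: "\<And>i. C i \<in> sets (obs_space Q)" "\<And>i. C' i \<in> sets borel"
      unfolding cylinders_def by auto
    define H where "H = G \<inter> {\<omega> \<in> ?\<Omega>. R (Suc n) \<omega> = S}"
    have H: "H \<in> sets (history Q R n)"
      unfolding H_def using G sampling_rule_sets[OF R, of "\<lambda>x. x = S" n] by blast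
    define \<phi> where "\<phi> = (\<lambda>i x. if i \<in> S then indicator (C i) x else (1::ennreal))"
    define \<phi>' where "\<phi>' = (\<lambda>i x. if i \<in> ?U \<inter> S then ennreal (exp (- gain Q A i x)) * \<phi> i x else \<phi> i x)"
    define \<psi> where "\<psi> = (\<lambda>i x. indicator (C' i) x :: ennreal)"
    have \<phi>: "\<phi> i \<in> borel_measurable (obs_space Q)" for i using C by (auto simp: \<phi>_def)
    have \<phi>': "\<phi>' i \<in> borel_measurable (obs_space Q)" if "i \<in> sources Q" for i
      unfolding \<phi>'_def using gain_measurable[OF that, of A] \<phi>[of i] by (cases "i \<in> ?U \<inter> S") auto
    have \<psi>: "\<psi> i \<in> borel_measurable borel" for i using C by (auto simp: \<psi>_def)
    have Xevent: "X \<in> sets (outcomes Q)" using cyl_events that by blast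
    have ind: "indicator X \<omega> = indicator H \<omega> * (\<Prod>i\<in>sources Q. \<phi> i (obs Q i (Suc n) \<omega>))
        * (\<Prod>i\<in>sources Q. \<psi> i (aux Q i (Suc n) \<omega>))" (is "_ = _ * ?p1 * ?p2") if "\<omega> \<in> ?\<Omega>" for \<omega>
    proof -
      have "?p1 = (if \<forall>i\<in>S. obs Q i (Suc n) \<omega> \<in> C i then 1 else 0)"
        using S by (auto simp: \<phi>_def intro!: prod.neutral prod_zero) (auto simp: indicator_def)
      moreover have "?p2 = (if \<forall>i\<in>sources Q. aux Q i (Suc n) \<omega> \<in> C' i then 1 else 0)"
        by (auto simp: \<psi>_def intro!: prod.neutral prod_zero) (auto simp: indicator_def)
      ultimately show ?thesis
        using that by (auto simp: X cylinder_def H_def indicator_def)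
    qed
    have indL: "L (Suc n) \<omega> * indicator X \<omega> = (L n \<omega> * indicator H \<omega>) * (\<Prod>i\<in>sources Q. \<phi>' i (obs Q i (Suc n) \<omega>))
        * (\<Prod>i\<in>sources Q. \<psi> i (aux Q i (Suc n) \<omega>))" if "\<omega> \<in> ?\<Omega>" for \<omega>
    proof (cases "\<omega> \<in> H")
      case True
      then have RS: "R (Suc n) \<omega> = S" by (simp add: H_def)
      have "(\<Prod>i\<in>sources Q. \<phi>' i (obs Q i (Suc n) \<omega>))
          = (\<Prod>i\<in>sources Q. if i \<in> ?U \<inter> R (Suc n) \<omega> then ennreal (exp (- gain Q A i (obs Q i (Suc n) \<omega>))) else 1)
            * (\<Prod>i\<in>sources Q. \<phi> i (obs Q i (Suc n) \<omega>))"
        unfolding prod.distrib[symmetric] RS by (intro prod.cong) (auto simp: \<phi>'_def)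
      then show ?thesis unfolding ind[OF that] L_Suc by (simp only: mult_ac)
    next
      case False
      then show ?thesis unfolding ind[OF that] by simp
    qed
    have "emeasure D X = (\<integral>\<^sup>+\<omega>. L (Suc n) \<omega> * indicator X \<omega> \<partial>law Q A)"
      unfolding D_def using Xevent by (intro emeasure_density Lm_A) (simp add: sets_law[OF A])
    also have "\<dots> = (\<integral>\<^sup>+\<omega>. (L n \<omega> * indicator H \<omega>) * (\<Prod>i\<in>sources Q. \<phi>' i (obs Q i (Suc n) \<omega>))
        * (\<Prod>i\<in>sources Q. \<psi> i (aux Q i (Suc n) \<omega>)) \<partial>law Q A)"
      by (intro nn_integral_cong indL) (simp add: space_law[OF A])
    also have "\<dots> = (\<integral>\<^sup>+\<omega>. L n \<omega> * indicator H \<omega> \<partial>law Q A)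
        * (\<Prod>i\<in>sources Q. \<integral>\<^sup>+\<omega>. \<phi>' i (obs Q i (Suc n) \<omega>) \<partial>law Q A)
        * (\<Prod>i\<in>sources Q. \<integral>\<^sup>+\<omega>. \<psi> i (aux Q i (Suc n) \<omega>) \<partial>law Q A)"
      using H Lm[of n]
      by (intro nn_integral_factor[OF A _ _ indep_history[OF A R] space_history _ \<phi>' \<psi>]) auto
    also have "(\<integral>\<^sup>+\<omega>. L n \<omega> * indicator H \<omega> \<partial>law Q A) = emeasure (law Q B) H"
      unfolding L_def by (rule Suc.IH[OF H])
    also have "\<dots> = (\<integral>\<^sup>+\<omega>. indicator H \<omega> \<partial>law Q B)"
      using H hist_sub by (subst nn_integral_indicator) (auto simp: sets_law[OF B])
    also have "(\<Prod>i\<in>sources Q. \<integral>\<^sup>+\<omega>. \<phi>' i (obs Q i (Suc n) \<omega>) \<partial>law Q A)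
        = (\<Prod>i\<in>sources Q. \<integral>\<^sup>+\<omega>. \<phi> i (obs Q i (Suc n) \<omega>) \<partial>law Q B)"
    proof (rule prod.cong[OF refl])
      fix i assume i: "i \<in> sources Q"
      consider "i \<in> ?U \<inter> S" | "i \<notin> ?U" | "i \<notin> S" by blast
      then show "(\<integral>\<^sup>+\<omega>. \<phi>' i (obs Q i (Suc n) \<omega>) \<partial>law Q A) = (\<integral>\<^sup>+\<omega>. \<phi> i (obs Q i (Suc n) \<omega>) \<partial>law Q B)"
      proof cases
        case 1
        then show ?thesis
          using nn_integral_obs_change[OF A B i _ _ \<phi>[of i], of "Suc n"] by (auto simp: \<phi>'_def)
      next
        case 2
        then show ?thesis
          using nn_integral_obs_same[OF A B i _ _ \<phi>[of i], of "Suc n"] by (auto simp: \<phi>'_def)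
      next
        case 3
        then show ?thesis
          using prob_space.emeasure_space_1[OF prob_law[OF A]] prob_space.emeasure_space_1[OF prob_law[OF B]]
          by (simp add: \<phi>'_def \<phi>_def)
      qed
    qed
    also have "(\<Prod>i\<in>sources Q. \<integral>\<^sup>+\<omega>. \<psi> i (aux Q i (Suc n) \<omega>) \<partial>law Q A)
        = (\<Prod>i\<in>sources Q. \<integral>\<^sup>+\<omega>. \<psi> i (aux Q i (Suc n) \<omega>) \<partial>law Q B)"
      by (intro prod.cong refl nn_integral_aux_same[OF A B _ \<psi>])
    also have "(\<integral>\<^sup>+\<omega>. indicator H \<omega> \<partial>law Q B)
        * (\<Prod>i\<in>sources Q. \<integral>\<^sup>+\<omega>. \<phi> i (obs Q i (Suc n) \<omega>) \<partial>law Q B)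
        * (\<Prod>i\<in>sources Q. \<integral>\<^sup>+\<omega>. \<psi> i (aux Q i (Suc n) \<omega>) \<partial>law Q B)
      = (\<integral>\<^sup>+\<omega>. indicator H \<omega> * (\<Prod>i\<in>sources Q. \<phi> i (obs Q i (Suc n) \<omega>))
        * (\<Prod>i\<in>sources Q. \<psi> i (aux Q i (Suc n) \<omega>)) \<partial>law Q B)"
      using H
      by (intro nn_integral_factor[OF B _ _ indep_history[OF B R] space_history _ \<phi> \<psi>, symmetric]) auto
    also have "\<dots> = (\<integral>\<^sup>+\<omega>. indicator X \<omega> \<partial>law Q B)"
      by (intro nn_integral_cong ind[symmetric]) (simp add: space_law[OF B])
    also have "\<dots> = emeasure (law Q B) X"
      using Xevent by (subst nn_integral_indicator) (auto simp: sets_law[OF B])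
    finally show ?thesis .
  qed
  let ?E = "cylinders Q R n"
  have RS: "R (Suc n) \<omega> \<subseteq> sources Q" if "\<omega> \<in> ?\<Omega>" for \<omega>
    using sampling_ruleD(2)[OF R _ that] by simp
  have obs: "obs Q i (Suc n) \<omega> \<in> space (obs_space Q)" if "\<omega> \<in> ?\<Omega>" "i \<in> sources Q" for \<omega> i
    using measurable_space[OF obs_measurable[OF that(2)]] that by simp
  have top: "?\<Omega> \<in> sets (history Q R n)"
    using sets.top[of "history Q R n"] by (simp add: space_history)
  let ?cov = "(\<lambda>S. cylinder Q R (Suc n) ?\<Omega> S (\<lambda>_. space (obs_space Q)) (\<lambda>_. UNIV)) ` Pow (sources Q)"
  have cov: "?cov \<subseteq> ?E"
    by (rule image_subsetI, rule cylindersI[OF top]) auto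
  have G_sig: "G \<in> sigma_sets ?\<Omega> ?E"
    using Suc.prems sets_history_Suc_cylinders[OF R] by blast
  have "emeasure D G = emeasure (law Q B) G"
  proof (rule emeasure_eq_on_sigma_sets[OF _ sets_law[OF B] Int_stable_cylinders cyl_events eq_cyl _ cov _ _ G_sig])
    show "sets D = sets (outcomes Q)" by (simp add: D_def sets_law[OF A])
    show "\<Union> ?cov = ?\<Omega>" 
    proof (rule equalityI)
      show "\<Union> ?cov \<subseteq> ?\<Omega>" unfolding cylinder_def by blast
      show "?\<Omega> \<subseteq> \<Union> ?cov"
      proof
        fix \<omega> assume \<omega>: "\<omega> \<in> ?\<Omega>"
        then have "\<omega> \<in> cylinder Q R (Suc n) ?\<Omega> (R (Suc n) \<omega>) (\<lambda>_. space (obs_space Q)) (\<lambda>_. UNIV)"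
          unfolding cylinder_def using RS[OF \<omega>] obs[OF \<omega>] by blast
        then show "\<omega> \<in> \<Union> ?cov" using RS[OF \<omega>] by blast
      qed
    qed
    show "emeasure (law Q B) X \<noteq> \<infinity>" for X
      using prob_space.emeasure_le_1[OF prob_law[OF B], of X] by (auto simp: top_unique)
    show "countable ?cov" by (intro countable_finite finite_imageI) simp
  qed
  moreover have "emeasure D G = (\<integral>\<^sup>+\<omega>. L (Suc n) \<omega> * indicator G \<omega> \<partial>law Q A)"
    unfolding D_def using Suc.prems hist_sub[of "Suc n"]
    by (intro emeasure_density Lm_A) (unfold sets_law[OF A], blast)
  ultimately show ?case by (simp add: L_def)
qed

end

section \<open>Deviations of adaptively sampled sums\<close>

primrec running_max :: "(nat \<Rightarrow> real) \<Rightarrow> nat \<Rightarrow> real" where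
  "running_max x 0 = \<bar>x 0\<bar>"
| "running_max x (Suc n) = max (running_max x n) \<bar>x (Suc n)\<bar>"

lemma running_max_ge: "m \<le> n \<Longrightarrow> \<bar>x m\<bar> \<le> running_max x n"
proof (induction n)
  case (Suc n)
  then show ?case by (cases "m = Suc n") auto
qed simp

lemma running_max_nonneg: "0 \<le> running_max x n"
  by (induction n) auto

lemma running_max_le: "(\<And>m. m \<le> n \<Longrightarrow> \<bar>x m\<bar> \<le> c) \<Longrightarrow> running_max x n \<le> c"
  by (induction n) auto

text \<open>
  Doob's \<open>L\<^sup>2\<close> inequality in pathwise form: when \<open>x\<close> is a martingale, the last sum has mean zero.
  Summation by parts against the running maximum \<open>M\<close> yields \<open>M\<^sub>n\<^sup>2 \<le> 2 M\<^sub>n |x\<^sub>n| - 2 \<Sum> M\<^sub>k \<Delta>|x|\<^sub>k\<close>, and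
  \<open>4 M\<^sub>n |x\<^sub>n| \<le> M\<^sub>n\<^sup>2 + 4 x\<^sub>n\<^sup>2\<close> absorbs the mixed term.
\<close>

lemma running_max_pathwise:
  fixes x :: "nat \<Rightarrow> real"
  assumes "x 0 = 0"
  shows "(running_max x n)\<^sup>2
    \<le> 4 * (x n)\<^sup>2 - 4 * (\<Sum>k<n. running_max x k * sgn (x k) * (x (Suc k) - x k))"
proof -
  let ?M = "running_max x"
  have *: "(?M n)\<^sup>2 - 2 * ?M n * \<bar>x n\<bar> + 2 * (\<Sum>k<n. ?M k * (\<bar>x (Suc k)\<bar> - \<bar>x k\<bar>)) \<le> 0"
  proof (induction n)
    case 0
    then show ?case using assms by simp
  next
    case (Suc n)
    show ?case
    proof (cases "\<bar>x (Suc n)\<bar> \<le> ?M n")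
      case True
      then have M: "?M (Suc n) = ?M n" by simp
      show ?thesis using Suc unfolding M by (simp add: algebra_simps)
    next
      case False
      then have M: "?M (Suc n) = \<bar>x (Suc n)\<bar>" by simp
      have "0 \<le> (\<bar>x (Suc n)\<bar> - ?M n)\<^sup>2" by simp
      then show ?thesis using Suc unfolding M by (simp add: algebra_simps power2_eq_square)
    qed
  qed
  have "(\<Sum>k<n. ?M k * sgn (x k) * (x (Suc k) - x k)) \<le> (\<Sum>k<n. ?M k * (\<bar>x (Suc k)\<bar> - \<bar>x k\<bar>))"
  proof (rule sum_mono)
    fix k
    have "sgn (x k) * (x (Suc k) - x k) \<le> \<bar>x (Suc k)\<bar> - \<bar>x k\<bar>"
      by (cases "x k" "0::real" rule: linorder_cases) auto
    then show "?M k * sgn (x k) * (x (Suc k) - x k) \<le> ?M k * (\<bar>x (Suc k)\<bar> - \<bar>x k\<bar>)"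
      using mult_left_mono[OF _ running_max_nonneg[of x k]] by (simp add: mult.assoc)
  qed
  moreover have "0 \<le> (?M n - 2 * \<bar>x n\<bar>)\<^sup>2" by simp
  then have "2 * (2 * ?M n * \<bar>x n\<bar>) \<le> (?M n)\<^sup>2 + 4 * (x n)\<^sup>2"
    by (simp add: power2_eq_square algebra_simps)
  ultimately show ?thesis using * by linarith
qed

context anomaly_model
begin

lemma measurable_law_history:
  "A \<subseteq> sources Q \<Longrightarrow> sampling_rule Q R \<Longrightarrow> f \<in> measurable (history Q R n) N \<Longrightarrow> f \<in> measurable (law Q A) N"
  using measurable_history by (simp add: measurable_law)

text \<open>
  Whether source \<open>i\<close> is sampled at time \<open>n + 1\<close> is decided by the history up to \<open>n\<close>, of which the new
  observation is independent; this is the only form in which the martingale property is used.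
\<close>

lemma integral_predictable:
  fixes h :: "'w \<Rightarrow> real" and \<phi> :: "'s \<Rightarrow> real"
  assumes A: "A \<subseteq> sources Q" and R: "sampling_rule Q R" and i: "i \<in> sources Q"
    and h: "h \<in> borel_measurable (history Q R n)" "integrable (law Q A) h"
    and \<phi>: "\<phi> \<in> borel_measurable (obs_space Q)" "integrable (law Q A) (\<lambda>\<omega>. \<phi> (obs Q i (Suc n) \<omega>))"
  shows "integrable (law Q A) (\<lambda>\<omega>. h \<omega> * \<phi> (obs Q i (Suc n) \<omega>))"
    and "(\<integral>\<omega>. h \<omega> * \<phi> (obs Q i (Suc n) \<omega>) \<partial>law Q A)
      = (\<integral>\<omega>. h \<omega> \<partial>law Q A) * (\<integral>\<omega>. \<phi> (obs Q i (Suc n) \<omega>) \<partial>law Q A)"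
proof -
  interpret prob_space "law Q A" by (rule prob_law[OF A])
  let ?X = "\<lambda>\<omega>. \<phi> (obs Q i (Suc n) \<omega>)"
  let ?c = "coord_sets Q (Inl (i, Suc n))"
  have isets: "indep_sets (case_option (sets (history Q R n)) (coord_sets Q)) {None, Some (Inl (i, Suc n))}"
    by (rule indep_sets_mono_index[OF _ indep_history[OF A R, of n]]) (use i in auto)
  have indep: "indep_set (sets (history Q R n)) ?c"
    unfolding indep_sets2_eq
  proof (intro conjI ballI)
    show "sets (history Q R n) \<subseteq> events" "?c \<subseteq> events"
      using isets unfolding indep_sets_def by auto
    fix a b assume ab: "a \<in> sets (history Q R n)" "b \<in> ?c"
    then have "\<forall>j\<in>{None, Some (Inl (i, Suc n))}.
        case_option a (\<lambda>_. b) j \<in> case_option (sets (history Q R n)) (coord_sets Q) j"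
      by auto
    from indep_setsD[OF isets order_refl _ _ this]
    show "prob (a \<inter> b) = prob a * prob b" by simp
  qed
  have "indep_set {h -` B \<inter> space (law Q A) |B. B \<in> sets borel} {?X -` B \<inter> space (law Q A) |B. B \<in> sets borel}"
    unfolding indep_sets2_eq
  proof (intro conjI ballI)
    have 1: "{h -` B \<inter> space (law Q A) |B. B \<in> sets borel} \<subseteq> sets (history Q R n)"
      using measurable_sets[OF h(1)] by (auto simp: space_history space_law[OF A])
    have 2: "{?X -` B \<inter> space (law Q A) |B. B \<in> sets borel} \<subseteq> ?c"
    proof
      fix G assume "G \<in> {?X -` B \<inter> space (law Q A) |B. B \<in> sets borel}"
      then obtain B where B: "B \<in> sets borel" and G: "G = ?X -` B \<inter> space (outcomes Q)"
        by (auto simp: space_law[OF A])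
      have "obs Q i (Suc n) \<omega> \<in> space (obs_space Q)" if "\<omega> \<in> space (outcomes Q)" for \<omega>
        using measurable_space[OF obs_measurable[OF i]] that by simp
      then have "G = obs Q i (Suc n) -` (\<phi> -` B \<inter> space (obs_space Q)) \<inter> space (outcomes Q)"
        by (auto simp: G)
      then show "G \<in> ?c"
        unfolding coord_sets_def using measurable_sets[OF \<phi>(1) B] by (simp del: vimage_Int) blast
    qed
    show "{h -` B \<inter> space (law Q A) |B. B \<in> sets borel} \<subseteq> events"
      "{?X -` B \<inter> space (law Q A) |B. B \<in> sets borel} \<subseteq> events"
      using 1 2 indep unfolding indep_sets2_eq by auto
    fix a b assume "a \<in> {h -` B \<inter> space (law Q A) |B. B \<in> sets borel}"
      "b \<in> {?X -` B \<inter> space (law Q A) |B. B \<in> sets borel}"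
    then show "prob (a \<inter> b) = prob a * prob b"
      using 1 2 indep unfolding indep_sets2_eq by blast
  qed
  then have "indep_set (sigma_sets (space (law Q A)) {h -` B \<inter> space (law Q A) |B. B \<in> sets borel})
     (sigma_sets (space (law Q A)) {?X -` B \<inter> space (law Q A) |B. B \<in> sets borel})"
    by (rule indep_set_sigma_sets) (rule Int_stable_vimage_sets)+
  then have "indep_var borel h borel ?X"
    unfolding indep_var_eq using h(2) \<phi>(2) by auto
  from indep_var_integrable[OF this h(2) \<phi>(2)] indep_var_lebesgue_integral[OF this h(2) \<phi>(2)]
  show "integrable (law Q A) (\<lambda>\<omega>. h \<omega> * ?X \<omega>)"
    "(\<integral>\<omega>. h \<omega> * ?X \<omega> \<partial>law Q A) = (\<integral>\<omega>. h \<omega> \<partial>law Q A) * (\<integral>\<omega>. ?X \<omega> \<partial>law Q A)" by auto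
qed

definition stopped_sum :: "'w rule \<Rightarrow> ('w \<Rightarrow> nat) \<Rightarrow> nat \<Rightarrow> ('s \<Rightarrow> real) \<Rightarrow> nat \<Rightarrow> 'w \<Rightarrow> real" where
  "stopped_sum R \<tau> i \<phi> n \<omega> = (\<Sum>m=1..n. of_bool (i \<in> R m \<omega> \<and> m \<le> \<tau> \<omega>) * \<phi> (obs Q i m \<omega>))"

text \<open>
  A stopping time with values in \<^typ>\<open>nat\<close>, stated through \<open>n < \<tau>\<close> because this event decides whether
  the observation at time \<open>n + 1\<close> counts.
\<close>

definition stopping :: "'w rule \<Rightarrow> ('w \<Rightarrow> nat) \<Rightarrow> bool" where
  "stopping R \<tau> \<longleftrightarrow> (\<forall>n. {\<omega> \<in> space (outcomes Q). n < \<tau> \<omega>} \<in> sets (history Q R n))"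

lemma selector_measurable:
  assumes R: "sampling_rule Q R" and \<tau>: "stopping R \<tau>"
  shows "(\<lambda>\<omega>. of_bool (i \<in> R (Suc n) \<omega> \<and> Suc n \<le> \<tau> \<omega>) :: real) \<in> borel_measurable (history Q R n)"
proof -
  have "{\<omega> \<in> space (outcomes Q). i \<in> R (Suc n) \<omega>} \<inter> {\<omega> \<in> space (outcomes Q). n < \<tau> \<omega>} \<in> sets (history Q R n)"
    using sampling_rule_sets[OF R, of "\<lambda>S. i \<in> S" n] \<tau> by (auto simp: stopping_def)
  then have "indicator ({\<omega> \<in> space (outcomes Q). i \<in> R (Suc n) \<omega>} \<inter> {\<omega> \<in> space (outcomes Q). n < \<tau> \<omega>})
      \<in> (borel_measurable (history Q R n) :: ('w \<Rightarrow> real) set)"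
    by simp
  then show ?thesis
    by (rule measurable_cong[THEN iffD1, rotated]) (auto simp: space_history Suc_le_eq)
qed

lemma stopped_sum_measurable:
  assumes R: "sampling_rule Q R" and \<tau>: "stopping R \<tau>" and i: "i \<in> sources Q"
    and \<phi>: "\<phi> \<in> borel_measurable (obs_space Q)"
  shows "stopped_sum R \<tau> i \<phi> n \<in> borel_measurable (history Q R n)"
proof (induction n)
  case 0
  then show ?case by (simp add: stopped_sum_def[abs_def])
next
  case (Suc n)
  have s: "(\<lambda>\<omega>. of_bool (i \<in> R (Suc n) \<omega> \<and> Suc n \<le> \<tau> \<omega>) :: real) \<in> borel_measurable (history Q R (Suc n))"
    by (rule measurable_history_mono[OF _ selector_measurable[OF R \<tau>]]) simp
  have w: "(\<lambda>\<omega>. (\<Sum>m=1..k. \<phi> (obs Q i m \<omega>) * of_bool (i \<in> R m \<omega>))) \<in> borel_measurable (history Q R (Suc n))"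
    if "k \<le> Suc n" for k
    by (rule measurable_history_mono[OF that sampled_sum_measurable[OF R i \<phi>]])
  have x: "stopped_sum R \<tau> i \<phi> n \<in> borel_measurable (history Q R (Suc n))"
    by (rule measurable_history_mono[OF _ Suc]) simp
  have eq: "stopped_sum R \<tau> i \<phi> (Suc n) \<omega> = stopped_sum R \<tau> i \<phi> n \<omega>
      + of_bool (i \<in> R (Suc n) \<omega> \<and> Suc n \<le> \<tau> \<omega>) *
        ((\<Sum>m=1..Suc n. \<phi> (obs Q i m \<omega>) * of_bool (i \<in> R m \<omega>)) - (\<Sum>m=1..n. \<phi> (obs Q i m \<omega>) * of_bool (i \<in> R m \<omega>)))"
    for \<omega> by (simp add: stopped_sum_def)
  show ?case
    using x s w[of "Suc n"] w[of n] unfolding eq[abs_def]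
    by (intro borel_measurable_add borel_measurable_times borel_measurable_diff) auto
qed

lemma stopped_sum_Suc: "stopped_sum R \<tau> i \<phi> (Suc n) \<omega> = stopped_sum R \<tau> i \<phi> n \<omega>
    + of_bool (i \<in> R (Suc n) \<omega> \<and> Suc n \<le> \<tau> \<omega>) * \<phi> (obs Q i (Suc n) \<omega>)"
  by (simp add: stopped_sum_def)

lemma obs_in_space: "i \<in> sources Q \<Longrightarrow> 1 \<le> n \<Longrightarrow> \<omega> \<in> space (outcomes Q) \<Longrightarrow> obs Q i n \<omega> \<in> space (obs_space Q)"
  using measurable_space[OF obs_measurable] by blast

lemma stopped_sum_bound:
  assumes i: "i \<in> sources Q" and b: "\<And>x. x \<in> space (obs_space Q) \<Longrightarrow> \<bar>\<phi> x\<bar> \<le> b"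
    and \<omega>: "\<omega> \<in> space (outcomes Q)"
  shows "\<bar>stopped_sum R \<tau> i \<phi> n \<omega>\<bar> \<le> real n * b"
proof -
  have "\<bar>stopped_sum R \<tau> i \<phi> n \<omega>\<bar> \<le> (\<Sum>m=1..n. \<bar>of_bool (i \<in> R m \<omega> \<and> m \<le> \<tau> \<omega>) * \<phi> (obs Q i m \<omega>)\<bar>)"
    unfolding stopped_sum_def by (rule sum_abs)
  also have "\<dots> \<le> (\<Sum>m=1..n. b)"
  proof (rule sum_mono)
    fix m assume "m \<in> {1..n}"
    then have "\<bar>\<phi> (obs Q i m \<omega>)\<bar> \<le> b" using obs_in_space[OF i _ \<omega>] b by auto
    moreover then have "0 \<le> b" by linarith
    ultimately show "\<bar>of_bool (i \<in> R m \<omega> \<and> m \<le> \<tau> \<omega>) * \<phi> (obs Q i m \<omega>)\<bar> \<le> b"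
      by (auto simp: abs_mult)
  qed
  finally show ?thesis by simp
qed

lemma running_max_measurable:
  assumes "\<And>m. m \<le> n \<Longrightarrow> x m \<in> borel_measurable M"
  shows "(\<lambda>\<omega>. running_max (\<lambda>m. x m \<omega>) n) \<in> borel_measurable M"
  using assms by (induction n) auto

text \<open>
  The bound grows with the mean number of observations taken before \<open>\<tau>\<close> rather than with the horizon
  \<open>n\<close>, which is essential since only \<open>E[\<tau>]\<close> is under control later.
\<close>

lemma stopped_sum_maximal:
  assumes A: "A \<subseteq> sources Q" and R: "sampling_rule Q R" and \<tau>: "stopping R \<tau>" and i: "i \<in> sources Q"
    and \<phi>: "\<phi> \<in> borel_measurable (obs_space Q)"
    and b: "\<And>x. x \<in> space (obs_space Q) \<Longrightarrow> \<bar>\<phi> x\<bar> \<le> b"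
    and mean: "\<And>m. 1 \<le> m \<Longrightarrow> (\<integral>\<omega>. \<phi> (obs Q i m \<omega>) \<partial>law Q A) = 0"
  shows "integrable (law Q A) (\<lambda>\<omega>. (running_max (\<lambda>m. stopped_sum R \<tau> i \<phi> m \<omega>) n)\<^sup>2)"
    and "(\<integral>\<omega>. (running_max (\<lambda>m. stopped_sum R \<tau> i \<phi> m \<omega>) n)\<^sup>2 \<partial>law Q A)
      \<le> 4 * b\<^sup>2 * (\<Sum>m=1..n. \<integral>\<omega>. of_bool (i \<in> R m \<omega> \<and> m \<le> \<tau> \<omega>) \<partial>law Q A)"
proof -
  interpret prob_space "law Q A" by (rule prob_law[OF A])
  define x where "x = (\<lambda>m \<omega>. stopped_sum R \<tau> i \<phi> m \<omega>)"
  define M where "M = (\<lambda>m \<omega>. running_max (\<lambda>m. x m \<omega>) m)"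
  define h where "h = (\<lambda>m \<omega>. of_bool (i \<in> R m \<omega> \<and> m \<le> \<tau> \<omega>) :: real)"
  have x_hist: "x m \<in> borel_measurable (history Q R m)" for m
    unfolding x_def by (rule stopped_sum_measurable[OF R \<tau> i \<phi>])
  have M_hist: "M m \<in> borel_measurable (history Q R m)" for m
    unfolding M_def by (intro running_max_measurable measurable_history_mono[OF _ x_hist])
  have h_hist: "h (Suc m) \<in> borel_measurable (history Q R m)" for m
    unfolding h_def by (rule selector_measurable[OF R \<tau>])
  have x_b: "\<bar>x m \<omega>\<bar> \<le> real m * b" if "\<omega> \<in> space (law Q A)" for m \<omega>
    unfolding x_def using stopped_sum_bound[OF i b] that by (simp add: space_law[OF A])
  obtain x0 where "x0 \<in> space (obs_space Q)"
    using obs_in_space[OF i, of 1] not_empty by (auto simp: space_law[OF A])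
  then have b0: "0 \<le> b" using b[of x0] by linarith
  have M_b: "\<bar>M m \<omega>\<bar> \<le> real m * b" if "\<omega> \<in> space (law Q A)" for m \<omega>
  proof -
    have "M m \<omega> \<le> real m * b"
      unfolding M_def
    proof (rule running_max_le)
      fix k assume "k \<le> m"
      then have "real k * b \<le> real m * b" using b0 by (intro mult_right_mono) auto
      then show "\<bar>x k \<omega>\<bar> \<le> real m * b" using x_b[OF that, of k] by linarith
    qed
    then show ?thesis using running_max_nonneg[of "\<lambda>m. x m \<omega>" m] by (simp add: M_def)
  qed
  have bounded: "integrable (law Q A) f" if "f \<in> borel_measurable (history Q R m)"
    "\<And>\<omega>. \<omega> \<in> space (law Q A) \<Longrightarrow> \<bar>f \<omega>\<bar> \<le> c" for f :: "'w \<Rightarrow> real" and m c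
    using that by (intro integrable_const_bound[of _ c] measurable_law_history[OF A R, of f m] AE_I2) auto
  have h_b: "\<bar>h m \<omega>\<bar> \<le> 1" for m \<omega> by (simp add: h_def)
  have \<phi>_int: "integrable (law Q A) (\<lambda>\<omega>. \<phi> (obs Q i (Suc m) \<omega>))" for m
  proof (intro integrable_const_bound[of _ b] AE_I2)
    show "(\<lambda>\<omega>. \<phi> (obs Q i (Suc m) \<omega>)) \<in> borel_measurable (law Q A)"
      using measurable_compose[OF obs_measurable[OF i] \<phi>] by (simp add: measurable_law[OF A])
    show "norm (\<phi> (obs Q i (Suc m) \<omega>)) \<le> b" if "\<omega> \<in> space (law Q A)" for \<omega>
      using b obs_in_space[OF i] that by (simp add: space_law[OF A])
  qed
  have cross: "integrable (law Q A) (\<lambda>\<omega>. f \<omega> * h (Suc m) \<omega> * \<phi> (obs Q i (Suc m) \<omega>))"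
    "(\<integral>\<omega>. f \<omega> * h (Suc m) \<omega> * \<phi> (obs Q i (Suc m) \<omega>) \<partial>law Q A) = 0"
    if f: "f \<in> borel_measurable (history Q R m)" "\<And>\<omega>. \<omega> \<in> space (law Q A) \<Longrightarrow> \<bar>f \<omega>\<bar> \<le> c"
    for f :: "'w \<Rightarrow> real" and m c
  proof -
    have fh: "(\<lambda>\<omega>. f \<omega> * h (Suc m) \<omega>) \<in> borel_measurable (history Q R m)"
      using f h_hist by measurable
    have int: "integrable (law Q A) (\<lambda>\<omega>. f \<omega> * h (Suc m) \<omega>)"
    proof (rule bounded[OF fh, of c])
      fix \<omega> assume "\<omega> \<in> space (law Q A)"
      then show "\<bar>f \<omega> * h (Suc m) \<omega>\<bar> \<le> c"
        using f(2)[of \<omega>] by (auto simp: h_def abs_mult)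
    qed
    from integral_predictable[OF A R i fh int \<phi> \<phi>_int] mean[of "Suc m"]
    show "integrable (law Q A) (\<lambda>\<omega>. f \<omega> * h (Suc m) \<omega> * \<phi> (obs Q i (Suc m) \<omega>))"
      "(\<integral>\<omega>. f \<omega> * h (Suc m) \<omega> * \<phi> (obs Q i (Suc m) \<omega>) \<partial>law Q A) = 0" by auto
  qed
  have sq_bound: "\<bar>y\<^sup>2\<bar> \<le> c\<^sup>2" if "\<bar>y\<bar> \<le> c" for y c :: real
    using that by (simp add: abs_le_square_iff[symmetric])
  have x2_int: "integrable (law Q A) (\<lambda>\<omega>. (x m \<omega>)\<^sup>2)" for m
    by (rule bounded[of _ m "(real m * b)\<^sup>2"]) (use x_hist sq_bound[OF x_b] in auto)
  have M2_int: "integrable (law Q A) (\<lambda>\<omega>. (M m \<omega>)\<^sup>2)" for m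
    by (rule bounded[of _ m "(real m * b)\<^sup>2"]) (use M_hist sq_bound[OF M_b] in auto)
  have h_int: "integrable (law Q A) (h (Suc m))" for m
    by (rule bounded[OF h_hist h_b])
  have x_Suc: "x (Suc m) \<omega> = x m \<omega> + h (Suc m) \<omega> * \<phi> (obs Q i (Suc m) \<omega>)" for m \<omega>
    by (simp add: x_def h_def stopped_sum_Suc)
  have x2: "(\<integral>\<omega>. (x m \<omega>)\<^sup>2 \<partial>law Q A) \<le> b\<^sup>2 * (\<Sum>k=1..m. \<integral>\<omega>. h k \<omega> \<partial>law Q A)" for m
  proof (induction m)
    case 0
    then show ?case by (simp add: x_def stopped_sum_def)
  next
    case (Suc m)
    have "(\<integral>\<omega>. (x (Suc m) \<omega>)\<^sup>2 \<partial>law Q A)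
       \<le> (\<integral>\<omega>. (x m \<omega>)\<^sup>2 + 2 * (x m \<omega> * h (Suc m) \<omega> * \<phi> (obs Q i (Suc m) \<omega>)) + b\<^sup>2 * h (Suc m) \<omega> \<partial>law Q A)"
    proof (rule integral_mono)
      show "integrable (law Q A) (\<lambda>\<omega>. (x m \<omega>)\<^sup>2 + 2 * (x m \<omega> * h (Suc m) \<omega> * \<phi> (obs Q i (Suc m) \<omega>)) + b\<^sup>2 * h (Suc m) \<omega>)"
        using x2_int cross(1)[OF x_hist x_b] h_int by auto
      fix \<omega> assume \<omega>: "\<omega> \<in> space (law Q A)"
      have "(h (Suc m) \<omega> * \<phi> (obs Q i (Suc m) \<omega>))\<^sup>2 \<le> b\<^sup>2 * h (Suc m) \<omega>"
        using sq_bound[OF b[OF obs_in_space[OF i]], of "Suc m" \<omega>] \<omega>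
        by (auto simp: h_def space_law[OF A])
      then show "(x (Suc m) \<omega>)\<^sup>2 \<le> (x m \<omega>)\<^sup>2 + 2 * (x m \<omega> * h (Suc m) \<omega> * \<phi> (obs Q i (Suc m) \<omega>)) + b\<^sup>2 * h (Suc m) \<omega>"
        unfolding x_Suc by (simp add: power2_sum algebra_simps)
    qed (rule x2_int)
    also have "\<dots> = (\<integral>\<omega>. (x m \<omega>)\<^sup>2 \<partial>law Q A) + b\<^sup>2 * (\<integral>\<omega>. h (Suc m) \<omega> \<partial>law Q A)"
      using x2_int cross[OF x_hist x_b] h_int by simp
    finally show ?case using Suc by (simp add: algebra_simps)
  qed
  show "integrable (law Q A) (\<lambda>\<omega>. (running_max (\<lambda>m. stopped_sum R \<tau> i \<phi> m \<omega>) n)\<^sup>2)"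
    using M2_int by (simp add: M_def x_def)
  have f_hist: "(\<lambda>\<omega>. M k \<omega> * sgn (x k \<omega>)) \<in> borel_measurable (history Q R k)" for k
    using M_hist[of k] x_hist[of k] by measurable
  have f_b: "\<bar>M k \<omega> * sgn (x k \<omega>)\<bar> \<le> real k * b" if "\<omega> \<in> space (law Q A)" for k \<omega>
    using M_b[OF that, of k] b0 by (auto simp: abs_mult sgn_if)
  have "(\<integral>\<omega>. (M n \<omega>)\<^sup>2 \<partial>law Q A) \<le> (\<integral>\<omega>. 4 * (x n \<omega>)\<^sup>2
      - 4 * (\<Sum>k<n. M k \<omega> * sgn (x k \<omega>) * h (Suc k) \<omega> * \<phi> (obs Q i (Suc k) \<omega>)) \<partial>law Q A)"
  proof (rule integral_mono)
    show "integrable (law Q A) (\<lambda>\<omega>. 4 * (x n \<omega>)\<^sup>2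
      - 4 * (\<Sum>k<n. M k \<omega> * sgn (x k \<omega>) * h (Suc k) \<omega> * \<phi> (obs Q i (Suc k) \<omega>)))"
      using x2_int cross(1)[OF f_hist f_b] by (intro Bochner_Integration.integrable_diff integrable_mult_right Bochner_Integration.integrable_sum) auto
    fix \<omega>
    show "(M n \<omega>)\<^sup>2 \<le> 4 * (x n \<omega>)\<^sup>2
      - 4 * (\<Sum>k<n. M k \<omega> * sgn (x k \<omega>) * h (Suc k) \<omega> * \<phi> (obs Q i (Suc k) \<omega>))"
      using running_max_pathwise[of "\<lambda>m. x m \<omega>" n] unfolding M_def x_Suc
      by (simp add: x_def stopped_sum_def mult.assoc)
  qed (rule M2_int)
  also have "\<dots> = 4 * (\<integral>\<omega>. (x n \<omega>)\<^sup>2 \<partial>law Q A)"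
    using x2_int cross[OF f_hist f_b]
    by (subst Bochner_Integration.integral_diff) (auto simp: Bochner_Integration.integral_sum)
  also have "\<dots> \<le> 4 * b\<^sup>2 * (\<Sum>m=1..n. \<integral>\<omega>. h m \<omega> \<partial>law Q A)"
    using x2[of n] by simp
  finally show "(\<integral>\<omega>. (running_max (\<lambda>m. stopped_sum R \<tau> i \<phi> m \<omega>) n)\<^sup>2 \<partial>law Q A)
      \<le> 4 * b\<^sup>2 * (\<Sum>m=1..n. \<integral>\<omega>. of_bool (i \<in> R m \<omega> \<and> m \<le> \<tau> \<omega>) \<partial>law Q A)"
    by (simp add: M_def x_def h_def)
qed


definition sample_count :: "'w rule \<Rightarrow> nat \<Rightarrow> nat \<Rightarrow> 'w \<Rightarrow> real" where
  "sample_count R i n \<omega> = (\<Sum>m=1..n. of_bool (i \<in> R m \<omega>))"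

lemma obs_identically_distributed:
  fixes f :: "'s \<Rightarrow> real"
  assumes A: "A \<subseteq> sources Q" and i: "i \<in> sources Q" and m: "1 \<le> m" "1 \<le> n"
    and f: "f \<in> borel_measurable (obs_space Q)"
  shows "integrable (law Q A) (\<lambda>\<omega>. f (obs Q i m \<omega>)) \<longleftrightarrow> integrable (law Q A) (\<lambda>\<omega>. f (obs Q i n \<omega>))"
    and "(\<integral>\<omega>. f (obs Q i m \<omega>) \<partial>law Q A) = (\<integral>\<omega>. f (obs Q i n \<omega>) \<partial>law Q A)"
proof -
  have f': "f \<in> borel_measurable (ref Q i)" using f by (simp add: measurable_ref[OF i])
  have nn: "\<And>x. x \<in> space (ref Q i) \<Longrightarrow> 0 \<le> dens Q A i x"
    using dens_nonneg'[OF i] by (simp add: space_ref[OF i])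
  show "integrable (law Q A) (\<lambda>\<omega>. f (obs Q i m \<omega>)) \<longleftrightarrow> integrable (law Q A) (\<lambda>\<omega>. f (obs Q i n \<omega>))"
    using distributed_integrable[OF obs_distributed'[OF A i m(1)] f' nn]
      distributed_integrable[OF obs_distributed'[OF A i m(2)] f' nn] by simp
  show "(\<integral>\<omega>. f (obs Q i m \<omega>) \<partial>law Q A) = (\<integral>\<omega>. f (obs Q i n \<omega>) \<partial>law Q A)"
    using distributed_integral[OF obs_distributed'[OF A i m(1)] f' nn]
      distributed_integral[OF obs_distributed'[OF A i m(2)] f' nn] by simp
qed

lemma gain_tail:
  assumes A: "A \<subseteq> sources Q" and i: "i \<in> sources Q" and \<epsilon>: "0 < \<epsilon>"
  obtains c where "0 < c"
    "(\<integral>\<omega>. (if \<bar>gain Q A i (obs Q i 1 \<omega>)\<bar> \<le> c then 0 else \<bar>gain Q A i (obs Q i 1 \<omega>)\<bar>) \<partial>law Q A) < \<epsilon>"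
proof -
  define g where "g = (\<lambda>\<omega>. gain Q A i (obs Q i 1 \<omega>))"
  have int: "integrable (law Q A) g" using gain_integrable(1)[OF A i, of 1] by (simp add: g_def)
  then have [measurable]: "g \<in> borel_measurable (law Q A)" by simp
  have "(\<lambda>n. \<integral>\<omega>. (if \<bar>g \<omega>\<bar> \<le> real n then 0 else \<bar>g \<omega>\<bar>) \<partial>law Q A) \<longlonglongrightarrow> (\<integral>\<omega>. 0 \<partial>law Q A)"
  proof (rule integral_dominated_convergence[where w = "\<lambda>\<omega>. \<bar>g \<omega>\<bar>"])
    show "AE \<omega> in law Q A. (\<lambda>n. if \<bar>g \<omega>\<bar> \<le> real n then 0 else \<bar>g \<omega>\<bar>) \<longlonglongrightarrow> 0"
    proof (rule AE_I2)
      fix \<omega>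
      obtain n0 where "\<bar>g \<omega>\<bar> \<le> real n0" using real_arch_simple by blast
      then have "eventually (\<lambda>n. (if \<bar>g \<omega>\<bar> \<le> real n then 0 else \<bar>g \<omega>\<bar>) = 0) sequentially"
        by (intro eventually_sequentiallyI[of n0]) auto
      then show "(\<lambda>n. if \<bar>g \<omega>\<bar> \<le> real n then 0 else \<bar>g \<omega>\<bar>) \<longlonglongrightarrow> 0"
        by (rule tendsto_eventually)
    qed
    show "integrable (law Q A) (\<lambda>\<omega>. \<bar>g \<omega>\<bar>)" using int by simp
  qed auto
  then have "eventually (\<lambda>n. (\<integral>\<omega>. (if \<bar>g \<omega>\<bar> \<le> real n then 0 else \<bar>g \<omega>\<bar>) \<partial>law Q A) < \<epsilon>) sequentially"
    using \<epsilon> by (intro order_tendstoD(2)) auto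
  moreover have "eventually (\<lambda>n::nat. 0 < n) sequentially" by (rule eventually_gt_at_top)
  ultimately have "eventually (\<lambda>n. 0 < n \<and> (\<integral>\<omega>. (if \<bar>g \<omega>\<bar> \<le> real n then 0 else \<bar>g \<omega>\<bar>) \<partial>law Q A) < \<epsilon>) sequentially"
    by (rule eventually_conj[rotated])
  then obtain n :: nat where "0 < n" "(\<integral>\<omega>. (if \<bar>g \<omega>\<bar> \<le> real n then 0 else \<bar>g \<omega>\<bar>) \<partial>law Q A) < \<epsilon>"
    using eventually_happens' sequentially_bot by blast
  then show thesis unfolding g_def by (intro that[of "real n"]) simp_all
qed

lemma stopping_integrable:
  assumes A: "A \<subseteq> sources Q" and R: "sampling_rule Q R" and \<tau>: "stopping R \<tau>"
    and N: "\<And>\<omega>. \<omega> \<in> space (outcomes Q) \<Longrightarrow> \<tau> \<omega> \<le> N"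
  shows "integrable (law Q A) (\<lambda>\<omega>. real (\<tau> \<omega>))"
proof -
  interpret prob_space "law Q A" by (rule prob_law[OF A])
  have "{\<omega> \<in> space (outcomes Q). n < \<tau> \<omega>} \<in> sets (law Q A)" for n
    using \<tau> sets_history_subset[OF R, of n] unfolding stopping_def sets_law[OF A] by blast
  then have m: "indicator {\<omega> \<in> space (outcomes Q). n < \<tau> \<omega>} \<in> (borel_measurable (law Q A) :: ('w \<Rightarrow> real) set)" for n
    by simp
  have "real (\<tau> \<omega>) = (\<Sum>n<N. indicator {\<omega> \<in> space (outcomes Q). n < \<tau> \<omega>} \<omega>)"
    if "\<omega> \<in> space (law Q A)" for \<omega>
  proof -
    have \<omega>: "\<omega> \<in> space (outcomes Q)" using that by (simp add: space_law[OF A])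
    have "(\<Sum>n<N. indicator {\<omega> \<in> space (outcomes Q). n < \<tau> \<omega>} \<omega>) = (\<Sum>n<\<tau> \<omega>. 1 :: real)"
      using N[OF \<omega>] \<omega> by (intro sum.mono_neutral_cong_right) auto
    then show ?thesis by simp
  qed
  then have "(\<lambda>\<omega>. real (\<tau> \<omega>)) \<in> borel_measurable (law Q A)"
    by (subst measurable_cong) (use m in \<open>auto intro!: borel_measurable_sum\<close>)
  then show ?thesis
    using N by (intro integrable_const_bound[of _ "real N"] AE_I2) (auto simp: space_law[OF A])
qed

text \<open>
  The constant \<open>C\<close> must serve all sampling rules and stopping times at once, since the lower bound
  ranges over all policies and the upper bound over all thresholds.
\<close>

definition deviation_control :: "nat set \<Rightarrow> nat set \<Rightarrow> real \<Rightarrow> real \<Rightarrow> bool" where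
  "deviation_control A S \<epsilon> C \<longleftrightarrow> (\<forall>R \<tau> N. sampling_rule Q R \<longrightarrow> stopping R \<tau> \<longrightarrow>
     (\<forall>\<omega>\<in>space (outcomes Q). \<tau> \<omega> \<le> N) \<longrightarrow>
     (\<exists>X. integrable (law Q A) X \<and> (\<integral>\<omega>. X \<omega> \<partial>law Q A) \<le> \<epsilon> * (\<integral>\<omega>. real (\<tau> \<omega>) \<partial>law Q A) + C \<and>
       (\<forall>\<omega>\<in>space (outcomes Q). \<forall>n\<le>\<tau> \<omega>.
         (\<Sum>i\<in>S. \<bar>walk Q A R i n \<omega> - strength Q A i * sample_count R i n \<omega>\<bar>) \<le> X \<omega>)))"

lemma deviation_controlE:
  assumes dev: "deviation_control A S \<epsilon> C" and R: "sampling_rule Q R" and \<tau>: "stopping R \<tau>"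
    and N: "\<And>\<omega>. \<omega> \<in> space (outcomes Q) \<Longrightarrow> \<tau> \<omega> \<le> N"
  obtains X where "integrable (law Q A) X"
    "(\<integral>\<omega>. X \<omega> \<partial>law Q A) \<le> \<epsilon> * (\<integral>\<omega>. real (\<tau> \<omega>) \<partial>law Q A) + C"
    "\<And>\<omega> n. \<omega> \<in> space (outcomes Q) \<Longrightarrow> n \<le> \<tau> \<omega> \<Longrightarrow>
      (\<Sum>i\<in>S. \<bar>walk Q A R i n \<omega> - strength Q A i * sample_count R i n \<omega>\<bar>) \<le> X \<omega>"
proof -
  from dev[unfolded deviation_control_def, rule_format, OF R \<tau> N]
  obtain X where X: "integrable (law Q A) X \<and> (\<integral>\<omega>. X \<omega> \<partial>law Q A) \<le> \<epsilon> * (\<integral>\<omega>. real (\<tau> \<omega>) \<partial>law Q A) + C \<and>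
       (\<forall>\<omega>\<in>space (outcomes Q). \<forall>n\<le>\<tau> \<omega>.
         (\<Sum>i\<in>S. \<bar>walk Q A R i n \<omega> - strength Q A i * sample_count R i n \<omega>\<bar>) \<le> X \<omega>)" ..
  show thesis by (rule that[of X]) (use X in simp_all)
qed

text \<open>
  The centred gain is split at a level \<open>c\<close> into a part \<open>\<phi>1\<close> bounded by \<open>2 c\<close> and a part \<open>\<phi>2\<close> of small
  absolute mean.  The first has a maximum of order \<open>sqrt E[\<tau>]\<close>, which is below \<open>\<epsilon> E[\<tau>] / 2\<close> plus a
  constant; the second is summed in absolute value, and Wald's identity bounds that by \<open>\<epsilon> E[\<tau>] / 2\<close>.
\<close>

lemma maximal_deviation:
  assumes A: "A \<subseteq> sources Q" and i: "i \<in> sources Q" and \<epsilon>: "0 < \<epsilon>"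
  obtains C where "deviation_control A {i} \<epsilon> C"
proof -
  interpret prob_space "law Q A" by (rule prob_law[OF A])
  obtain c where c: "0 < c" and tail:
    "(\<integral>\<omega>. (if \<bar>gain Q A i (obs Q i 1 \<omega>)\<bar> \<le> c then 0 else \<bar>gain Q A i (obs Q i 1 \<omega>)\<bar>) \<partial>law Q A) < \<epsilon> / 4"
    using gain_tail[OF A i, of "\<epsilon> / 4"] \<epsilon> by auto
  define g where "g = gain Q A i"
  have g[measurable]: "g \<in> borel_measurable (obs_space Q)" unfolding g_def by (rule gain_measurable[OF i])
  define s l where "s = (\<lambda>x. if \<bar>g x\<bar> \<le> c then g x else 0)" and "l = (\<lambda>x. if \<bar>g x\<bar> \<le> c then 0 else g x)"
  have s[measurable]: "s \<in> borel_measurable (obs_space Q)" and l[measurable]: "l \<in> borel_measurable (obs_space Q)"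
    unfolding s_def l_def by measurable
  have obs_m: "obs Q i 1 \<in> law Q A \<rightarrow>\<^sub>M obs_space Q"
    using obs_measurable[OF i, of 1] by (simp add: measurable_law[OF A])
  define a1 where "a1 = (\<integral>\<omega>. s (obs Q i 1 \<omega>) \<partial>law Q A)"
  define a2 where "a2 = (\<integral>\<omega>. l (obs Q i 1 \<omega>) \<partial>law Q A)"
  have g_int: "integrable (law Q A) (\<lambda>\<omega>. g (obs Q i 1 \<omega>))"
    using gain_integrable(1)[OF A i, of 1] by (simp add: g_def)
  have s_int: "integrable (law Q A) (\<lambda>\<omega>. s (obs Q i 1 \<omega>))"
    by (rule Bochner_Integration.integrable_bound[OF g_int])
      (use measurable_compose[OF obs_m s] in \<open>auto simp: s_def\<close>)
  have l_int: "integrable (law Q A) (\<lambda>\<omega>. l (obs Q i 1 \<omega>))"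
    by (rule Bochner_Integration.integrable_bound[OF g_int])
      (use measurable_compose[OF obs_m l] in \<open>auto simp: l_def\<close>)
  have sl: "s x + l x = g x" for x by (simp add: s_def l_def)
  have a12: "a1 + a2 = strength Q A i"
    using gain_integrable(2)[OF A i, of 1] s_int l_int
    unfolding a1_def a2_def by (simp add: Bochner_Integration.integral_add[symmetric] sl g_def del: Bochner_Integration.integral_add)
  have abs_l: "(\<integral>\<omega>. \<bar>l (obs Q i 1 \<omega>)\<bar> \<partial>law Q A) < \<epsilon> / 4"
  proof -
    have "\<bar>l (obs Q i 1 \<omega>)\<bar> = (if \<bar>gain Q A i (obs Q i 1 \<omega>)\<bar> \<le> c then 0 else \<bar>gain Q A i (obs Q i 1 \<omega>)\<bar>)" for \<omega>
      by (simp add: l_def g_def)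
    then show ?thesis using tail by presburger
  qed
  have a2_le: "\<bar>a2\<bar> < \<epsilon> / 4"
    using integral_abs_bound[of "law Q A" "\<lambda>\<omega>. l (obs Q i 1 \<omega>)"] abs_l unfolding a2_def by linarith
  have a1_le: "\<bar>a1\<bar> \<le> c"
  proof -
    have "\<bar>a1\<bar> \<le> (\<integral>\<omega>. \<bar>s (obs Q i 1 \<omega>)\<bar> \<partial>law Q A)" unfolding a1_def by (rule integral_abs_bound)
    also have "\<dots> \<le> (\<integral>\<omega>. c \<partial>law Q A)"
      using s_int c by (intro integral_mono) (auto simp: s_def)
    finally show ?thesis by (simp add: prob_space)
  qed
  define \<phi>1 where "\<phi>1 = (\<lambda>x. s x - a1)"
  define \<phi>2 where "\<phi>2 = (\<lambda>x. l x - a2)"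
  have \<phi>1[measurable]: "\<phi>1 \<in> borel_measurable (obs_space Q)" and \<phi>2[measurable]: "\<phi>2 \<in> borel_measurable (obs_space Q)"
    unfolding \<phi>1_def \<phi>2_def by measurable
  have \<phi>1_b: "\<bar>\<phi>1 x\<bar> \<le> 2 * c" for x
    using a1_le c by (auto simp: \<phi>1_def s_def)
  have \<phi>1_mean: "(\<integral>\<omega>. \<phi>1 (obs Q i m \<omega>) \<partial>law Q A) = 0" if "1 \<le> m" for m
    using obs_identically_distributed(2)[OF A i that _ \<phi>1, of 1] s_int
    by (simp add: \<phi>1_def a1_def prob_space)
  have abs\<phi>2: "(\<lambda>x. \<bar>\<phi>2 x\<bar>) \<in> borel_measurable (obs_space Q)" by measurable
  have \<phi>2_int1: "integrable (law Q A) (\<lambda>\<omega>. \<bar>\<phi>2 (obs Q i 1 \<omega>)\<bar>)"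
    using l_int by (auto simp: \<phi>2_def)
  have \<phi>2_int: "integrable (law Q A) (\<lambda>\<omega>. \<bar>\<phi>2 (obs Q i (Suc m) \<omega>)\<bar>)" for m
    using obs_identically_distributed(1)[OF A i _ _ abs\<phi>2, of 1 "Suc m"] \<phi>2_int1 by simp
  have \<phi>2_le: "(\<integral>\<omega>. \<bar>\<phi>2 (obs Q i (Suc m) \<omega>)\<bar> \<partial>law Q A) \<le> \<epsilon> / 2" for m
  proof -
    have "(\<integral>\<omega>. \<bar>\<phi>2 (obs Q i (Suc m) \<omega>)\<bar> \<partial>law Q A) = (\<integral>\<omega>. \<bar>\<phi>2 (obs Q i 1 \<omega>)\<bar> \<partial>law Q A)"
      by (rule obs_identically_distributed(2)[OF A i _ _ abs\<phi>2]) auto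
    also have "\<dots> \<le> (\<integral>\<omega>. \<bar>l (obs Q i 1 \<omega>)\<bar> + \<bar>a2\<bar> \<partial>law Q A)"
      using l_int \<phi>2_int1 by (intro integral_mono) (auto simp: \<phi>2_def)
    also have "\<dots> = (\<integral>\<omega>. \<bar>l (obs Q i 1 \<omega>)\<bar> \<partial>law Q A) + \<bar>a2\<bar>"
      using l_int by (simp add: prob_space)
    finally show ?thesis using abs_l a2_le by linarith
  qed
  \<comment> \<open>In \<open>M \<le> \<delta> M\<^sup>2 + 1 / (4 \<delta>)\<close> the maximal inequality contributes \<open>4 (2 c)\<^sup>2 \<delta> = \<epsilon> / 2\<close> per observation.\<close>
  define \<delta> where "\<delta> = \<epsilon> / (8 * (2 * c)\<^sup>2)"
  have \<delta>: "0 < \<delta>" using \<epsilon> c by (simp add: \<delta>_def)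
  show thesis
  proof (rule that[of "1 / (4 * \<delta>)"], unfold deviation_control_def, intro allI impI)
    fix R \<tau> N
    assume R: "sampling_rule Q R" and \<tau>: "stopping R \<tau>"
      and "\<forall>\<omega>\<in>space (outcomes Q). \<tau> \<omega> \<le> N"
    then have N: "\<And>\<omega>. \<omega> \<in> space (outcomes Q) \<Longrightarrow> \<tau> \<omega> \<le> N" by blast
    define h where "h = (\<lambda>m \<omega>. of_bool (i \<in> R m \<omega> \<and> m \<le> \<tau> \<omega>) :: real)"
    define M where "M = (\<lambda>\<omega>. running_max (\<lambda>m. stopped_sum R \<tau> i \<phi>1 m \<omega>) N)"
    define T where "T = (\<lambda>\<omega>. \<Sum>m=1..N. h m \<omega> * \<bar>\<phi>2 (obs Q i m \<omega>)\<bar>)"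
    have \<tau>_int: "integrable (law Q A) (\<lambda>\<omega>. real (\<tau> \<omega>))" by (rule stopping_integrable[OF A R \<tau> N])
    have h_hist: "h (Suc m) \<in> borel_measurable (history Q R m)" for m
      unfolding h_def by (rule selector_measurable[OF R \<tau>])
    have h_int': "integrable (law Q A) (h (Suc m))" for m
      by (intro integrable_const_bound[of _ 1] measurable_law_history[OF A R h_hist] AE_I2) (simp add: h_def)
    have h_int: "integrable (law Q A) (h m)" if "1 \<le> m" for m
      using h_int'[of "m - 1"] that by simp
    have sum_h: "(\<Sum>m=1..N. \<integral>\<omega>. h m \<omega> \<partial>law Q A) \<le> (\<integral>\<omega>. real (\<tau> \<omega>) \<partial>law Q A)"
    proof -
      have "(\<Sum>m=1..N. \<integral>\<omega>. h m \<omega> \<partial>law Q A) = (\<integral>\<omega>. (\<Sum>m=1..N. h m \<omega>) \<partial>law Q A)"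
        using h_int by (intro Bochner_Integration.integral_sum[symmetric]) auto
      also have "\<dots> \<le> (\<integral>\<omega>. real (\<tau> \<omega>) \<partial>law Q A)"
      proof (rule integral_mono[OF _ \<tau>_int])
        show "integrable (law Q A) (\<lambda>\<omega>. \<Sum>m=1..N. h m \<omega>)"
          using h_int by (intro Bochner_Integration.integrable_sum) auto
        fix \<omega>
        have "(\<Sum>m=1..N. h m \<omega>) \<le> (\<Sum>m\<in>{1..\<tau> \<omega>}. 1)"
        proof -
          have "(\<Sum>m=1..N. h m \<omega>) = (\<Sum>m\<in>{1..N} \<inter> {1..\<tau> \<omega>}. h m \<omega>)"
            by (intro sum.mono_neutral_right) (auto simp: h_def)
          also have "\<dots> \<le> (\<Sum>m\<in>{1..N} \<inter> {1..\<tau> \<omega>}. 1)"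
            by (intro sum_mono) (simp add: h_def)
          also have "\<dots> \<le> (\<Sum>m\<in>{1..\<tau> \<omega>}. 1)"
            by (intro sum_mono2) auto
          finally show ?thesis .
        qed
        then show "(\<Sum>m=1..N. h m \<omega>) \<le> real (\<tau> \<omega>)" by simp
      qed
      finally show ?thesis .
    qed
    have M2: "integrable (law Q A) (\<lambda>\<omega>. (M \<omega>)\<^sup>2)"
      "(\<integral>\<omega>. (M \<omega>)\<^sup>2 \<partial>law Q A) \<le> 4 * (2 * c)\<^sup>2 * (\<Sum>m=1..N. \<integral>\<omega>. h m \<omega> \<partial>law Q A)"
      using stopped_sum_maximal[OF A R \<tau> i \<phi>1 \<phi>1_b \<phi>1_mean, of N] by (simp_all add: M_def h_def)
    have M_meas: "M \<in> borel_measurable (law Q A)"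
      unfolding M_def
      by (intro running_max_measurable measurable_law_history[OF A R stopped_sum_measurable[OF R \<tau> i \<phi>1]])
    have M_le: "M \<omega> \<le> \<delta> * (M \<omega>)\<^sup>2 + 1 / (4 * \<delta>)" for \<omega>
    proof -
      have "0 \<le> (2 * \<delta> * M \<omega> - 1)\<^sup>2" by simp
      then have "4 * \<delta> * M \<omega> \<le> 4 * \<delta> * (\<delta> * (M \<omega>)\<^sup>2 + 1 / (4 * \<delta>))"
        using \<delta> by (simp add: power2_eq_square algebra_simps)
      then show ?thesis using \<delta> by simp
    qed
    have M_int: "integrable (law Q A) M"
    proof (rule Bochner_Integration.integrable_bound[OF _ M_meas])
      show "integrable (law Q A) (\<lambda>\<omega>. \<delta> * (M \<omega>)\<^sup>2 + 1 / (4 * \<delta>))" using M2(1) by simp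
      show "AE \<omega> in law Q A. norm (M \<omega>) \<le> norm (\<delta> * (M \<omega>)\<^sup>2 + 1 / (4 * \<delta>))"
      proof (rule AE_I2)
        fix \<omega>
        have "0 \<le> M \<omega>" by (simp add: M_def running_max_nonneg)
        with M_le[of \<omega>] show "norm (M \<omega>) \<le> norm (\<delta> * (M \<omega>)\<^sup>2 + 1 / (4 * \<delta>))" by simp
      qed
    qed
    have E_M: "(\<integral>\<omega>. M \<omega> \<partial>law Q A) \<le> \<epsilon> / 2 * (\<Sum>m=1..N. \<integral>\<omega>. h m \<omega> \<partial>law Q A) + 1 / (4 * \<delta>)"
    proof -
      have "(\<integral>\<omega>. M \<omega> \<partial>law Q A) \<le> (\<integral>\<omega>. \<delta> * (M \<omega>)\<^sup>2 + 1 / (4 * \<delta>) \<partial>law Q A)"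
        using M_int M2(1) M_le by (intro integral_mono) auto
      also have "\<dots> = \<delta> * (\<integral>\<omega>. (M \<omega>)\<^sup>2 \<partial>law Q A) + 1 / (4 * \<delta>)"
        using M2(1) by (simp add: prob_space)
      also have "\<dots> \<le> \<delta> * (4 * (2 * c)\<^sup>2 * (\<Sum>m=1..N. \<integral>\<omega>. h m \<omega> \<partial>law Q A)) + 1 / (4 * \<delta>)"
        using M2(2) \<delta> by simp
      also have "\<delta> * (4 * (2 * c)\<^sup>2 * (\<Sum>m=1..N. \<integral>\<omega>. h m \<omega> \<partial>law Q A))
          = \<epsilon> / 2 * (\<Sum>m=1..N. \<integral>\<omega>. h m \<omega> \<partial>law Q A)"
        using c by (simp add: \<delta>_def)
      finally show ?thesis .
    qed
    have T_term: "integrable (law Q A) (\<lambda>\<omega>. h m \<omega> * \<bar>\<phi>2 (obs Q i m \<omega>)\<bar>)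
        \<and> (\<integral>\<omega>. h m \<omega> * \<bar>\<phi>2 (obs Q i m \<omega>)\<bar> \<partial>law Q A) \<le> \<epsilon> / 2 * (\<integral>\<omega>. h m \<omega> \<partial>law Q A)"
      if "1 \<le> m" for m
    proof -
      from that obtain k where m: "m = Suc k" by (cases m) auto
      have h0: "0 \<le> (\<integral>\<omega>. h (Suc k) \<omega> \<partial>law Q A)" by (simp add: h_def)
      show ?thesis
        unfolding m using integral_predictable[OF A R i h_hist h_int' abs\<phi>2 \<phi>2_int, of k]
          mult_left_mono[OF \<phi>2_le h0, of k] by (simp add: mult.commute)
    qed
    have T_int: "integrable (law Q A) T"
      unfolding T_def using T_term by (intro Bochner_Integration.integrable_sum) auto
    have E_T: "(\<integral>\<omega>. T \<omega> \<partial>law Q A) \<le> \<epsilon> / 2 * (\<Sum>m=1..N. \<integral>\<omega>. h m \<omega> \<partial>law Q A)"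
    proof -
      have "(\<integral>\<omega>. T \<omega> \<partial>law Q A) = (\<Sum>m=1..N. \<integral>\<omega>. h m \<omega> * \<bar>\<phi>2 (obs Q i m \<omega>)\<bar> \<partial>law Q A)"
        unfolding T_def using T_term by (intro Bochner_Integration.integral_sum) auto
      also have "\<dots> \<le> (\<Sum>m=1..N. \<epsilon> / 2 * (\<integral>\<omega>. h m \<omega> \<partial>law Q A))"
        using T_term by (intro sum_mono) auto
      finally show ?thesis by (simp only: sum_distrib_left)
    qed
    show "\<exists>X. integrable (law Q A) X \<and> (\<integral>\<omega>. X \<omega> \<partial>law Q A) \<le> \<epsilon> * (\<integral>\<omega>. real (\<tau> \<omega>) \<partial>law Q A) + 1 / (4 * \<delta>) \<and>
        (\<forall>\<omega>\<in>space (outcomes Q). \<forall>n\<le>\<tau> \<omega>.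
          (\<Sum>i\<in>{i}. \<bar>walk Q A R i n \<omega> - strength Q A i * sample_count R i n \<omega>\<bar>) \<le> X \<omega>)"
    proof (intro exI[of _ "\<lambda>\<omega>. M \<omega> + T \<omega>"] conjI ballI allI impI)
      show "integrable (law Q A) (\<lambda>\<omega>. M \<omega> + T \<omega>)" using M_int T_int by simp
      show "(\<integral>\<omega>. M \<omega> + T \<omega> \<partial>law Q A) \<le> \<epsilon> * (\<integral>\<omega>. real (\<tau> \<omega>) \<partial>law Q A) + 1 / (4 * \<delta>)"
      proof -
        have "\<epsilon> * (\<Sum>m=1..N. \<integral>\<omega>. h m \<omega> \<partial>law Q A) \<le> \<epsilon> * (\<integral>\<omega>. real (\<tau> \<omega>) \<partial>law Q A)"
          using mult_left_mono[OF sum_h] \<epsilon> by simp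
        then have "(\<integral>\<omega>. M \<omega> \<partial>law Q A) + (\<integral>\<omega>. T \<omega> \<partial>law Q A)
            \<le> \<epsilon> * (\<integral>\<omega>. real (\<tau> \<omega>) \<partial>law Q A) + 1 / (4 * \<delta>)"
          using E_M E_T by linarith
        then show ?thesis
          using Bochner_Integration.integral_add[OF M_int T_int] by simp
      qed
      fix \<omega> n assume \<omega>: "\<omega> \<in> space (outcomes Q)" and n: "n \<le> \<tau> \<omega>"
      have nN: "n \<le> N" using n N[OF \<omega>] by simp
      have "walk Q A R i n \<omega> - strength Q A i * sample_count R i n \<omega>
          = (\<Sum>m=1..n. h m \<omega> * (\<phi>1 (obs Q i m \<omega>) + \<phi>2 (obs Q i m \<omega>)))"
        unfolding walk_def sample_count_def sum_distrib_left sum_subtractf[symmetric]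
      proof (rule sum.cong[OF refl])
        fix m assume "m \<in> {1..n}"
        then have "m \<le> \<tau> \<omega>" using n by simp
        then show "gain Q A i (obs Q i m \<omega>) * of_bool (i \<in> R m \<omega>) - strength Q A i * of_bool (i \<in> R m \<omega>)
            = h m \<omega> * (\<phi>1 (obs Q i m \<omega>) + \<phi>2 (obs Q i m \<omega>))"
          using sl[of "obs Q i m \<omega>"] a12 by (simp add: h_def \<phi>1_def \<phi>2_def g_def)
      qed
      also have "\<dots> = stopped_sum R \<tau> i \<phi>1 n \<omega> + (\<Sum>m=1..n. h m \<omega> * \<phi>2 (obs Q i m \<omega>))"
        by (simp add: stopped_sum_def h_def distrib_left sum.distrib)
      finally have eq: "walk Q A R i n \<omega> - strength Q A i * sample_count R i n \<omega>
          = stopped_sum R \<tau> i \<phi>1 n \<omega> + (\<Sum>m=1..n. h m \<omega> * \<phi>2 (obs Q i m \<omega>))" .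
      have "\<bar>stopped_sum R \<tau> i \<phi>1 n \<omega>\<bar> \<le> M \<omega>"
        unfolding M_def by (rule running_max_ge[OF nN])
      moreover have "\<bar>\<Sum>m=1..n. h m \<omega> * \<phi>2 (obs Q i m \<omega>)\<bar> \<le> T \<omega>"
      proof -
        have "\<bar>\<Sum>m=1..n. h m \<omega> * \<phi>2 (obs Q i m \<omega>)\<bar> \<le> (\<Sum>m=1..n. h m \<omega> * \<bar>\<phi>2 (obs Q i m \<omega>)\<bar>)"
          by (rule order_trans[OF sum_abs]) (auto simp: abs_mult h_def intro!: sum_mono)
        also have "\<dots> \<le> T \<omega>"
          unfolding T_def using nN by (intro sum_mono2) (auto simp: h_def)
        finally show ?thesis .
      qed
      ultimately show "(\<Sum>i\<in>{i}. \<bar>walk Q A R i n \<omega> - strength Q A i * sample_count R i n \<omega>\<bar>) \<le> M \<omega> + T \<omega>"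
        using eq by simp
    qed
  qed
qed

lemma deviation_control_sources:
  assumes A: "A \<subseteq> sources Q" and \<epsilon>: "0 < \<epsilon>"
  obtains C where "deviation_control A (sources Q) \<epsilon> C"
proof -
  let ?M = "num_sources Q"
  have M: "0 < real ?M" using num_sources_pos by simp
  have "\<exists>C. deviation_control A {i} (\<epsilon> / ?M) C" if "i \<in> sources Q" for i
    using maximal_deviation[OF A that, of "\<epsilon> / ?M"] \<epsilon> M by auto
  then obtain C where C: "\<And>i. i \<in> sources Q \<Longrightarrow> deviation_control A {i} (\<epsilon> / ?M) (C i)" by metis
  show thesis
  proof (rule that[of "\<Sum>i\<in>sources Q. C i"], unfold deviation_control_def, intro allI impI)
    fix R \<tau> N
    assume R: "sampling_rule Q R" and \<tau>: "stopping R \<tau>" and N: "\<forall>\<omega>\<in>space (outcomes Q). \<tau> \<omega> \<le> N"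
    define good where "good = (\<lambda>i X. integrable (law Q A) X
        \<and> (\<integral>\<omega>. X \<omega> \<partial>law Q A) \<le> \<epsilon> / ?M * (\<integral>\<omega>. real (\<tau> \<omega>) \<partial>law Q A) + C i
        \<and> (\<forall>\<omega>\<in>space (outcomes Q). \<forall>n\<le>\<tau> \<omega>.
          (\<Sum>i\<in>{i}. \<bar>walk Q A R i n \<omega> - strength Q A i * sample_count R i n \<omega>\<bar>) \<le> X \<omega>))"
    have "\<forall>i\<in>sources Q. \<exists>X. good i X"
      unfolding good_def
      by (rule ballI, rule C[unfolded deviation_control_def, rule_format, OF _ R \<tau> bspec[OF N]])
    from bchoice[OF this] obtain X where good: "\<forall>i\<in>sources Q. good i (X i)" ..
    have X: "\<And>i. i \<in> sources Q \<Longrightarrow> integrable (law Q A) (X i)"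
      "\<And>i. i \<in> sources Q \<Longrightarrow> (\<integral>\<omega>. X i \<omega> \<partial>law Q A) \<le> \<epsilon> / ?M * (\<integral>\<omega>. real (\<tau> \<omega>) \<partial>law Q A) + C i"
      "\<And>i \<omega> n. i \<in> sources Q \<Longrightarrow> \<omega> \<in> space (outcomes Q) \<Longrightarrow> n \<le> \<tau> \<omega> \<Longrightarrow>
          \<bar>walk Q A R i n \<omega> - strength Q A i * sample_count R i n \<omega>\<bar> \<le> X i \<omega>"
      using good unfolding good_def by simp_all
    show "\<exists>X. integrable (law Q A) X \<and> (\<integral>\<omega>. X \<omega> \<partial>law Q A) \<le> \<epsilon> * (\<integral>\<omega>. real (\<tau> \<omega>) \<partial>law Q A) + (\<Sum>i\<in>sources Q. C i) \<and>
        (\<forall>\<omega>\<in>space (outcomes Q). \<forall>n\<le>\<tau> \<omega>.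
          (\<Sum>i\<in>sources Q. \<bar>walk Q A R i n \<omega> - strength Q A i * sample_count R i n \<omega>\<bar>) \<le> X \<omega>)"
    proof (intro exI[of _ "\<lambda>\<omega>. \<Sum>i\<in>sources Q. X i \<omega>"] conjI ballI allI impI)
      show "integrable (law Q A) (\<lambda>\<omega>. \<Sum>i\<in>sources Q. X i \<omega>)"
        using X(1) by (intro Bochner_Integration.integrable_sum)
      have "(\<integral>\<omega>. (\<Sum>i\<in>sources Q. X i \<omega>) \<partial>law Q A) = (\<Sum>i\<in>sources Q. \<integral>\<omega>. X i \<omega> \<partial>law Q A)"
        using X(1) by (intro Bochner_Integration.integral_sum)
      also have "\<dots> \<le> (\<Sum>i\<in>sources Q. \<epsilon> / ?M * (\<integral>\<omega>. real (\<tau> \<omega>) \<partial>law Q A) + C i)"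
        by (intro sum_mono X(2))
      also have "\<dots> = \<epsilon> * (\<integral>\<omega>. real (\<tau> \<omega>) \<partial>law Q A) + (\<Sum>i\<in>sources Q. C i)"
        using M by (simp add: sum.distrib)
      finally show "(\<integral>\<omega>. (\<Sum>i\<in>sources Q. X i \<omega>) \<partial>law Q A) \<le> \<epsilon> * (\<integral>\<omega>. real (\<tau> \<omega>) \<partial>law Q A) + (\<Sum>i\<in>sources Q. C i)" .
      fix \<omega> n assume "\<omega> \<in> space (outcomes Q)" "n \<le> \<tau> \<omega>"
      then show "(\<Sum>i\<in>sources Q. \<bar>walk Q A R i n \<omega> - strength Q A i * sample_count R i n \<omega>\<bar>) \<le> (\<Sum>i\<in>sources Q. X i \<omega>)"
        using X(3) by (intro sum_mono) auto
    qed
  qed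
qed

end

section \<open>The sum-intersection rule as a policy, and its error probabilities\<close>

text \<open>
  The stopping condition without sorting: the sum of the \<open>k\<close> smallest statistics reaches \<open>d\<close> iff all
  sums of \<open>k\<close> statistics do.
\<close>

definition crossing :: "('s, 'w) anomaly_setup \<Rightarrow> nat \<Rightarrow> real \<Rightarrow> 'w rule \<Rightarrow> nat \<Rightarrow> 'w \<Rightarrow> bool" where
  "crossing Q k d R n \<omega> \<longleftrightarrow>
     (\<forall>U. U \<subseteq> sources Q \<and> card U = k \<longrightarrow> d \<le> (\<Sum>i\<in>U. \<bar>cum_llr Q R i n \<omega>\<bar>))"

lemma ordered_sum_ge_iff:
  assumes k: "1 \<le> k" "k \<le> num_sources Q"
  shows "d \<le> (\<Sum>i=1..k. ordered_abs_llr Q R i n \<omega>) \<longleftrightarrow> crossing Q k d R n \<omega>"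
proof
  assume "d \<le> (\<Sum>i=1..k. ordered_abs_llr Q R i n \<omega>)"
  then show "crossing Q k d R n \<omega>"
    using smallest_sum_le[OF k, of _ "\<lambda>j. \<bar>cum_llr Q R j n \<omega>\<bar>"]
    unfolding crossing_def ordered_abs_llr_def by (blast intro: order_trans)
next
  assume *: "crossing Q k d R n \<omega>"
  obtain U t where "U \<subseteq> {1..num_sources Q}" "card U = k"
    "(\<Sum>i=1..k. ordered_abs_llr Q R i n \<omega>) = (\<Sum>i\<in>U. \<bar>cum_llr Q R i n \<omega>\<bar>)"
    unfolding ordered_abs_llr_def by (rule smallest_sum_exists[OF k, of "\<lambda>j. \<bar>cum_llr Q R j n \<omega>\<bar>"])
  then show "d \<le> (\<Sum>i=1..k. ordered_abs_llr Q R i n \<omega>)"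
    using * by (simp add: crossing_def)
qed

lemma T_si_eq:
  assumes k: "1 \<le> k" "k \<le> num_sources Q"
  shows "T_si Q k d R \<omega> = Inf (enat ` {n. 1 \<le> n \<and> crossing Q k d R n \<omega>})"
  unfolding T_si_def ordered_sum_ge_iff[OF k] ..

lemma T_si_enatD:
  assumes k: "1 \<le> k" "k \<le> num_sources Q" and T: "T_si Q k d R \<omega> = enat n"
  shows "1 \<le> n \<and> crossing Q k d R n \<omega>"
proof -
  let ?S = "enat ` {n. 1 \<le> n \<and> crossing Q k d R n \<omega>}"
  have T': "Inf ?S = enat n" using T by (simp add: T_si_eq[OF k])
  have "?S \<noteq> {}"
  proof
    assume "?S = {}"
    with T' have "Inf {} = enat n" by (simp only:)
    then show False by (simp add: Inf_enat_def)
  qed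
  then have "Inf ?S \<in> ?S" by (auto simp: Inf_enat_def intro: LeastI)
  then show ?thesis using T' by auto
qed

lemma T_si_le_iff:
  assumes k: "1 \<le> k" "k \<le> num_sources Q"
  shows "T_si Q k d R \<omega> \<le> enat n \<longleftrightarrow> (\<exists>m\<in>{1..n}. crossing Q k d R m \<omega>)"
proof
  assume le: "T_si Q k d R \<omega> \<le> enat n"
  then obtain m where m: "T_si Q k d R \<omega> = enat m" "m \<le> n" by (cases "T_si Q k d R \<omega>") auto
  then show "\<exists>m\<in>{1..n}. crossing Q k d R m \<omega>" using T_si_enatD[OF k m(1)] by (intro bexI[of _ m]) auto
next
  assume "\<exists>m\<in>{1..n}. crossing Q k d R m \<omega>"
  then obtain m where "m \<in> {1..n}" "crossing Q k d R m \<omega>" by blast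
  then have "T_si Q k d R \<omega> \<le> enat m" unfolding T_si_eq[OF k] by (intro Inf_lower) auto
  also have "\<dots> \<le> enat n" using \<open>m \<in> {1..n}\<close> by simp
  finally show "T_si Q k d R \<omega> \<le> enat n" .
qed

lemma policy_sampling_rule: "(R, T, D) \<in> policies Q \<Longrightarrow> sampling_rule Q R"
  by (simp add: policies_def)

lemma policy_time_sets:
  assumes "(R, T, D) \<in> policies Q"
  shows "{\<omega> \<in> space (outcomes Q). T \<omega> \<le> enat n} \<in> sets (history Q R n)"
proof -
  have "Measurable.pred (info_filtration Q R (enat n)) (\<lambda>\<omega>. T \<omega> \<le> enat n)"
    using assms by (auto simp: policies_def stopping_time_def)
  then show ?thesis by (simp add: info_filtration_def pred_def space_history)
qed

lemma policy_decision_subset: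
  assumes "(R, T, D) \<in> policies Q" "\<omega> \<in> space (outcomes Q)"
  shows "D \<omega> \<subseteq> sources Q"
proof -
  interpret F: filtration "space (outcomes Q)" "info_filtration Q R"
    by (rule filtration_info_filtration)
  have "D \<in> F.pre_sigma T \<rightarrow>\<^sub>M count_space (Pow (sources Q))"
    using assms by (simp add: policies_def)
  from measurable_space[OF this, of \<omega>] show ?thesis
    using assms(2) by (simp add: F.space_pre_sigma)
qed

lemma policy_decision_pre_sigma:
  assumes p: "(R, T, D) \<in> policies Q"
  shows "{\<omega> \<in> space (outcomes Q). P (D \<omega>) \<and> T \<omega> \<le> t} \<in> sets (info_filtration Q R t)"
proof -
  interpret F: filtration "space (outcomes Q)" "info_filtration Q R"
    by (rule filtration_info_filtration)
  have T: "stopping_time (info_filtration Q R) T"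
    and D: "D \<in> F.pre_sigma T \<rightarrow>\<^sub>M count_space (Pow (sources Q))"
    using p by (auto simp: policies_def)
  have "D -` {S \<in> Pow (sources Q). P S} \<inter> space (F.pre_sigma T) \<in> sets (F.pre_sigma T)"
    by (rule measurable_sets[OF D]) auto
  also have "D -` {S \<in> Pow (sources Q). P S} \<inter> space (F.pre_sigma T) = {\<omega> \<in> space (outcomes Q). P (D \<omega>)}"
    using policy_decision_subset[OF p] by (auto simp: F.space_pre_sigma)
  finally have "{\<omega> \<in> {\<omega> \<in> space (outcomes Q). P (D \<omega>)}. T \<omega> \<le> t} \<in> sets (info_filtration Q R t)"
    by (rule F.sets_pre_sigmaD[OF T])
  also have "{\<omega> \<in> {\<omega> \<in> space (outcomes Q). P (D \<omega>)}. T \<omega> \<le> t} = {\<omega> \<in> space (outcomes Q). P (D \<omega>) \<and> T \<omega> \<le> t}"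
    by auto
  finally show ?thesis .
qed

lemma policy_event_sets:
  assumes p: "(R, T, D) \<in> policies Q"
  shows "{\<omega> \<in> space (outcomes Q). T \<omega> = enat n \<and> P (D \<omega>)} \<in> sets (history Q R n)"
proof -
  have 1: "{\<omega> \<in> space (outcomes Q). P (D \<omega>) \<and> T \<omega> \<le> enat n} \<in> sets (history Q R n)"
    using policy_decision_pre_sigma[OF p, of P "enat n"] by (simp add: info_filtration_def)
  have "{\<omega> \<in> space (outcomes Q). T \<omega> \<le> enat m} \<in> sets (history Q R n)" if "m < n" for m
    using policy_time_sets[OF p, of m] sets_history_mono[of m n] that by auto
  then have "{\<omega> \<in> space (outcomes Q). P (D \<omega>) \<and> T \<omega> \<le> enat n}
      - (\<Union>m\<in>{..<n}. {\<omega> \<in> space (outcomes Q). T \<omega> \<le> enat m}) \<in> sets (history Q R n)"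
    using 1 by (intro sets.Diff sets.finite_UN) auto
  also have "{\<omega> \<in> space (outcomes Q). P (D \<omega>) \<and> T \<omega> \<le> enat n}
      - (\<Union>m\<in>{..<n}. {\<omega> \<in> space (outcomes Q). T \<omega> \<le> enat m})
      = {\<omega> \<in> space (outcomes Q). T \<omega> = enat n \<and> P (D \<omega>)}"
  proof (intro equalityI subsetI)
    fix \<omega> assume "\<omega> \<in> {\<omega> \<in> space (outcomes Q). P (D \<omega>) \<and> T \<omega> \<le> enat n}
      - (\<Union>m\<in>{..<n}. {\<omega> \<in> space (outcomes Q). T \<omega> \<le> enat m})"
    then show "\<omega> \<in> {\<omega> \<in> space (outcomes Q). T \<omega> = enat n \<and> P (D \<omega>)}"
      by (cases "T \<omega>") (auto simp: not_less dest!: spec[of _ n] intro: le_antisym)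
  qed auto
  finally show ?thesis .
qed

context anomaly_model
begin

text \<open>
  On \<open>{T = \<infinity>}\<close> the decision may depend on all histories, and their limit still consists of events.
\<close>

lemma policy_decision_sets:
  assumes p: "(R, T, D) \<in> policies Q"
  shows "{\<omega> \<in> space (outcomes Q). P (D \<omega>)} \<in> sets (outcomes Q)"
proof -
  have hist: "(\<Union>n. sets (history Q R n)) \<subseteq> sets (outcomes Q)"
    using sets_history_subset[OF policy_sampling_rule[OF p]] by blast
  have "sets (info_filtration Q R \<infinity>) = sigma_sets (space (outcomes Q)) (\<Union>n. sets (history Q R n))"
    unfolding info_filtration_def enat.case
    by (rule sets_measure_of) (use hist sets.space_closed in blast)
  also have "\<dots> \<subseteq> sets (outcomes Q)" by (rule sets.sigma_sets_subset[OF hist])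
  finally show ?thesis using policy_decision_pre_sigma[OF p, of P \<infinity>] by auto
qed

text \<open>
  With \<open>G n\<close> contained in \<open>{T = n}\<close>, the inequalities for the single times add up to one for a stopping
  time with arbitrary finite values.
\<close>

lemma lr_stopped:
  assumes A: "A \<subseteq> sources Q" and B: "B \<subseteq> sources Q" and R: "sampling_rule Q R"
    and G: "\<And>n. G n \<in> sets (history Q R n)" and disj: "disjoint_family G"
    and le: "\<And>n \<omega>. \<omega> \<in> G n \<Longrightarrow> log_lr Q A B R n \<omega> \<le> x"
  shows "measure (law Q A) (\<Union>n. G n) \<le> exp x * measure (law Q B) (\<Union>n. G n)"
proof -
  interpret PA: prob_space "law Q A" by (rule prob_law[OF A])
  interpret PB: prob_space "law Q B" by (rule prob_law[OF B])
  have G': "G n \<in> sets (outcomes Q)" for n using G sets_history_subset[OF R] by blast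
  have step: "emeasure (law Q A) (G n) \<le> ennreal (exp x) * emeasure (law Q B) (G n)" for n
  proof -
    have m: "log_lr Q A B R n \<in> borel_measurable (law Q A)"
      by (rule measurable_law_history[OF A R log_lr_measurable[OF R A B]])
    have "emeasure (law Q A) (G n) = (\<integral>\<^sup>+\<omega>. indicator (G n) \<omega> \<partial>law Q A)"
      using G'[of n] by (subst nn_integral_indicator) (auto simp: sets_law[OF A])
    also have "\<dots> \<le> (\<integral>\<^sup>+\<omega>. ennreal (exp x) * (ennreal (exp (- log_lr Q A B R n \<omega>)) * indicator (G n) \<omega>) \<partial>law Q A)"
    proof (rule nn_integral_mono)
      fix \<omega>
      show "indicator (G n) \<omega> \<le> ennreal (exp x) * (ennreal (exp (- log_lr Q A B R n \<omega>)) * indicator (G n) \<omega>)"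
      proof (cases "\<omega> \<in> G n")
        case True
        then have "1 \<le> exp x * exp (- log_lr Q A B R n \<omega>)"
          using le[OF True] by (simp add: exp_add[symmetric])
        then have "1 \<le> ennreal (exp x * exp (- log_lr Q A B R n \<omega>))"
          by (metis ennreal_1 ennreal_leI)
        with True show ?thesis by (simp add: ennreal_mult)
      qed simp
    qed
    also have "\<dots> = ennreal (exp x) * (\<integral>\<^sup>+\<omega>. ennreal (exp (- log_lr Q A B R n \<omega>)) * indicator (G n) \<omega> \<partial>law Q A)"
    proof (rule nn_integral_cmult)
      have [measurable]: "G n \<in> PA.events" using G'[of n] by (simp add: sets_law[OF A])
      show "(\<lambda>\<omega>. ennreal (exp (- log_lr Q A B R n \<omega>)) * indicator (G n) \<omega>) \<in> borel_measurable (law Q A)"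
        using m by measurable
    qed
    also have "\<dots> = ennreal (exp x) * emeasure (law Q B) (G n)"
      by (simp only: lr_history[OF A B R G])
    finally show ?thesis .
  qed
  have "emeasure (law Q A) (\<Union>n. G n) = (\<Sum>n. emeasure (law Q A) (G n))"
    using G' disj by (intro suminf_emeasure[symmetric]) (auto simp: sets_law[OF A])
  also have "\<dots> \<le> (\<Sum>n. ennreal (exp x) * emeasure (law Q B) (G n))"
    by (intro suminf_le step) auto
  also have "\<dots> = ennreal (exp x) * emeasure (law Q B) (\<Union>n. G n)"
    using G' disj by (subst suminf_emeasure[symmetric]) (auto simp: sets_law[OF B] ennreal_suminf_cmult)
  finally show ?thesis
    by (simp add: PA.emeasure_eq_measure PB.emeasure_eq_measure ennreal_mult'[symmetric])
qed

lemma cum_llr_history: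
  "sampling_rule Q R \<Longrightarrow> i \<in> sources Q \<Longrightarrow> cum_llr Q R i n \<in> borel_measurable (history Q R n)"
  unfolding cum_llr_def[abs_def] by (intro sampled_sum_measurable llr_measurable)

lemma crossing_sets:
  assumes R: "sampling_rule Q R"
  shows "{\<omega> \<in> space (outcomes Q). crossing Q k d R n \<omega>} \<in> sets (history Q R n)"
proof -
  let ?\<U> = "{U. U \<subseteq> sources Q \<and> card U = k}"
  have fin: "finite ?\<U>" by (rule finite_subset[of _ "Pow (sources Q)"]) auto
  have "(\<lambda>\<omega>. \<Sum>i\<in>U. \<bar>cum_llr Q R i n \<omega>\<bar>) \<in> borel_measurable (history Q R n)" if "U \<in> ?\<U>" for U
    using that by (intro borel_measurable_sum borel_measurable_abs cum_llr_history[OF R]) auto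
  then have "{\<omega> \<in> space (history Q R n). d \<le> (\<Sum>i\<in>U. \<bar>cum_llr Q R i n \<omega>\<bar>)} \<in> sets (history Q R n)" if "U \<in> ?\<U>" for U
    using that by (intro borel_measurable_le) auto
  then have "{\<omega> \<in> space (history Q R n). \<forall>U\<in>?\<U>. d \<le> (\<Sum>i\<in>U. \<bar>cum_llr Q R i n \<omega>\<bar>)} \<in> sets (history Q R n)"
    using fin by (intro sets.sets_Collect_finite_All)
  then show ?thesis by (simp add: crossing_def space_history)
qed

lemma T_si_le_sets:
  assumes R: "sampling_rule Q R" and k: "1 \<le> k" "k \<le> num_sources Q"
  shows "{\<omega> \<in> space (outcomes Q). T_si Q k d R \<omega> \<le> enat n} \<in> sets (history Q R n)"
proof -
  have "{\<omega> \<in> space (outcomes Q). T_si Q k d R \<omega> \<le> enat n}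
      = (\<Union>m\<in>{1..n}. {\<omega> \<in> space (outcomes Q). crossing Q k d R m \<omega>})"
    by (auto simp: T_si_le_iff[OF k])
  moreover have "{\<omega> \<in> space (outcomes Q). crossing Q k d R m \<omega>} \<in> sets (history Q R n)" if "m \<in> {1..n}" for m
    using crossing_sets[OF R, of k d m] sets_history_mono[of m n] that by auto
  ultimately show ?thesis by auto
qed

lemma T_si_D_si_sets:
  assumes R: "sampling_rule Q R" and k: "1 \<le> k" "k \<le> num_sources Q"
  shows "{\<omega> \<in> space (outcomes Q). T_si Q k d R \<omega> = enat n \<and> P (D_si Q k d R \<omega>)} \<in> sets (history Q R n)"
proof -
  have le: "{\<omega> \<in> space (outcomes Q). T_si Q k d R \<omega> \<le> enat m} \<in> sets (history Q R n)" if "m \<le> n" for m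
    using T_si_le_sets[OF R k, of d m] sets_history_mono[of m n] that by auto
  have sgn: "{\<omega> \<in> space (history Q R n). P {i \<in> sources Q. 0 < cum_llr Q R i n \<omega>}} \<in> sets (history Q R n)"
  proof -
    have pos: "{\<omega> \<in> space (history Q R n). 0 < cum_llr Q R i n \<omega>} \<in> sets (history Q R n)" if "i \<in> sources Q" for i
      using cum_llr_history[OF R that, of n] by (intro borel_measurable_less) auto
    have "{\<omega> \<in> space (history Q R n). {i \<in> sources Q. 0 < cum_llr Q R i n \<omega>} = S} \<in> sets (history Q R n)"
      if S: "S \<subseteq> sources Q" for S
    proof -
      have "{\<omega> \<in> space (history Q R n). {i \<in> sources Q. 0 < cum_llr Q R i n \<omega>} = S}
          = {\<omega> \<in> space (history Q R n). \<forall>i\<in>sources Q. 0 < cum_llr Q R i n \<omega> \<longleftrightarrow> i \<in> S}"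
        using S by auto
      also have "\<dots> \<in> sets (history Q R n)"
      proof (rule sets.sets_Collect_finite_All)
        fix i assume i: "i \<in> sources Q"
        show "{\<omega> \<in> space (history Q R n). (0 < cum_llr Q R i n \<omega>) = (i \<in> S)} \<in> sets (history Q R n)"
          using pos[OF i] sets.sets_Collect_neg[OF pos[OF i]] by (cases "i \<in> S") auto
      qed simp
      finally show ?thesis .
    qed
    then have "(\<Union>S\<in>{S. S \<subseteq> sources Q \<and> P S}.
        {\<omega> \<in> space (history Q R n). {i \<in> sources Q. 0 < cum_llr Q R i n \<omega>} = S}) \<in> sets (history Q R n)"
      by (intro sets.finite_UN finite_subset[of "{S. S \<subseteq> sources Q \<and> P S}" "Pow (sources Q)"]) auto
    also have "(\<Union>S\<in>{S. S \<subseteq> sources Q \<and> P S}.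
        {\<omega> \<in> space (history Q R n). {i \<in> sources Q. 0 < cum_llr Q R i n \<omega>} = S})
        = {\<omega> \<in> space (history Q R n). P {i \<in> sources Q. 0 < cum_llr Q R i n \<omega>}}" by auto
    finally show ?thesis .
  qed
  have eq: "T_si Q k d R \<omega> = enat n \<longleftrightarrow> T_si Q k d R \<omega> \<le> enat n \<and> (\<forall>m<n. \<not> T_si Q k d R \<omega> \<le> enat m)" for \<omega>
    by (cases "T_si Q k d R \<omega>") (auto simp: not_le intro: le_antisym leI)
  have "{\<omega> \<in> space (outcomes Q). T_si Q k d R \<omega> = enat n \<and> P (D_si Q k d R \<omega>)}
      = ({\<omega> \<in> space (outcomes Q). T_si Q k d R \<omega> \<le> enat n}
          - (\<Union>m\<in>{..<n}. {\<omega> \<in> space (outcomes Q). T_si Q k d R \<omega> \<le> enat m}))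
        \<inter> {\<omega> \<in> space (history Q R n). P {i \<in> sources Q. 0 < cum_llr Q R i n \<omega>}}"
    (is "?l = ?r")
  proof (rule set_eqI)
    fix \<omega>
    have "\<omega> \<in> ?r \<longleftrightarrow> \<omega> \<in> space (outcomes Q) \<and> T_si Q k d R \<omega> = enat n
        \<and> P {i \<in> sources Q. 0 < cum_llr Q R i n \<omega>}"
      unfolding eq[of \<omega>] by (auto simp: space_history)
    also have "\<dots> \<longleftrightarrow> \<omega> \<in> ?l"
      by (cases "T_si Q k d R \<omega> = enat n") (simp_all add: D_si_def)
    finally show "\<omega> \<in> ?l \<longleftrightarrow> \<omega> \<in> ?r" ..
  qed
  also have "\<dots> \<in> sets (history Q R n)"
    using le sgn by (intro sets.Int sets.Diff sets.finite_UN) auto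
  finally show ?thesis .
qed

lemma T_si_policy:
  assumes R: "sampling_rule Q R" and k: "1 \<le> k" "k \<le> num_sources Q"
  shows "(R, T_si Q k d R, D_si Q k d R) \<in> policies Q"
proof -
  interpret F: filtration "space (outcomes Q)" "info_filtration Q R"
    by (rule filtration_info_filtration)
  let ?T = "T_si Q k d R" and ?D = "D_si Q k d R"
  have T: "stopping_time (info_filtration Q R) ?T"
    unfolding stopping_time_def
  proof
    fix t
    show "Measurable.pred (info_filtration Q R t) (\<lambda>\<omega>. ?T \<omega> \<le> t)"
    proof (cases t)
      case (enat n)
      then show ?thesis
        using T_si_le_sets[OF R k, of d n] by (simp add: info_filtration_def pred_def space_history)
    qed simp
  qed
  have fin: "{\<omega> \<in> space (outcomes Q). ?D \<omega> = S \<and> ?T \<omega> \<le> enat n} \<in> sets (history Q R n)" for S n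
  proof -
    have "{\<omega> \<in> space (outcomes Q). ?T \<omega> = enat m \<and> ?D \<omega> = S} \<in> sets (history Q R n)" if "m \<le> n" for m
      using T_si_D_si_sets[OF R k, of d m "\<lambda>x. x = S"] sets_history_mono[OF that, of Q R] by blast
    then have "(\<Union>m\<in>{..n}. {\<omega> \<in> space (outcomes Q). ?T \<omega> = enat m \<and> ?D \<omega> = S}) \<in> sets (history Q R n)"
      by (intro sets.finite_UN) auto
    also have "(\<Union>m\<in>{..n}. {\<omega> \<in> space (outcomes Q). ?T \<omega> = enat m \<and> ?D \<omega> = S})
        = {\<omega> \<in> space (outcomes Q). ?D \<omega> = S \<and> ?T \<omega> \<le> enat n}"
    proof (intro equalityI subsetI)
      fix \<omega> assume "\<omega> \<in> {\<omega> \<in> space (outcomes Q). ?D \<omega> = S \<and> ?T \<omega> \<le> enat n}"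
      then show "\<omega> \<in> (\<Union>m\<in>{..n}. {\<omega> \<in> space (outcomes Q). ?T \<omega> = enat m \<and> ?D \<omega> = S})"
        by (cases "?T \<omega>") auto
    qed auto
    finally show ?thesis .
  qed
  have D: "?D \<in> F.pre_sigma ?T \<rightarrow>\<^sub>M count_space (Pow (sources Q))"
  proof (subst measurable_count_space_eq2, simp, intro conjI ballI funcsetI)
    show "?D \<omega> \<in> Pow (sources Q)" for \<omega> by (auto simp: D_si_def split: enat.split)
    fix S
    show "?D -` {S} \<inter> space (F.pre_sigma ?T) \<in> sets (F.pre_sigma ?T)"
    proof (rule F.sets_pre_sigmaI[OF T])
      fix t
      have eq: "{\<omega> \<in> ?D -` {S} \<inter> space (F.pre_sigma ?T). ?T \<omega> \<le> t} = {\<omega> \<in> space (outcomes Q). ?D \<omega> = S \<and> ?T \<omega> \<le> t}"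
        by (auto simp: F.space_pre_sigma)
      show "{\<omega> \<in> ?D -` {S} \<inter> space (F.pre_sigma ?T). ?T \<omega> \<le> t} \<in> sets (info_filtration Q R t)"
      proof (cases t)
        case (enat n)
        then show ?thesis using fin[of S n] unfolding eq by (simp add: info_filtration_def)
      next
        case infinity
        let ?F = "info_filtration Q R \<infinity>"
        have up: "sets (history Q R n) \<subseteq> sets ?F" for n
          using F.sets_F_mono[of "enat n" \<infinity>] by (simp add: info_filtration_def)
        have top: "space (outcomes Q) \<in> sets ?F"
          using sets.top[of ?F] by (simp add: F.space_F)
        have "{\<omega> \<in> space (outcomes Q). ?D \<omega> = S \<and> ?T \<omega> \<le> \<infinity>}
          = (\<Union>n. {\<omega> \<in> space (outcomes Q). ?D \<omega> = S \<and> ?T \<omega> \<le> enat n})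
            \<union> (if S = {} then space (outcomes Q) - (\<Union>n. {\<omega> \<in> space (outcomes Q). ?T \<omega> \<le> enat n}) else {})"
          (is "?l = ?r")
        proof (intro equalityI subsetI)
          fix \<omega> assume "\<omega> \<in> ?l"
          then show "\<omega> \<in> ?r" by (cases "?T \<omega>") (auto simp: D_si_def)
        next
          fix \<omega> assume "\<omega> \<in> ?r"
          then show "\<omega> \<in> ?l" by (cases "?T \<omega>") (auto simp: D_si_def split: if_splits)
        qed
        also have "\<dots> \<in> sets ?F"
          using fin[of S] T_si_le_sets[OF R k, of d] up top
          by (auto intro!: sets.Un sets.countable_UN sets.Diff)
        finally show ?thesis unfolding eq unfolding infinity .
      qed
    qed
  qed
  show ?thesis using R T D by (simp add: policies_def)
qed

text \<open>
  If \<open>k\<close> sources \<open>U\<close> are misclassified at the stopping time, then none of their statistics has the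
  right sign, so the log-likelihood ratio of \<open>P\<^sub>B\<close> against the configuration with \<open>U\<close> flipped is minus a sum
  of \<open>k\<close> absolute statistics, hence at most \<open>- d\<close>.  Only errors on \<open>{T_si < \<infinity>}\<close> are covered: without
  assumptions on \<open>R\<close> under \<open>P\<^sub>B\<close> nothing forces the rule to stop.
\<close>

lemma T_si_error:
  assumes R: "sampling_rule Q R" and k: "1 \<le> k" "k \<le> num_sources Q" and B: "B \<subseteq> sources Q"
  shows "measure (law Q B) {\<omega> \<in> space (outcomes Q). T_si Q k d R \<omega> < \<infinity> \<and>
      k \<le> card ((B - D_si Q k d R \<omega>) \<union> (D_si Q k d R \<omega> - B))}
    \<le> real (num_sources Q choose k) * exp (- d)"
proof -
  interpret PB: prob_space "law Q B" by (rule prob_law[OF B])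
  let ?T = "T_si Q k d R" and ?D = "D_si Q k d R"
  let ?\<U> = "{U. U \<subseteq> sources Q \<and> card U = k}"
  have finU: "finite ?\<U>" by (rule finite_subset[of _ "Pow (sources Q)"]) auto
  define G where "G = (\<lambda>U n. {\<omega> \<in> space (outcomes Q). ?T \<omega> = enat n \<and> U \<subseteq> (B - ?D \<omega>) \<union> (?D \<omega> - B)})"
  have G: "G U n \<in> sets (history Q R n)" for U n
    unfolding G_def by (rule T_si_D_si_sets[OF R k, where P = "\<lambda>S. U \<subseteq> (B - S) \<union> (S - B)"])
  have G': "G U n \<in> PB.events" for U n
    using G sets_history_subset[OF R] unfolding sets_law[OF B] by blast
  have bound: "measure (law Q B) (\<Union>n. G U n) \<le> exp (- d)" if U: "U \<in> ?\<U>" for U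
  proof -
    define B' where "B' = (B - U) \<union> (U - B)"
    have B': "B' \<subseteq> sources Q" using U B by (auto simp: B'_def)
    interpret PB': prob_space "law Q B'" by (rule prob_law[OF B'])
    have diff: "(B - B') \<union> (B' - B) = U" by (auto simp: B'_def)
    have "measure (law Q B) (\<Union>n. G U n) \<le> exp (- d) * measure (law Q B') (\<Union>n. G U n)"
    proof (rule lr_stopped[OF B B' R G])
      show "disjoint_family (G U)" by (auto simp: disjoint_family_on_def G_def)
      fix n \<omega> assume \<omega>: "\<omega> \<in> G U n"
      then have Tn: "?T \<omega> = enat n" and UD: "U \<subseteq> (B - ?D \<omega>) \<union> (?D \<omega> - B)" by (auto simp: G_def)
      have D: "?D \<omega> = {i \<in> sources Q. 0 < cum_llr Q R i n \<omega>}" using Tn by (simp add: D_si_def)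
      have "log_lr Q B B' R n \<omega> = (\<Sum>i\<in>U. - \<bar>cum_llr Q R i n \<omega>\<bar>)"
        unfolding log_lr_def diff
      proof (rule sum.cong[OF refl])
        fix i assume i: "i \<in> U"
        then have "i \<in> sources Q" using U by auto
        with i UD D have "i \<in> B \<and> \<not> 0 < cum_llr Q R i n \<omega> \<or> i \<notin> B \<and> 0 < cum_llr Q R i n \<omega>" by auto
        then show "walk Q B R i n \<omega> = - \<bar>cum_llr Q R i n \<omega>\<bar>" by (auto simp: walk_eq_cum_llr)
      qed
      also have "\<dots> = - (\<Sum>i\<in>U. \<bar>cum_llr Q R i n \<omega>\<bar>)" by (rule sum_negf)
      also have "\<dots> \<le> - d"
        using T_si_enatD[OF k Tn] U by (auto simp: crossing_def)
      finally show "log_lr Q B B' R n \<omega> \<le> - d" .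
    qed
    also have "\<dots> \<le> exp (- d) * 1" by (intro mult_left_mono PB'.prob_le_1) auto
    finally show ?thesis by simp
  qed
  have sub: "{\<omega> \<in> space (outcomes Q). ?T \<omega> < \<infinity> \<and> k \<le> card ((B - ?D \<omega>) \<union> (?D \<omega> - B))}
      \<subseteq> (\<Union>U\<in>?\<U>. \<Union>n. G U n)"
  proof
    fix \<omega> assume "\<omega> \<in> {\<omega> \<in> space (outcomes Q). ?T \<omega> < \<infinity> \<and> k \<le> card ((B - ?D \<omega>) \<union> (?D \<omega> - B))}"
    then have \<omega>: "\<omega> \<in> space (outcomes Q)" and Tfin: "?T \<omega> < \<infinity>" and card: "k \<le> card ((B - ?D \<omega>) \<union> (?D \<omega> - B))"
      by auto
    obtain n where n: "?T \<omega> = enat n" using Tfin by auto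
    obtain U where U: "U \<subseteq> (B - ?D \<omega>) \<union> (?D \<omega> - B)" "card U = k"
      using obtain_subset_with_card_n[OF card] by metis
    have "?D \<omega> \<subseteq> sources Q" by (auto simp: D_si_def split: enat.split)
    then have "U \<in> ?\<U>" using U B by auto
    moreover have "\<omega> \<in> G U n" using \<omega> n U by (simp add: G_def)
    ultimately show "\<omega> \<in> (\<Union>U\<in>?\<U>. \<Union>n. G U n)" by blast
  qed
  have "measure (law Q B) {\<omega> \<in> space (outcomes Q). ?T \<omega> < \<infinity> \<and> k \<le> card ((B - ?D \<omega>) \<union> (?D \<omega> - B))}
      \<le> measure (law Q B) (\<Union>U\<in>?\<U>. \<Union>n. G U n)"
    using G' finU by (intro PB.finite_measure_mono[OF sub] sets.finite_UN sets.countable_UN) auto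
  also have "\<dots> \<le> (\<Sum>U\<in>?\<U>. measure (law Q B) (\<Union>n. G U n))"
    using G' finU by (intro PB.finite_measure_subadditive_finite) auto
  also have "\<dots> \<le> (\<Sum>U\<in>?\<U>. exp (- d))" by (intro sum_mono bound)
  also have "\<dots> = real (num_sources Q choose k) * exp (- d)"
    by (simp add: n_subsets)
  finally show ?thesis .
qed

lemma threshold_error:
  assumes \<alpha>: "0 < \<alpha>" "\<alpha> < 1" and k: "1 \<le> k" "k \<le> num_sources Q"
  shows "real (num_sources Q choose k) * exp (- threshold Q k \<alpha>) = \<alpha>"
proof -
  have "0 < real (num_sources Q choose k)" using k by simp
  then show ?thesis
    using \<alpha> by (simp add: threshold_def exp_diff exp_minus abs_of_neg exp_add field_simps)
qed

end

section \<open>The max-min rate in terms of the sources\<close>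

lemma rankingD:
  assumes "ranking Q A \<sigma>"
  shows "bij_betw \<sigma> (sources Q) (sources Q)"
    and "i \<in> sources Q \<Longrightarrow> strength Q A (\<sigma> i) = elem (F_list Q A) i"
  using assms by (auto simp: ranking_def)

lemma length_F_list: "length (F_list Q A) = num_sources Q"
  by (simp add: F_list_def)

lemma ranking_sum:
  assumes r: "ranking Q A \<sigma>" and U: "U \<subseteq> sources Q"
  shows "\<sigma> ` U \<subseteq> sources Q" "card (\<sigma> ` U) = card U"
    "(\<Sum>j\<in>\<sigma> ` U. c j * strength Q A j) = (\<Sum>i\<in>U. c (\<sigma> i) * elem (F_list Q A) i)"
proof -
  have inj: "inj_on \<sigma> U" and img: "\<sigma> ` sources Q = sources Q"
    using rankingD(1)[OF r] U by (auto simp: bij_betw_def intro: inj_on_subset)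
  show "\<sigma> ` U \<subseteq> sources Q" using img U by blast
  show "card (\<sigma> ` U) = card U" by (rule card_image[OF inj])
  show "(\<Sum>j\<in>\<sigma> ` U. c j * strength Q A j) = (\<Sum>i\<in>U. c (\<sigma> i) * elem (F_list Q A) i)"
    unfolding sum.reindex[OF inj] using U rankingD(2)[OF r] by (intro sum.cong) auto
qed

lemma ranking_preimage:
  assumes r: "ranking Q A \<sigma>" and U: "U \<subseteq> sources Q"
  obtains U' where "U' \<subseteq> sources Q" "\<sigma> ` U' = U" "card U' = card U"
proof -
  let ?U' = "{i \<in> sources Q. \<sigma> i \<in> U}"
  have "U \<subseteq> \<sigma> ` sources Q" using rankingD(1)[OF r] U by (simp add: bij_betw_def)
  then have img: "\<sigma> ` ?U' = U" by blast
  moreover have "card (\<sigma> ` ?U') = card ?U'" by (rule ranking_sum(2)[OF r]) auto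
  ultimately show thesis by (intro that[of ?U']) auto
qed

context anomaly_model
begin

lemma allocation_F_list:
  assumes "1 \<le> k" "k \<le> num_sources Q" "0 < K"
  shows "allocation k K (F_list Q A)"
proof
  show "sorted (F_list Q A)" by (simp add: F_list_def)
  show "0 < l" if "l \<in> set (F_list Q A)" for l
    using that strength_pos by (auto simp: F_list_def)
qed (use assms in \<open>simp_all add: length_F_list\<close>)

lemma bdd_above_max_min:
  assumes "1 \<le> k" "k \<le> num_sources Q" "0 < K"
  shows "bdd_above ((\<lambda>c. Min ((\<lambda>U. \<Sum>i\<in>U. c i * elem (F_list Q A) i) `
      {U. U \<subseteq> {1..length (F_list Q A)} \<and> card U = k})) ` budget_vectors (num_sources Q) K)"
proof (rule bdd_aboveI2)
  interpret allocation k K "F_list Q A" by (rule allocation_F_list[OF assms])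
  let ?E = "elem (F_list Q A)"
  fix c assume c: "c \<in> budget_vectors (num_sources Q) K"
  have "Min ((\<lambda>U. \<Sum>i\<in>U. c i * ?E i) ` {U. U \<subseteq> {1..length (F_list Q A)} \<and> card U = k}) \<le> (\<Sum>i=1..k. c i * ?E i)"
  proof (rule Min_le)
    show "finite ((\<lambda>U. \<Sum>i\<in>U. c i * ?E i) ` {U. U \<subseteq> {1..length (F_list Q A)} \<and> card U = k})"
      by (rule finite_imageI, rule finite_subset[of _ "Pow {1..length (F_list Q A)}"]) auto
    show "(\<Sum>i=1..k. c i * ?E i) \<in> (\<lambda>U. \<Sum>i\<in>U. c i * ?E i) ` {U. U \<subseteq> {1..length (F_list Q A)} \<and> card U = k}"
      using assms by (intro image_eqI[of _ _ "{1..k}"]) (auto simp: length_F_list)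
  qed
  also have "\<dots> \<le> (\<Sum>i=1..k. ?E i)"
  proof (rule sum_mono)
    fix i assume i: "i \<in> {1..k}"
    then have "i \<in> {1..num_sources Q}" using assms by auto
    then have "0 \<le> c i \<and> c i \<le> 1" using c unfolding budget_vectors_def by (auto simp: PiE_def Pi_def)
    moreover have "0 \<le> ?E i" using i assms by (intro E_nonneg) (auto simp: length_F_list)
    ultimately show "c i * ?E i \<le> ?E i" by (simp add: mult_left_le_one_le)
  qed
  finally show "Min ((\<lambda>U. \<Sum>i\<in>U. c i * ?E i) ` {U. U \<subseteq> {1..length (F_list Q A)} \<and> card U = k}) \<le> (\<Sum>i=1..k. ?E i)" .
qed

text \<open>
  For the vector of empirical sampling frequencies this is what turns the budget constraint into a
  lower bound on the stopping time.
\<close>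

lemma rate_upper:
  assumes k: "1 \<le> k" "k \<le> num_sources Q" and K: "0 < K" and r: "ranking Q A \<sigma>"
    and c: "\<And>i. i \<in> sources Q \<Longrightarrow> 0 \<le> c i \<and> c i \<le> 1" and sum_c: "(\<Sum>i\<in>sources Q. c i) \<le> K"
  obtains U where "U \<subseteq> sources Q" "card U = k"
    "(\<Sum>i\<in>U. c i * strength Q A i) \<le> max_min_rate (num_sources Q) k K (F_list Q A)"
proof -
  define c' where "c' = restrict (c \<circ> \<sigma>) (sources Q)"
  have \<sigma>_in: "\<sigma> i \<in> sources Q" if "i \<in> sources Q" for i
    using rankingD(1)[OF r] that by (auto simp: bij_betw_def)
  have "(\<Sum>i\<in>sources Q. c' i) = (\<Sum>i\<in>sources Q. c (\<sigma> i))"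
    by (intro sum.cong) (auto simp: c'_def)
  also have "\<dots> = (\<Sum>i\<in>sources Q. c i)"
    by (rule sum.reindex_bij_betw[OF rankingD(1)[OF r]])
  finally have "c' \<in> budget_vectors (num_sources Q) K"
    using sum_c c \<sigma>_in by (auto simp: budget_vectors_def c'_def)
  from cSUP_upper[OF this bdd_above_max_min[OF k K]]
  have le: "Min ((\<lambda>U. \<Sum>i\<in>U. c' i * elem (F_list Q A) i) ` {U. U \<subseteq> {1..length (F_list Q A)} \<and> card U = k})
      \<le> max_min_rate (num_sources Q) k K (F_list Q A)"
    by (simp only: max_min_rate_def)
  obtain U t where U: "U \<subseteq> {1..num_sources Q}" "card U = k" and
    Ueq: "(\<Sum>i=1..k. sort (map (\<lambda>i. c' i * elem (F_list Q A) i) [1..<Suc (num_sources Q)]) ! (i - 1))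
      = (\<Sum>i\<in>U. c' i * elem (F_list Q A) i)"
    by (rule smallest_sum_exists[OF k, of "\<lambda>i. c' i * elem (F_list Q A) i"])
  have "(\<Sum>j\<in>\<sigma> ` U. c j * strength Q A j) = (\<Sum>i\<in>U. c (\<sigma> i) * elem (F_list Q A) i)"
    by (rule ranking_sum(3)[OF r U(1)])
  also have "\<dots> = (\<Sum>i\<in>U. c' i * elem (F_list Q A) i)"
    using U(1) by (intro sum.cong) (auto simp: c'_def)
  also have "\<dots> \<le> max_min_rate (num_sources Q) k K (F_list Q A)"
    using le Ueq by (simp only: smallest_sum_eq_Min[OF k] length_F_list)
  finally show thesis
    using ranking_sum(1,2)[OF r U(1)] U(2) by (intro that[of "\<sigma> ` U"]) auto
qed

lemma rate_approx:
  assumes k: "1 \<le> k" "k \<le> num_sources Q" and K: "0 < K" and r: "ranking Q A \<sigma>"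
    and v: "v < max_min_rate (num_sources Q) k K (F_list Q A)"
  obtains c where "\<And>i. i \<in> sources Q \<Longrightarrow> 0 \<le> c i \<and> c i \<le> 1" "(\<Sum>i\<in>sources Q. c i) \<le> K"
    "\<And>U. U \<subseteq> sources Q \<Longrightarrow> card U = k \<Longrightarrow> v \<le> (\<Sum>i\<in>U. c i * strength Q A i)"
proof -
  let ?L = "F_list Q A"
  have "(\<lambda>i\<in>{1..num_sources Q}. 0) \<in> budget_vectors (num_sources Q) K"
    using K by (simp add: budget_vectors_def)
  then have ne: "budget_vectors (num_sources Q) K \<noteq> {}" by blast
  from v obtain c where c: "c \<in> budget_vectors (num_sources Q) K"
    and vc: "v < Min ((\<lambda>U. \<Sum>i\<in>U. c i * elem ?L i) ` {U. U \<subseteq> {1..length ?L} \<and> card U = k})"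
    unfolding max_min_rate_def less_cSUP_iff[OF ne bdd_above_max_min[OF k K]] by blast
  define c' where "c' = (\<lambda>j. c (inv_into (sources Q) \<sigma> j))"
  have inv: "inv_into (sources Q) \<sigma> (\<sigma> i) = i" if "i \<in> sources Q" for i
    using rankingD(1)[OF r] that by (auto simp: bij_betw_def)
  have bij: "bij_betw (inv_into (sources Q) \<sigma>) (sources Q) (sources Q)"
    by (rule bij_betw_inv_into[OF rankingD(1)[OF r]])
  show thesis
  proof (rule that[of c'])
    show "0 \<le> c' i \<and> c' i \<le> 1" if "i \<in> sources Q" for i
    proof -
      have "inv_into (sources Q) \<sigma> i \<in> sources Q" using bij that by (auto simp: bij_betw_def)
      then show ?thesis using c unfolding c'_def budget_vectors_def by (auto simp: PiE_def Pi_def)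
    qed
    show "(\<Sum>i\<in>sources Q. c' i) \<le> K"
      unfolding c'_def sum.reindex_bij_betw[OF bij] using c by (simp add: budget_vectors_def)
    fix U assume U: "U \<subseteq> sources Q" "card U = k"
    obtain U' where U': "U' \<subseteq> sources Q" "\<sigma> ` U' = U" "card U' = card U"
      using ranking_preimage[OF r U(1)] by blast
    have "v \<le> Min ((\<lambda>U. \<Sum>i\<in>U. c i * elem ?L i) ` {U. U \<subseteq> {1..length ?L} \<and> card U = k})"
      using vc by simp
    also have "\<dots> \<le> (\<Sum>i\<in>U'. c i * elem ?L i)"
    proof (rule Min_le)
      show "finite ((\<lambda>U. \<Sum>i\<in>U. c i * elem ?L i) ` {U. U \<subseteq> {1..length ?L} \<and> card U = k})"
        by (rule finite_imageI, rule finite_subset[of _ "Pow {1..length ?L}"]) auto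
    qed (use U' U in \<open>auto simp: length_F_list\<close>)
    also have "\<dots> = (\<Sum>i\<in>U'. c' (\<sigma> i) * elem ?L i)"
      using U'(1) inv by (intro sum.cong) (auto simp: c'_def)
    also have "\<dots> = (\<Sum>i\<in>U. c' i * strength Q A i)"
      using ranking_sum(3)[OF r U'(1), of c'] U'(2) by simp
    finally show "v \<le> (\<Sum>i\<in>U. c' i * strength Q A i)" .
  qed
qed

lemma c_star_rate:
  assumes k: "1 \<le> k" "k \<le> num_sources Q" and K: "0 < K" and r: "ranking Q A \<sigma>"
    and U: "U \<subseteq> sources Q" "card U = k"
  shows "max_min_rate (num_sources Q) k K (F_list Q A) \<le> (\<Sum>i\<in>U. c_star Q A k K \<sigma> i * strength Q A i)"
proof -
  interpret allocation k K "F_list Q A" by (rule allocation_F_list[OF k K])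
  obtain U' where U': "U' \<subseteq> sources Q" "\<sigma> ` U' = U" "card U' = card U"
    using ranking_preimage[OF r U(1)] by blast
  have inv: "inv_into (sources Q) \<sigma> (\<sigma> i) = i" if "i \<in> sources Q" for i
    using rankingD(1)[OF r] that by (auto simp: bij_betw_def)
  have "max_min_rate (num_sources Q) k K (F_list Q A) \<le> (\<Sum>i\<in>U'. c_prime k K (F_list Q A) i * elem (F_list Q A) i)"
    by (rule c_prime_optimal) (use U' U in \<open>simp_all add: length_F_list\<close>)
  also have "\<dots> = (\<Sum>i\<in>U'. c_star Q A k K \<sigma> (\<sigma> i) * elem (F_list Q A) i)"
    using U'(1) inv by (intro sum.cong) (auto simp: c_star_def)
  also have "\<dots> = (\<Sum>i\<in>U. c_star Q A k K \<sigma> i * strength Q A i)"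
    using ranking_sum(3)[OF r U'(1), of "c_star Q A k K \<sigma>"] U'(2) by simp
  finally show ?thesis .
qed

lemma rate_pos:
  assumes k: "1 \<le> k" "k \<le> num_sources Q" and K: "0 < K" "K \<le> real (num_sources Q)" and r: "ranking Q A \<sigma>"
  shows "0 < max_min_rate (num_sources Q) k K (F_list Q A)"
proof -
  let ?c = "\<lambda>i::nat. K / real (num_sources Q)"
  have M: "0 < real (num_sources Q)" using k by simp
  obtain U where U: "U \<subseteq> sources Q" "card U = k"
    and le: "(\<Sum>i\<in>U. ?c i * strength Q A i) \<le> max_min_rate (num_sources Q) k K (F_list Q A)"
    by (rule rate_upper[OF k K(1) r, of ?c]) (use K M in auto)
  have "U \<noteq> {}" using U k by auto
  then have "0 < (\<Sum>i\<in>U. ?c i * strength Q A i)"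
    using U K M strength_pos finite_subset[OF U(1)] by (intro sum_pos) (auto intro!: mult_pos_pos)
  with le show ?thesis by simp
qed

section \<open>Bounded truncations of a random time\<close>

definition truncate_time :: "('w \<Rightarrow> enat) \<Rightarrow> nat \<Rightarrow> 'w \<Rightarrow> nat" where
  "truncate_time T N \<omega> = (case T \<omega> of enat n \<Rightarrow> min n N | \<infinity> \<Rightarrow> N)"

lemma truncate_time_le: "truncate_time T N \<omega> \<le> N"
  by (auto simp: truncate_time_def split: enat.split)

lemma enat_truncate_time_le: "enat (truncate_time T N \<omega>) \<le> T \<omega>"
  by (auto simp: truncate_time_def split: enat.split)

lemma stopping_truncate_time:
  assumes T: "\<And>n. {\<omega> \<in> space (outcomes Q). T \<omega> \<le> enat n} \<in> sets (history Q R n)"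
  shows "stopping R (truncate_time T N)"
  unfolding stopping_def
proof
  fix n
  have "{\<omega> \<in> space (outcomes Q). n < truncate_time T N \<omega>}
      = (if n < N then space (history Q R n) - {\<omega> \<in> space (outcomes Q). T \<omega> \<le> enat n} else {})"
  proof (rule set_eqI)
    fix \<omega>
    show "\<omega> \<in> {\<omega> \<in> space (outcomes Q). n < truncate_time T N \<omega>}
      \<longleftrightarrow> \<omega> \<in> (if n < N then space (history Q R n) - {\<omega> \<in> space (outcomes Q). T \<omega> \<le> enat n} else {})"
      by (cases "T \<omega>") (auto simp: truncate_time_def space_history)
  qed
  also have "\<dots> \<in> sets (history Q R n)" using T[of n] by auto
  finally show "{\<omega> \<in> space (outcomes Q). n < truncate_time T N \<omega>} \<in> sets (history Q R n)" .
qed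

end

section \<open>Bounds on expected times\<close>

context anomaly_model
begin

text \<open>
  The error probabilities are restricted to \<open>{T < \<infinity>}\<close>, so that the bound covers all admissible
  policies as well as the sum-intersection rule with a sampling rule that need not stop under other
  configurations.  The constant \<open>C\<close> is chosen before the policy.
\<close>

lemma lower_bound:
  assumes A: "A \<subseteq> sources Q" and k: "1 \<le> k" "k \<le> num_sources Q"
    and K: "0 < K" "K \<le> real (num_sources Q)" and r: "ranking Q A \<sigma>"
    and \<epsilon>: "0 < \<epsilon>" "\<epsilon> < 1"
  obtains C where "\<And>R T D a. (R, T, D) \<in> policies Q \<Longrightarrow>
      (AE \<omega> in law Q A. \<forall>n. T \<omega> = enat n \<longrightarrow> (1 / real n) * (\<Sum>m=1..n. real (card (R m \<omega>))) \<le> K) \<Longrightarrow>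
      0 < a \<Longrightarrow>
      (\<And>B. B \<subseteq> sources Q \<Longrightarrow> measure (law Q B) {\<omega> \<in> space (outcomes Q). T \<omega> < \<infinity> \<and>
          k \<le> card ((B - D \<omega>) \<union> (D \<omega> - B))} \<le> exp (- a)) \<Longrightarrow>
      ennreal (((1 - \<epsilon>) * a - C) / (max_min_rate (num_sources Q) k K (F_list Q A) + \<epsilon>)) \<le> expected_time Q A T"
proof -
  interpret PA: prob_space "law Q A" by (rule prob_law[OF A])
  define V where "V = max_min_rate (num_sources Q) k K (F_list Q A)"
  have V: "0 < V" unfolding V_def by (rule rate_pos[OF k K r])
  obtain C where dev: "deviation_control A (sources Q) (\<epsilon>) C"
    by (rule deviation_control_sources[OF A \<epsilon>(1)])
  \<comment> \<open>Pairs of a tolerated error \<open>W\<close> and a set \<open>U\<close> of further changes that would make it intolerable.\<close>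
  define P where "P = {(W, U). W \<subseteq> sources Q \<and> card W < k \<and> U \<subseteq> sources Q - W \<and> card U = k - card W}"
  have finP: "finite P"
    by (rule finite_subset[of _ "Pow (sources Q) \<times> Pow (sources Q)"]) (auto simp: P_def)
  show thesis
  proof (rule that[of "C + 1 + real (card P) / \<epsilon>"], fold V_def)
    fix R :: "'w rule" and T :: "'w \<Rightarrow> enat" and D :: "'w \<Rightarrow> nat set" and a :: real
    assume p: "(R, T, D) \<in> policies Q"
      and budget: "AE \<omega> in law Q A. \<forall>n. T \<omega> = enat n \<longrightarrow> (1 / real n) * (\<Sum>m=1..n. real (card (R m \<omega>))) \<le> K"
      and a: "0 < a"
      and error: "\<And>B. B \<subseteq> sources Q \<Longrightarrow> measure (law Q B) {\<omega> \<in> space (outcomes Q). T \<omega> < \<infinity> \<and>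
          k \<le> card ((B - D \<omega>) \<union> (D \<omega> - B))} \<le> exp (- a)"
    note R = policy_sampling_rule[OF p]
    \<comment> \<open>Truncating at \<open>N\<close> loses nothing: a policy still running at time \<open>a / V\<close> has met the bound.\<close>
    define N where "N = nat \<lceil>a / V\<rceil>"
    have N: "a \<le> V * real N"
      using V real_nat_ceiling_ge[of "a / V"] by (simp add: N_def pos_divide_le_eq mult.commute)
    define \<tau> where "\<tau> = truncate_time T N"
    have stop: "stopping R \<tau>" unfolding \<tau>_def by (rule stopping_truncate_time[OF policy_time_sets[OF p]])
    have \<tau>N: "\<tau> \<omega> \<le> N" for \<omega> by (simp add: \<tau>_def truncate_time_le)
    obtain X where X: "integrable (law Q A) X" "(\<integral>\<omega>. X \<omega> \<partial>law Q A) \<le> \<epsilon> * (\<integral>\<omega>. real (\<tau> \<omega>) \<partial>law Q A) + C"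
      and Xdev_all: "\<And>\<omega> n. \<omega> \<in> space (outcomes Q) \<Longrightarrow> n \<le> \<tau> \<omega> \<Longrightarrow>
        (\<Sum>i\<in>sources Q. \<bar>walk Q A R i n \<omega> - strength Q A i * sample_count R i n \<omega>\<bar>) \<le> X \<omega>"
      by (rule deviation_controlE[OF dev R stop \<tau>N], rule that, assumption+)
    have Xdev: "(\<Sum>i\<in>U. \<bar>walk Q A R i n \<omega> - strength Q A i * sample_count R i n \<omega>\<bar>) \<le> X \<omega>"
      if "\<omega> \<in> space (outcomes Q)" "n \<le> \<tau> \<omega>" "U \<subseteq> sources Q" for \<omega> n U
      using that(3) by (intro order_trans[OF sum_mono2 Xdev_all[OF that(1,2)]]) auto
    have X0: "0 \<le> X \<omega>" if "\<omega> \<in> space (outcomes Q)" for \<omega>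
      using Xdev[OF that, of 0 "{}"] by simp
    define wrong where "wrong = (\<lambda>B. {\<omega> \<in> space (outcomes Q). T \<omega> < \<infinity> \<and> k \<le> card ((B - D \<omega>) \<union> (D \<omega> - B))})"
    have wrong_sets: "wrong B \<in> sets (outcomes Q)" for B
    proof -
      have "wrong B = (\<Union>n. {\<omega> \<in> space (outcomes Q). T \<omega> = enat n \<and> k \<le> card ((B - D \<omega>) \<union> (D \<omega> - B))})"
        by (auto simp: wrong_def)
      also have "\<dots> \<in> sets (outcomes Q)"
        using policy_event_sets[OF p, of _ "\<lambda>S. k \<le> card ((B - S) \<union> (S - B))"] sets_history_subset[OF R]
        by (intro sets.countable_UN) auto
      finally show ?thesis .
    qed
    define B :: "nat set \<times> nat set \<Rightarrow> nat set" where "B = (\<lambda>q. (A - snd q) \<union> (snd q - A))"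
    have B_sub: "B q \<subseteq> sources Q" if "q \<in> P" for q using that A by (auto simp: P_def B_def)
    define G where "G = (\<lambda>q n. {\<omega> \<in> space (outcomes Q). T \<omega> = enat n \<and> (A - D \<omega>) \<union> (D \<omega> - A) = fst q}
        \<inter> {\<omega> \<in> space (outcomes Q). log_lr Q A (B q) R n \<omega> \<le> (1 - \<epsilon>) * a})"
    have G_hist: "G q n \<in> sets (history Q R n)" if "q \<in> P" for q n
    proof -
      have "{\<omega> \<in> space (history Q R n). log_lr Q A (B q) R n \<omega> \<le> (1 - \<epsilon>) * a} \<in> sets (history Q R n)"
        using log_lr_measurable[OF R A B_sub[OF that], of n] by (intro borel_measurable_le) auto
      then show ?thesis
        unfolding G_def using policy_event_sets[OF p, of n "\<lambda>S. (A - S) \<union> (S - A) = fst q"]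
        by (intro sets.Int) (auto simp: space_history)
    qed
    have G_sets: "(\<Union>n. G q n) \<in> sets (outcomes Q)" if "q \<in> P" for q
      using G_hist[OF that] sets_history_subset[OF R] by (intro sets.countable_UN) auto
    have G_le: "measure (law Q A) (\<Union>n. G q n) \<le> exp (- \<epsilon> * a)" if q: "q \<in> P" for q
    proof -
      interpret PB: prob_space "law Q (B q)" by (rule prob_law[OF B_sub[OF q]])
      have "measure (law Q A) (\<Union>n. G q n) \<le> exp ((1 - \<epsilon>) * a) * measure (law Q (B q)) (\<Union>n. G q n)"
        by (rule lr_stopped[OF A B_sub[OF q] R G_hist[OF q]]) (auto simp: disjoint_family_on_def G_def)
      also have "measure (law Q (B q)) (\<Union>n. G q n) \<le> measure (law Q (B q)) (wrong (B q))"
      proof (rule PB.finite_measure_mono)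
        show "wrong (B q) \<in> PB.events" using wrong_sets by (simp add: sets_law[OF B_sub[OF q]])
        show "(\<Union>n. G q n) \<subseteq> wrong (B q)"
        proof
          fix \<omega> assume "\<omega> \<in> (\<Union>n. G q n)"
          then obtain n where \<omega>: "\<omega> \<in> space (outcomes Q)" "T \<omega> = enat n" and W: "(A - D \<omega>) \<union> (D \<omega> - A) = fst q"
            by (auto simp: G_def)
          have q': "fst q \<subseteq> sources Q" "card (fst q) < k" "snd q \<subseteq> sources Q - fst q" "card (snd q) = k - card (fst q)"
            using q by (auto simp: P_def)
          have "(B q - D \<omega>) \<union> (D \<omega> - B q) = fst q \<union> snd q"
            using W q'(3) unfolding B_def by blast
          moreover have "card (fst q \<union> snd q) = k"
            using q' finite_subset[OF q'(1)] finite_subset[OF q'(3)] by (subst card_Un_disjoint) auto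
          ultimately show "\<omega> \<in> wrong (B q)" using \<omega> by (simp add: wrong_def)
        qed
      qed
      also have "measure (law Q (B q)) (wrong (B q)) \<le> exp (- a)"
        unfolding wrong_def by (rule error[OF B_sub[OF q]])
      also have "exp ((1 - \<epsilon>) * a) * exp (- a) = exp (- \<epsilon> * a)"
        by (simp add: exp_add[symmetric] algebra_simps)
      finally show ?thesis by simp
    qed
    define bad where "bad = wrong A \<union> (\<Union>q\<in>P. \<Union>n. G q n)"
    have bad_sets: "bad \<in> PA.events"
      unfolding bad_def sets_law[OF A] by (intro sets.Un sets.finite_UN[OF finP] wrong_sets G_sets)
    have "measure (law Q A) bad \<le> measure (law Q A) (wrong A) + measure (law Q A) (\<Union>q\<in>P. \<Union>n. G q n)"
      unfolding bad_def
      by (rule measure_Un_le; unfold sets_law[OF A]) (intro sets.finite_UN[OF finP] wrong_sets G_sets)+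
    also have "measure (law Q A) (\<Union>q\<in>P. \<Union>n. G q n) \<le> (\<Sum>q\<in>P. measure (law Q A) (\<Union>n. G q n))"
      using finP G_sets by (intro PA.finite_measure_subadditive_finite) (auto simp: sets_law[OF A])
    also have "\<dots> \<le> (\<Sum>q\<in>P. exp (- \<epsilon> * a))" by (intro sum_mono G_le)
    also have "measure (law Q A) (wrong A) \<le> exp (- a)" unfolding wrong_def by (rule error[OF A])
    finally have bad_le: "measure (law Q A) bad \<le> exp (- a) + real (card P) * exp (- \<epsilon> * a)" by simp
    \<comment> \<open>The probability of the bad event, multiplied by \<open>a\<close>, stays bounded and can go into the constant.\<close>
    have a_exp: "a * exp (- c * a) \<le> 1 / c" if c: "0 < c" for c
    proof -
      have "c * a \<le> exp (c * a)" using exp_ge_add_one_self[of "c * a"] by linarith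
      then have "c * a * exp (- (c * a)) \<le> exp (c * a) * exp (- (c * a))" by (intro mult_right_mono) auto
      then show ?thesis using c by (simp add: exp_minus field_simps)
    qed
    have "a * measure (law Q A) bad \<le> a * (exp (- a) + real (card P) * exp (- \<epsilon> * a))"
      using bad_le a by (intro mult_left_mono) auto
    also have "\<dots> = a * exp (- 1 * a) + real (card P) * (a * exp (- \<epsilon> * a))" by (simp add: algebra_simps)
    also have "\<dots> \<le> 1 / 1 + real (card P) * (1 / \<epsilon>)"
      using a_exp[of 1] a_exp[OF \<epsilon>(1)] by (intro add_mono mult_left_mono) auto
    finally have a_bad: "a * measure (law Q A) bad \<le> 1 + real (card P) / \<epsilon>" by simp
    define t where "t = (\<integral>\<omega>. real (\<tau> \<omega>) \<partial>law Q A)"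
    have \<tau>_int: "integrable (law Q A) (\<lambda>\<omega>. real (\<tau> \<omega>))"
      by (rule stopping_integrable[OF A R stop \<tau>N])
    have pointwise: "(1 - \<epsilon>) * a * (1 - indicator bad \<omega>) \<le> V * real (\<tau> \<omega>) + X \<omega>"
      if \<omega>: "\<omega> \<in> space (outcomes Q)"
        and b: "\<forall>n. T \<omega> = enat n \<longrightarrow> (1 / real n) * (\<Sum>m=1..n. real (card (R m \<omega>))) \<le> K" for \<omega>
    proof (cases "\<omega> \<in> bad")
      case True
      then show ?thesis using V X0[OF \<omega>] by simp
    next
      case False
      have a': "(1 - \<epsilon>) * a \<le> a" using \<epsilon> a by (simp add: mult_left_le_one_le)
      show ?thesis
      proof (cases "T \<omega> \<le> enat N")
        case False
        then have "\<tau> \<omega> = N" by (cases "T \<omega>") (auto simp: \<tau>_def truncate_time_def)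
        then show ?thesis using N X0[OF \<omega>] a' \<open>\<omega> \<notin> bad\<close> by simp
      next
        case True
        then obtain n where n: "T \<omega> = enat n" "n \<le> N" by (cases "T \<omega>") auto
        then have \<tau>n: "\<tau> \<omega> = n" by (simp add: \<tau>_def truncate_time_def)
        define W where "W = (A - D \<omega>) \<union> (D \<omega> - A)"
        have W_sub: "W \<subseteq> sources Q"
          using policy_decision_subset[OF p \<omega>] A by (auto simp: W_def)
        have W_card: "card W < k"
          using False \<omega> n by (auto simp: bad_def wrong_def W_def)
        have R_sub: "R m \<omega> \<subseteq> sources Q" if "m \<in> {1..n}" for m
          using sampling_ruleD(2)[OF R _ \<omega>, of m] that by simp
        \<comment> \<open>For \<open>n = 0\<close> all counts vanish, and \<open>c = 0\<close> by the convention \<open>x / 0 = 0\<close>.\<close>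
        define c where "c = (\<lambda>i. sample_count R i n \<omega> / real n)"
        have cnt: "0 \<le> sample_count R i n \<omega>" "sample_count R i n \<omega> \<le> real n" for i
        proof -
          show "0 \<le> sample_count R i n \<omega>" unfolding sample_count_def by (intro sum_nonneg) simp
          have "sample_count R i n \<omega> \<le> (\<Sum>m=1..n. 1)" unfolding sample_count_def by (intro sum_mono) simp
          then show "sample_count R i n \<omega> \<le> real n" by simp
        qed
        have c01: "0 \<le> c i \<and> c i \<le> 1" for i
          using cnt[of i] unfolding c_def by (cases "n = 0") (auto simp: divide_le_eq)
        have "(\<Sum>i\<in>sources Q. c i) = (\<Sum>i\<in>sources Q. sample_count R i n \<omega>) / real n"
          by (simp add: c_def sum_divide_distrib)
        also have "(\<Sum>i\<in>sources Q. sample_count R i n \<omega>) = (\<Sum>m=1..n. \<Sum>i\<in>sources Q. of_bool (i \<in> R m \<omega>))"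
          unfolding sample_count_def by (rule sum.swap)
        also have "\<dots> = (\<Sum>m=1..n. real (card (R m \<omega>)))"
          using R_sub by (intro sum.cong) (auto simp: Int_absorb1)
        finally have sum_c: "(\<Sum>i\<in>sources Q. c i) \<le> K" using b n(1) by simp
        obtain U where U: "U \<subseteq> sources Q" "card U = k" and U_le: "(\<Sum>i\<in>U. c i * strength Q A i) \<le> V"
          unfolding V_def by (rule rate_upper[OF k K(1) r c01 sum_c])
        have nc: "real n * c i = sample_count R i n \<omega>" for i
          using cnt[of i] by (cases "n = 0") (auto simp: c_def)
        have "real n * (\<Sum>i\<in>U. c i * strength Q A i) \<le> real n * V" using U_le by (intro mult_left_mono) auto
        also have "real n * (\<Sum>i\<in>U. c i * strength Q A i) = (\<Sum>i\<in>U. strength Q A i * sample_count R i n \<omega>)"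
          unfolding sum_distrib_left nc[symmetric] by (intro sum.cong) (auto simp: algebra_simps)
        finally have U_le': "(\<Sum>i\<in>U. strength Q A i * sample_count R i n \<omega>) \<le> V * real n" by (simp add: mult.commute)
        have finU: "finite U" using U(1) finite_subset by blast
        \<comment> \<open>Any \<open>k\<close> sources contain enough sources outside \<open>W\<close> to complete \<open>W\<close> to an error.\<close>
        have "k - card W \<le> card (U - W)"
          using U(2) diff_card_le_card_Diff[of W U] finite_subset[OF W_sub] by simp
        then obtain U' where U': "U' \<subseteq> U - W" "card U' = k - card W"
          using obtain_subset_with_card_n by metis
        have q: "(W, U') \<in> P" using W_sub W_card U' U(1) by (auto simp: P_def)
        have "\<omega> \<notin> G (W, U') n" using False q by (auto simp: bad_def)
        then have "(1 - \<epsilon>) * a \<le> log_lr Q A (B (W, U')) R n \<omega>"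
          using \<omega> n(1) by (auto simp: G_def W_def)
        also have "(A - B (W, U')) \<union> (B (W, U') - A) = U'" by (auto simp: B_def)
        then have "log_lr Q A (B (W, U')) R n \<omega> = (\<Sum>i\<in>U'. walk Q A R i n \<omega>)"
          by (simp add: log_lr_def)
        also have "\<dots> \<le> (\<Sum>i\<in>U'. strength Q A i * sample_count R i n \<omega>
            + \<bar>walk Q A R i n \<omega> - strength Q A i * sample_count R i n \<omega>\<bar>)"
          by (intro sum_mono) linarith
        also have "\<dots> = (\<Sum>i\<in>U'. strength Q A i * sample_count R i n \<omega>)
            + (\<Sum>i\<in>U'. \<bar>walk Q A R i n \<omega> - strength Q A i * sample_count R i n \<omega>\<bar>)"
          by (rule sum.distrib)
        also have "(\<Sum>i\<in>U'. \<bar>walk Q A R i n \<omega> - strength Q A i * sample_count R i n \<omega>\<bar>) \<le> X \<omega>"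
          using U' U \<tau>n by (intro Xdev[OF \<omega>]) auto
        also have "(\<Sum>i\<in>U'. strength Q A i * sample_count R i n \<omega>) \<le> (\<Sum>i\<in>U. strength Q A i * sample_count R i n \<omega>)"
          using U' finU U(1) strength_pos cnt
          by (intro sum_mono2) (auto intro!: mult_nonneg_nonneg less_imp_le[OF strength_pos])
        finally show ?thesis using U_le' False by (simp add: \<tau>n)
      qed
    qed
    have "(1 - \<epsilon>) * a * (1 - measure (law Q A) bad) = (\<integral>\<omega>. (1 - \<epsilon>) * a * (1 - indicator bad \<omega>) \<partial>law Q A)"
    proof -
      have "(\<integral>\<omega>. 1 - indicator bad \<omega> \<partial>law Q A) = 1 - measure (law Q A) bad"
        using bad_sets by (subst Bochner_Integration.integral_diff) (auto simp: PA.prob_space PA.emeasure_eq_measure)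
      then show ?thesis by simp
    qed
    also have "\<dots> \<le> (\<integral>\<omega>. V * real (\<tau> \<omega>) + X \<omega> \<partial>law Q A)"
    proof (rule integral_mono_AE)
      show "integrable (law Q A) (\<lambda>\<omega>. (1 - \<epsilon>) * a * (1 - indicator bad \<omega>))"
        using bad_sets by (auto simp: PA.emeasure_eq_measure)
      show "integrable (law Q A) (\<lambda>\<omega>. V * real (\<tau> \<omega>) + X \<omega>)" using \<tau>_int X(1) by simp
      show "AE \<omega> in law Q A. (1 - \<epsilon>) * a * (1 - indicator bad \<omega>) \<le> V * real (\<tau> \<omega>) + X \<omega>"
        using budget by (rule AE_mp) (auto simp: space_law[OF A] intro!: AE_I2 pointwise)
    qed
    also have "\<dots> \<le> V * t + (\<epsilon> * t + C)"
      using \<tau>_int X by (simp add: t_def)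
    finally have "(1 - \<epsilon>) * a - (1 - \<epsilon>) * (a * measure (law Q A) bad) \<le> (V + \<epsilon>) * t + C"
      by (simp add: algebra_simps)
    moreover have "(1 - \<epsilon>) * (a * measure (law Q A) bad) \<le> 1 * (1 + real (card P) / \<epsilon>)"
      using a_bad \<epsilon> a by (intro mult_mono) auto
    ultimately have "((1 - \<epsilon>) * a - (C + 1 + real (card P) / \<epsilon>)) \<le> t * (V + \<epsilon>)" by (simp add: algebra_simps)
    then have "((1 - \<epsilon>) * a - (C + 1 + real (card P) / \<epsilon>)) / (V + \<epsilon>) \<le> t"
      using V \<epsilon> by (simp add: pos_divide_le_eq)
    then have "ennreal (((1 - \<epsilon>) * a - (C + 1 + real (card P) / \<epsilon>)) / (V + \<epsilon>)) \<le> ennreal t"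
      by (rule ennreal_leI)
    also have "ennreal t = (\<integral>\<^sup>+\<omega>. ennreal (real (\<tau> \<omega>)) \<partial>law Q A)"
      unfolding t_def by (rule nn_integral_eq_integral[OF \<tau>_int, symmetric]) simp
    also have "\<dots> \<le> expected_time Q A T"
      unfolding expected_time_def
    proof (rule nn_integral_mono)
      fix \<omega>
      have "ennreal_of_enat (enat (\<tau> \<omega>)) \<le> ennreal_of_enat (T \<omega>)"
        unfolding ennreal_of_enat_le_iff \<tau>_def by (rule enat_truncate_time_le)
      then show "ennreal (real (\<tau> \<omega>)) \<le> ennreal_of_enat (T \<omega>)"
        by (simp add: ennreal_of_nat_eq_real_of_nat)
    qed
    finally show "ennreal (((1 - \<epsilon>) * a - (C + 1 + real (card P) / \<epsilon>)) / (V + \<epsilon>)) \<le> expected_time Q A T" .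
  qed
qed

lemma expected_time_SUP:
  assumes A: "A \<subseteq> sources Q" and R: "sampling_rule Q R"
    and T: "\<And>n. {\<omega> \<in> space (outcomes Q). T \<omega> \<le> enat n} \<in> sets (history Q R n)"
  shows "expected_time Q A T = (SUP N. ennreal (\<integral>\<omega>. real (truncate_time T N \<omega>) \<partial>law Q A))"
proof -
  have int: "integrable (law Q A) (\<lambda>\<omega>. real (truncate_time T N \<omega>))" for N
    by (rule stopping_integrable[OF A R stopping_truncate_time[OF T] truncate_time_le])
  have sup: "ennreal_of_enat (T \<omega>) = (SUP N. ennreal (real (truncate_time T N \<omega>)))" for \<omega>
  proof (cases "T \<omega>")
    case (enat n)
    show ?thesis
    proof (rule antisym)
      show "ennreal_of_enat (T \<omega>) \<le> (SUP N. ennreal (real (truncate_time T N \<omega>)))"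
        by (rule SUP_upper2[of n]) (simp_all add: enat truncate_time_def ennreal_of_nat_eq_real_of_nat)
      show "(SUP N. ennreal (real (truncate_time T N \<omega>))) \<le> ennreal_of_enat (T \<omega>)"
        by (rule SUP_least) (simp add: enat truncate_time_def ennreal_of_nat_eq_real_of_nat)
    qed
  next
    case infinity
    have top: "(SUP N. ennreal (real N)) = top"
      using ennreal_SUP_of_nat_eq_top unfolding ennreal_of_nat_eq_real_of_nat .
    from infinity show ?thesis
      by (simp only: truncate_time_def enat.case ennreal_of_enat_infty top infinity_ennreal_def)
  qed
  have "expected_time Q A T = (\<integral>\<^sup>+\<omega>. (SUP N. ennreal (real (truncate_time T N \<omega>))) \<partial>law Q A)"
    unfolding expected_time_def sup ..
  also have "\<dots> = (SUP N. \<integral>\<^sup>+\<omega>. ennreal (real (truncate_time T N \<omega>)) \<partial>law Q A)"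
  proof (rule nn_integral_monotone_convergence_SUP)
    show "incseq (\<lambda>N \<omega>. ennreal (real (truncate_time T N \<omega>)))"
      by (auto simp: incseq_def le_fun_def truncate_time_def split: enat.split)
    show "(\<lambda>\<omega>. ennreal (real (truncate_time T N \<omega>))) \<in> borel_measurable (law Q A)" for N
      using int[of N] by (auto intro: measurable_compose[OF _ measurable_ennreal])
  qed
  also have "\<dots> = (SUP N. ennreal (\<integral>\<omega>. real (truncate_time T N \<omega>) \<partial>law Q A))"
    by (intro SUP_cong refl nn_integral_eq_integral int) simp
  finally show ?thesis .
qed

lemma sampling_freq_eq: "sampling_freq R i n \<omega> = sample_count R i n \<omega> / real n"
  by (simp add: sampling_freq_def sample_count_def)

lemma sampling_freq_sets:
  assumes R: "sampling_rule Q R"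
  shows "{\<omega> \<in> space (outcomes Q). sampling_freq R i n \<omega> < x} \<in> sets (outcomes Q)"
proof -
  have "(\<lambda>\<omega>. of_bool (i \<in> R m \<omega>) :: real) \<in> borel_measurable (outcomes Q)" if m: "m \<in> {1..n}" for m
  proof -
    have "{\<omega> \<in> space (outcomes Q). i \<in> R m \<omega>} \<in> sets (outcomes Q)"
      using sampling_rule_sets[OF R, of "\<lambda>S. i \<in> S" "m - 1"] sets_history_subset[OF R, of "m - 1"] m by auto
    then have "indicator {\<omega> \<in> space (outcomes Q). i \<in> R m \<omega>} \<in> (borel_measurable (outcomes Q) :: ('w \<Rightarrow> real) set)"
      by simp
    then show ?thesis by (rule measurable_cong[THEN iffD1, rotated]) auto
  qed
  then have "sampling_freq R i n \<in> borel_measurable (outcomes Q)"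
    unfolding sampling_freq_def[abs_def] by (intro borel_measurable_times borel_measurable_sum) auto
  then show ?thesis by (intro borel_measurable_less) auto
qed

text \<open>
  Applied with \<open>c = c\<^sup>*\<close> and \<open>v = V\<close> to the given rule, and with other \<open>c\<close> and \<open>v\<close> to the rule that
  bounds the optimum, for which it also shows that stopping occurs almost surely.
\<close>

lemma upper_bound:
  assumes A: "A \<subseteq> sources Q" and R: "sampling_rule Q R" and k: "1 \<le> k" "k \<le> num_sources Q"
    and v: "\<And>U. U \<subseteq> sources Q \<Longrightarrow> card U = k \<Longrightarrow> v \<le> (\<Sum>i\<in>U. c i * strength Q A i)"
    and freq: "\<And>i \<eta>. i \<in> sources Q \<Longrightarrow> 0 < \<eta> \<Longrightarrow> summable (\<lambda>n. measure (law Q A)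
        {\<omega> \<in> space (outcomes Q). sampling_freq R i (Suc n) \<omega> < c i - \<eta>})"
    and \<epsilon>: "0 < \<epsilon>" "\<epsilon> < v"
  obtains C where "\<And>d. 0 \<le> d \<Longrightarrow> expected_time Q A (T_si Q k d R) \<le> ennreal ((d + C) / (v - \<epsilon>))"
proof -
  interpret PA: prob_space "law Q A" by (rule prob_law[OF A])
  define F where "F = (\<Sum>i\<in>sources Q. strength Q A i)"
  have F: "0 < F" unfolding F_def using num_sources_pos strength_pos by (intro sum_pos) auto
  \<comment> \<open>Half of \<open>\<epsilon>\<close> pays for the error in the frequencies, the other half for the deviations.\<close>
  define \<eta> where "\<eta> = \<epsilon> / (2 * F)"
  have \<eta>: "0 < \<eta>" "\<eta> * F = \<epsilon> / 2" using \<epsilon> F by (auto simp: \<eta>_def)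
  define v' where "v' = v - \<epsilon> / 2"
  have v': "0 < v'" using \<epsilon> by (simp add: v'_def)
  have \<epsilon>2: "0 < \<epsilon> / 2" using \<epsilon> by simp
  obtain C where dev: "deviation_control A (sources Q) (\<epsilon> / 2) C"
    by (rule deviation_control_sources[OF A \<epsilon>2])
  define rare where "rare = (\<lambda>i n. {\<omega> \<in> space (outcomes Q). sampling_freq R i n \<omega> < c i - \<eta>})"
  have rare_sets: "rare i n \<in> PA.events" for i n
    unfolding rare_def sets_law[OF A] by (rule sampling_freq_sets[OF R])
  define g where "g = (\<Sum>i\<in>sources Q. \<Sum>n. measure (law Q A) (rare i (Suc n)))"
  show thesis
  proof (rule that[of "C + v' * (1 + g)"])
    fix d :: real assume d: "0 \<le> d"
    define T where "T = T_si Q k d R"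
    have T_sets: "{\<omega> \<in> space (outcomes Q). T \<omega> \<le> enat n} \<in> sets (history Q R n)" for n
      unfolding T_def by (rule T_si_le_sets[OF R k])
    have bound: "(\<integral>\<omega>. real (truncate_time T N \<omega>) \<partial>law Q A) \<le> (d + (C + v' * (1 + g))) / (v - \<epsilon>)" for N
    proof -
      define \<tau> where "\<tau> = truncate_time T N"
      have stop: "stopping R \<tau>" unfolding \<tau>_def by (rule stopping_truncate_time[OF T_sets])
      have \<tau>N: "\<tau> \<omega> \<le> N" for \<omega> by (simp add: \<tau>_def truncate_time_le)
      obtain X where X: "integrable (law Q A) X" "(\<integral>\<omega>. X \<omega> \<partial>law Q A) \<le> \<epsilon> / 2 * (\<integral>\<omega>. real (\<tau> \<omega>) \<partial>law Q A) + C"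
        and Xdev_all: "\<And>\<omega> n. \<omega> \<in> space (outcomes Q) \<Longrightarrow> n \<le> \<tau> \<omega> \<Longrightarrow>
          (\<Sum>i\<in>sources Q. \<bar>walk Q A R i n \<omega> - strength Q A i * sample_count R i n \<omega>\<bar>) \<le> X \<omega>"
        by (rule deviation_controlE[OF dev R stop \<tau>N], rule that, assumption+)
      have Xdev: "(\<Sum>i\<in>U. \<bar>walk Q A R i n \<omega> - strength Q A i * sample_count R i n \<omega>\<bar>) \<le> X \<omega>"
        if "\<omega> \<in> space (outcomes Q)" "n \<le> \<tau> \<omega>" "U \<subseteq> sources Q" for \<omega> n U
        using that(3) by (intro order_trans[OF sum_mono2 Xdev_all[OF that(1,2)]]) auto
      have X0: "0 \<le> X \<omega>" if "\<omega> \<in> space (outcomes Q)" for \<omega>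
        using Xdev[OF that, of 0 "{}"] by simp
      have \<tau>_int: "integrable (law Q A) (\<lambda>\<omega>. real (\<tau> \<omega>))"
        by (rule stopping_integrable[OF A R stop \<tau>N])
      define G where "G = (\<lambda>\<omega>. \<Sum>i\<in>sources Q. \<Sum>n<N. indicator (rare i (Suc n)) \<omega> :: real)"
      have G_int: "integrable (law Q A) G"
        unfolding G_def using rare_sets
        by (intro Bochner_Integration.integrable_sum integrable_real_indicator) (auto simp: PA.emeasure_eq_measure)
      have "(\<integral>\<omega>. G \<omega> \<partial>law Q A) = (\<Sum>i\<in>sources Q. \<Sum>n<N. measure (law Q A) (rare i (Suc n)))"
      proof -
        have i1: "integrable (law Q A) (indicator (rare i (Suc n)) :: 'w \<Rightarrow> real)" for i n
          using rare_sets by (intro integrable_real_indicator) (auto simp: PA.emeasure_eq_measure)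
        show ?thesis
          unfolding G_def using rare_sets i1
          by (subst Bochner_Integration.integral_sum; (intro Bochner_Integration.integrable_sum i1)?)
            (auto intro!: sum.cong simp: Bochner_Integration.integral_sum)
      qed
      also have "\<dots> \<le> g"
        unfolding g_def using freq[OF _ \<eta>(1)]
        by (intro sum_mono sum_le_suminf) (auto simp: rare_def)
      finally have E_G: "(\<integral>\<omega>. G \<omega> \<partial>law Q A) \<le> g" .
      have pointwise: "v' * (real (\<tau> \<omega>) - 1 - G \<omega>) \<le> d + X \<omega>" if \<omega>: "\<omega> \<in> space (law Q A)" for \<omega>
      proof -
        have \<omega>': "\<omega> \<in> space (outcomes Q)" using \<omega> by (simp add: space_law[OF A])
        define J where "J = {1..<\<tau> \<omega>}"
        define S where "S = {n \<in> J. \<forall>i\<in>sources Q. c i - \<eta> \<le> sampling_freq R i n \<omega>}"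
        have SJ: "S \<subseteq> J" "finite J" by (auto simp: S_def J_def)
        have "real (card (J - S)) \<le> G \<omega>"
        proof -
          have "real (card (J - S)) = (\<Sum>n\<in>J - S. 1)" by simp
          also have "\<dots> \<le> (\<Sum>n\<in>J - S. \<Sum>i\<in>sources Q. indicator (rare i n) \<omega>)"
          proof (rule sum_mono)
            fix n assume "n \<in> J - S"
            then obtain i where i: "i \<in> sources Q" "sampling_freq R i n \<omega> < c i - \<eta>"
              by (auto simp: S_def not_le)
            then have "(1::real) = indicator (rare i n) \<omega>" using \<omega>' by (simp add: rare_def)
            also have "\<dots> \<le> (\<Sum>i\<in>sources Q. indicator (rare i n) \<omega>)"
              using i by (intro member_le_sum) auto
            finally show "(1::real) \<le> (\<Sum>i\<in>sources Q. indicator (rare i n) \<omega>)" .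
          qed
          also have "\<dots> \<le> (\<Sum>n\<in>{1..N}. \<Sum>i\<in>sources Q. indicator (rare i n) \<omega>)"
            using \<tau>N[of \<omega>] by (intro sum_mono2 sum_nonneg) (auto simp: J_def)
          also have "\<dots> = (\<Sum>n<N. \<Sum>i\<in>sources Q. indicator (rare i (Suc n)) \<omega>)"
            by (rule sum.reindex_bij_witness[of _ Suc "\<lambda>n. n - 1"]) auto
          also have "\<dots> = G \<omega>" unfolding G_def by (rule sum.swap)
          finally show ?thesis .
        qed
        moreover have "card J = card S + card (J - S)"
          using SJ by (metis card_Diff_subset card_mono finite_subset le_add_diff_inverse)
        moreover have "card J = \<tau> \<omega> - 1" by (simp add: J_def)
        ultimately have S_ge: "real (\<tau> \<omega>) - 1 - G \<omega> \<le> real (card S)" by linarith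
        show ?thesis
        proof (cases "S = {}")
          case True
          then have "v' * (real (\<tau> \<omega>) - 1 - G \<omega>) \<le> 0"
            using S_ge v' by (simp add: mult_le_0_iff)
          then show ?thesis using d X0[OF \<omega>'] by linarith
        next
          case False
          define n where "n = Max S"
          have n: "n \<in> S" unfolding n_def using False SJ finite_subset by (intro Max_in) auto
          have "S \<subseteq> {1..n}"
            using SJ finite_subset[OF SJ] by (auto simp: n_def J_def)
          then have "card S \<le> n" using card_mono[of "{1..n}" S] by simp
          then have "v' * (real (\<tau> \<omega>) - 1 - G \<omega>) \<le> v' * real n"
            using S_ge v' by (intro mult_left_mono) auto
          also have "v' * real n \<le> d + X \<omega>"
          proof -
            have n1: "1 \<le> n" "n < \<tau> \<omega>" using n by (auto simp: S_def J_def)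
            have "enat n < T \<omega>"
              using n1 enat_truncate_time_le[of T N \<omega>] unfolding \<tau>_def
              by (meson enat_ord_simps(2) less_le_trans)
            then have "\<not> T \<omega> \<le> enat n" by simp
            then have "\<not> crossing Q k d R n \<omega>" using n1 by (auto simp: T_def T_si_le_iff[OF k])
            then obtain U where U: "U \<subseteq> sources Q" "card U = k" and Ud: "(\<Sum>i\<in>U. \<bar>cum_llr Q R i n \<omega>\<bar>) < d"
              by (auto simp: crossing_def not_le)
            have "(\<Sum>i\<in>U. strength Q A i) \<le> F"
              unfolding F_def using U strength_pos by (intro sum_mono2) (auto intro: less_imp_le)
            then have "\<eta> * (\<Sum>i\<in>U. strength Q A i) \<le> \<epsilon> / 2"
              using mult_left_mono[of _ F \<eta>] \<eta> by fastforce
            then have "v' \<le> (\<Sum>i\<in>U. c i * strength Q A i) - \<eta> * (\<Sum>i\<in>U. strength Q A i)"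
              using v[OF U] by (simp add: v'_def)
            also have "\<dots> = (\<Sum>i\<in>U. (c i - \<eta>) * strength Q A i)"
              by (simp add: sum_subtractf sum_distrib_left left_diff_distrib)
            also have "\<dots> \<le> (\<Sum>i\<in>U. sample_count R i n \<omega> / real n * strength Q A i)"
            proof (rule sum_mono)
              fix i assume "i \<in> U"
              then have i: "i \<in> sources Q" using U by blast
              then have "c i - \<eta> \<le> sample_count R i n \<omega> / real n"
                using n by (auto simp: S_def sampling_freq_eq)
              then show "(c i - \<eta>) * strength Q A i \<le> sample_count R i n \<omega> / real n * strength Q A i"
                using strength_pos[OF i] by (intro mult_right_mono) (auto intro: less_imp_le)
            qed
            finally have "v' * real n \<le> (\<Sum>i\<in>U. sample_count R i n \<omega> / real n * strength Q A i) * real n"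
              by (intro mult_right_mono) auto
            also have "\<dots> = (\<Sum>i\<in>U. strength Q A i * sample_count R i n \<omega>)"
              unfolding sum_distrib_right using n1 by (intro sum.cong) auto
            also have "\<dots> \<le> (\<Sum>i\<in>U. \<bar>cum_llr Q R i n \<omega>\<bar> + \<bar>walk Q A R i n \<omega> - strength Q A i * sample_count R i n \<omega>\<bar>)"
            proof (rule sum_mono)
              fix i
              have "walk Q A R i n \<omega> \<le> \<bar>cum_llr Q R i n \<omega>\<bar>" by (auto simp: walk_eq_cum_llr)
              then show "strength Q A i * sample_count R i n \<omega>
                  \<le> \<bar>cum_llr Q R i n \<omega>\<bar> + \<bar>walk Q A R i n \<omega> - strength Q A i * sample_count R i n \<omega>\<bar>"
                by linarith
            qed
            also have "\<dots> \<le> d + X \<omega>"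
              using Ud Xdev[OF \<omega>' _ U(1), of n] n1 by (simp add: sum.distrib)
            finally show ?thesis .
          qed
          finally show ?thesis .
        qed
      qed
      define t where "t = (\<integral>\<omega>. real (\<tau> \<omega>) \<partial>law Q A)"
      have "v' * (t - 1 - (\<integral>\<omega>. G \<omega> \<partial>law Q A)) = (\<integral>\<omega>. v' * (real (\<tau> \<omega>) - 1 - G \<omega>) \<partial>law Q A)"
        using \<tau>_int G_int by (simp add: t_def PA.prob_space)
      also have "\<dots> \<le> (\<integral>\<omega>. d + X \<omega> \<partial>law Q A)"
        using \<tau>_int G_int X(1) pointwise by (intro integral_mono) auto
      also have "\<dots> \<le> d + (\<epsilon> / 2 * t + C)"
        using X by (simp add: t_def PA.prob_space)
      finally have "v' * t - v' * 1 - v' * (\<integral>\<omega>. G \<omega> \<partial>law Q A) \<le> d + (\<epsilon> / 2 * t + C)"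
        by (simp only: right_diff_distrib)
      moreover have "v' * (\<integral>\<omega>. G \<omega> \<partial>law Q A) \<le> v' * g"
        using E_G v' by (intro mult_left_mono) auto
      moreover have "t * (v - \<epsilon>) = v' * t - \<epsilon> / 2 * t" by (simp add: v'_def field_simps)
      moreover have "v' * (1 + g) = v' + v' * g" by (simp add: algebra_simps)
      ultimately have "t * (v - \<epsilon>) \<le> d + (C + v' * (1 + g))" by linarith
      then show ?thesis using \<epsilon> by (simp add: pos_le_divide_eq t_def \<tau>_def)
    qed
    have "expected_time Q A T = (SUP N. ennreal (\<integral>\<omega>. real (truncate_time T N \<omega>) \<partial>law Q A))"
      by (rule expected_time_SUP[OF A R T_sets])
    also have "\<dots> \<le> ennreal ((d + (C + v' * (1 + g))) / (v - \<epsilon>))"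
      by (intro SUP_least ennreal_leI bound)
    finally show "expected_time Q A (T_si Q k d R) \<le> ennreal ((d + (C + v' * (1 + g))) / (v - \<epsilon>))"
      unfolding T_def .
  qed
qed

end

section \<open>First-order asymptotics from affine bounds\<close>

lemma filterlim_minus_ln: "filterlim (\<lambda>\<alpha>::real. - ln \<alpha>) at_top (at_right 0)"
  using ln_at_0 by (simp add: filterlim_uminus_at_top)

lemma affine_ratio_tendsto:
  fixes V :: real
  assumes "0 < V" "w \<noteq> 0"
  shows "((\<lambda>\<alpha>. ((b * (- ln \<alpha>) + C) / w) / (- ln \<alpha> / V)) \<longlongrightarrow> b * V / w) (at_right 0)"
proof -
  have "((\<lambda>\<alpha>. (C * V / w) / (- ln \<alpha>)) \<longlongrightarrow> 0) (at_right 0)"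
    by (rule tendsto_divide_0[OF tendsto_const]) (rule filterlim_at_top_imp_at_infinity[OF filterlim_minus_ln])
  then have "((\<lambda>\<alpha>. b * V / w + (C * V / w) / (- ln \<alpha>)) \<longlongrightarrow> b * V / w + 0) (at_right 0)"
    by (intro tendsto_intros)
  moreover have "eventually (\<lambda>\<alpha>. b * V / w + (C * V / w) / (- ln \<alpha>) = ((b * (- ln \<alpha>) + C) / w) / (- ln \<alpha> / V)) (at_right (0::real))"
    using eventually_at_right_real[OF zero_less_one]
  proof eventually_elim
    case (elim \<alpha>)
    then have "ln \<alpha> < 0" by simp
    then show ?case using assms by (simp add: field_simps)
  qed
  ultimately show ?thesis by (simp add: tendsto_cong)
qed

text \<open>
  Affine bounds in \<open>- ln \<alpha>\<close> with slopes arbitrarily near \<open>1 / V\<close> are what the two estimates of expected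
  times provide; their additive constants disappear in the limit.
\<close>

lemma log_asymptotics:
  fixes f :: "real \<Rightarrow> ennreal"
  assumes V: "0 < V"
    and lower: "\<And>\<epsilon>. 0 < \<epsilon> \<Longrightarrow> \<epsilon> < 1 \<Longrightarrow> \<exists>C. \<forall>\<alpha>\<in>{0<..<1}. ennreal (((1 - \<epsilon>) * (- ln \<alpha>) - C) / (V + \<epsilon>)) \<le> f \<alpha>"
    and upper: "\<And>\<epsilon>. 0 < \<epsilon> \<Longrightarrow> \<epsilon> < V \<Longrightarrow> \<exists>C. \<forall>\<alpha>\<in>{0<..<1}. f \<alpha> \<le> ennreal ((- ln \<alpha> + C) / (V - \<epsilon>))"
  shows "eventually (\<lambda>\<alpha>. f \<alpha> < \<infinity>) (at_right 0)"
    and "((\<lambda>\<alpha>. enn2real (f \<alpha>) / (- ln \<alpha> / V)) \<longlongrightarrow> 1) (at_right 0)"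
proof -
  have unit: "eventually (\<lambda>\<alpha>. \<alpha> \<in> {0<..<1}) (at_right (0::real))"
    by (rule eventually_at_right_real) simp
  have fin: "f \<alpha> < \<infinity>" if "\<alpha> \<in> {0<..<1}" for \<alpha>
  proof -
    have "0 < V / 2" "V / 2 < V" using V by auto
    from upper[OF this] obtain C where
      "\<forall>\<alpha>\<in>{0<..<1}. f \<alpha> \<le> ennreal ((- ln \<alpha> + C) / (V - V / 2))" ..
    from bspec[OF this that] have "f \<alpha> \<le> ennreal ((- ln \<alpha> + C) / (V - V / 2))" .
    also have "\<dots> < \<infinity>" by simp
    finally show ?thesis .
  qed
  show "eventually (\<lambda>\<alpha>. f \<alpha> < \<infinity>) (at_right 0)" using unit by (rule eventually_mono) (rule fin)
  show "((\<lambda>\<alpha>. enn2real (f \<alpha>) / (- ln \<alpha> / V)) \<longlongrightarrow> 1) (at_right 0)"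
  proof (rule order_tendstoI)
    fix b :: real assume b: "b < 1"
    have "((\<lambda>\<epsilon>. (1 - \<epsilon>) * V / (V + \<epsilon>)) \<longlongrightarrow> (1 - 0) * V / (V + 0)) (at_right 0)"
      using V by (intro tendsto_intros) auto
    then have "eventually (\<lambda>\<epsilon>. b < (1 - \<epsilon>) * V / (V + \<epsilon>)) (at_right 0)"
      using V b by (intro order_tendstoD(1)) auto
    then have "eventually (\<lambda>\<epsilon>. b < (1 - \<epsilon>) * V / (V + \<epsilon>) \<and> \<epsilon> \<in> {0<..<1}) (at_right 0)"
      using unit by (rule eventually_conj)
    then obtain \<epsilon> where \<epsilon>: "b < (1 - \<epsilon>) * V / (V + \<epsilon>)" "0 < \<epsilon>" "\<epsilon> < 1"
      using eventually_happens'[OF trivial_limit_at_right_real] by fastforce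
    obtain C where C: "\<And>\<alpha>. \<alpha> \<in> {0<..<1} \<Longrightarrow> ennreal (((1 - \<epsilon>) * (- ln \<alpha>) - C) / (V + \<epsilon>)) \<le> f \<alpha>"
      using lower[OF \<epsilon>(2,3)] by blast
    have "((\<lambda>\<alpha>. (((1 - \<epsilon>) * (- ln \<alpha>) + (- C)) / (V + \<epsilon>)) / (- ln \<alpha> / V)) \<longlongrightarrow> (1 - \<epsilon>) * V / (V + \<epsilon>)) (at_right 0)"
      using V \<epsilon> by (intro affine_ratio_tendsto) auto
    then have "eventually (\<lambda>\<alpha>. b < (((1 - \<epsilon>) * (- ln \<alpha>) + (- C)) / (V + \<epsilon>)) / (- ln \<alpha> / V)) (at_right 0)"
      using \<epsilon> by (intro order_tendstoD(1))
    then show "eventually (\<lambda>\<alpha>. b < enn2real (f \<alpha>) / (- ln \<alpha> / V)) (at_right 0)"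
      using unit
    proof eventually_elim
      case (elim \<alpha>)
      then have "0 < - ln \<alpha> / V" using V by (simp add: divide_neg_pos)
      have "((1 - \<epsilon>) * (- ln \<alpha>) + (- C)) / (V + \<epsilon>) \<le> enn2real (f \<alpha>)"
      proof -
        have "enn2real (ennreal (((1 - \<epsilon>) * (- ln \<alpha>) - C) / (V + \<epsilon>))) \<le> enn2real (f \<alpha>)"
          using C[OF elim(2)] fin[OF elim(2)] by (intro enn2real_mono) auto
        then show ?thesis by (cases "0 \<le> ((1 - \<epsilon>) * (- ln \<alpha>) - C) / (V + \<epsilon>)")
          (auto simp: ennreal_neg intro: order_trans[OF _ enn2real_nonneg])
      qed
      from divide_right_mono[OF this, of "- ln \<alpha> / V"] elim(1) \<open>0 < - ln \<alpha> / V\<close>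
      show ?case by linarith
    qed
  next
    fix b :: real assume b: "1 < b"
    have "((\<lambda>\<epsilon>. 1 * V / (V - \<epsilon>)) \<longlongrightarrow> 1 * V / (V - 0)) (at_right 0)"
      using V by (intro tendsto_intros) auto
    then have "eventually (\<lambda>\<epsilon>. 1 * V / (V - \<epsilon>) < b) (at_right 0)"
      using V b by (intro order_tendstoD(2)) auto
    moreover have "eventually (\<lambda>\<epsilon>. \<epsilon> \<in> {0<..<V}) (at_right 0)"
      using V by (rule eventually_at_right_real)
    ultimately have "eventually (\<lambda>\<epsilon>. 1 * V / (V - \<epsilon>) < b \<and> \<epsilon> \<in> {0<..<V}) (at_right 0)"
      by (rule eventually_conj)
    then obtain \<epsilon> where \<epsilon>: "1 * V / (V - \<epsilon>) < b" "0 < \<epsilon>" "\<epsilon> < V"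
      using eventually_happens'[OF trivial_limit_at_right_real] by fastforce
    obtain C where C: "\<And>\<alpha>. \<alpha> \<in> {0<..<1} \<Longrightarrow> f \<alpha> \<le> ennreal ((- ln \<alpha> + C) / (V - \<epsilon>))"
      using upper[OF \<epsilon>(2,3)] by blast
    have "((\<lambda>\<alpha>. ((1 * (- ln \<alpha>) + C) / (V - \<epsilon>)) / (- ln \<alpha> / V)) \<longlongrightarrow> 1 * V / (V - \<epsilon>)) (at_right 0)"
      using V \<epsilon> by (intro affine_ratio_tendsto) auto
    then have "eventually (\<lambda>\<alpha>. ((1 * (- ln \<alpha>) + C) / (V - \<epsilon>)) / (- ln \<alpha> / V) < b) (at_right 0)"
      using \<epsilon> by (intro order_tendstoD(2))
    moreover have "eventually (\<lambda>\<alpha>. - C \<le> - ln \<alpha>) (at_right 0)"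
      using filterlim_minus_ln unfolding filterlim_at_top by blast
    ultimately show "eventually (\<lambda>\<alpha>. enn2real (f \<alpha>) / (- ln \<alpha> / V) < b) (at_right 0)"
      using unit
    proof eventually_elim
      case (elim \<alpha>)
      then have pos: "0 < - ln \<alpha> / V" using V by (simp add: divide_neg_pos)
      have "enn2real (f \<alpha>) \<le> enn2real (ennreal ((- ln \<alpha> + C) / (V - \<epsilon>)))"
        using C[OF elim(3)] by (intro enn2real_mono) auto
      also have "\<dots> = (1 * (- ln \<alpha>) + C) / (V - \<epsilon>)"
        using elim(2) \<epsilon> by simp
      finally show ?case
        using divide_right_mono[of _ _ "- ln \<alpha> / V"] elim(1) pos by fastforce
    qed
  qed
qed

section \<open>Deterministic rules with prescribed sampling frequencies\<close>

text \<open>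
  Source \<open>i\<close> is sampled whenever \<open>n c\<^sub>i\<close> passes an integer.  At time \<open>n\<close> it has been sampled
  \<open>\<lfloor>n c\<^sub>i\<rfloor>\<close> times, so the budget is respected at every time.
\<close>

definition regular_rule :: "nat set \<Rightarrow> (nat \<Rightarrow> real) \<Rightarrow> 'w rule" where
  "regular_rule S c n \<omega> = {i \<in> S. \<lfloor>real (n - 1) * c i\<rfloor> < \<lfloor>real n * c i\<rfloor>}"

lemma regular_rule_count:
  assumes i: "i \<in> S" and c: "0 \<le> c i" "c i \<le> 1"
  shows "(\<Sum>m=1..n. of_bool (i \<in> regular_rule S c m \<omega>)) = (of_int \<lfloor>real n * c i\<rfloor> :: real)"
proof (induction n)
  case (Suc n)
  let ?p = "real n * c i"
  have p: "real (Suc n) * c i = ?p + c i" by (simp add: algebra_simps)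
  have "\<lfloor>?p\<rfloor> \<le> \<lfloor>?p + c i\<rfloor>" using c by (intro floor_mono) simp
  moreover have "\<lfloor>?p + c i\<rfloor> \<le> \<lfloor>?p + 1\<rfloor>" using c by (intro floor_mono) simp
  ultimately have "\<lfloor>?p + c i\<rfloor> = \<lfloor>?p\<rfloor> \<or> \<lfloor>?p + c i\<rfloor> = \<lfloor>?p\<rfloor> + 1" by auto
  then have "of_bool (i \<in> regular_rule S c (Suc n) \<omega>) = (of_int \<lfloor>real (Suc n) * c i\<rfloor> - of_int \<lfloor>?p\<rfloor> :: real)"
    unfolding p using i p by (auto simp: regular_rule_def)
  then show ?case using Suc by simp
qed simp

context anomaly_model
begin

lemma sampling_rule_regular: "sampling_rule Q (regular_rule (sources Q) c)"
  unfolding sampling_rule_def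
proof (intro allI impI)
  fix n :: nat
  have eq: "regular_rule (sources Q) c n = (\<lambda>_. {i \<in> sources Q. \<lfloor>real (n - 1) * c i\<rfloor> < \<lfloor>real n * c i\<rfloor>})"
    by (rule ext) (simp add: regular_rule_def)
  show "regular_rule (sources Q) c n \<in> history Q (regular_rule (sources Q) c) (n - 1) \<rightarrow>\<^sub>M count_space (Pow (sources Q))"
    by (subst eq, rule measurable_const) auto
qed

lemma regular_rule_budget:
  assumes c: "\<And>i. i \<in> sources Q \<Longrightarrow> 0 \<le> c i \<and> c i \<le> 1" and sum_c: "(\<Sum>i\<in>sources Q. c i) \<le> K" and K: "0 \<le> K"
  shows "(1 / real n) * (\<Sum>m=1..n. real (card (regular_rule (sources Q) c m \<omega>))) \<le> K"
proof -
  have "(\<Sum>m=1..n. real (card (regular_rule (sources Q) c m \<omega>)))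
      = (\<Sum>m=1..n. \<Sum>i\<in>sources Q. of_bool (i \<in> regular_rule (sources Q) c m \<omega>))"
    by (intro sum.cong refl) (auto simp: regular_rule_def Int_def)
  also have "\<dots> = (\<Sum>i\<in>sources Q. \<Sum>m=1..n. of_bool (i \<in> regular_rule (sources Q) c m \<omega>))"
    by (rule sum.swap)
  also have "\<dots> = (\<Sum>i\<in>sources Q. of_int \<lfloor>real n * c i\<rfloor>)"
    using c by (intro sum.cong regular_rule_count) auto
  also have "\<dots> \<le> (\<Sum>i\<in>sources Q. real n * c i)" by (intro sum_mono) simp
  also have "\<dots> = real n * (\<Sum>i\<in>sources Q. c i)" by (simp add: sum_distrib_left)
  also have "\<dots> \<le> real n * K" using sum_c by (intro mult_left_mono) auto
  finally show ?thesis using K by (cases "n = 0") (auto simp: field_simps)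
qed

lemma regular_rule_freq:
  assumes i: "i \<in> sources Q" and c: "0 \<le> c i" "c i \<le> 1" and \<eta>: "0 < \<eta>"
  shows "summable (\<lambda>n. measure (law Q B)
    {\<omega> \<in> space (outcomes Q). sampling_freq (regular_rule (sources Q) c) i (Suc n) \<omega> < c i - \<eta>})"
proof (rule summable_finite[of "{..nat \<lceil>1 / \<eta>\<rceil>}"])
  fix n assume "n \<notin> {..nat \<lceil>1 / \<eta>\<rceil>}"
  then have "1 / \<eta> \<le> real n" by (simp add: not_le) linarith
  then have n: "1 \<le> \<eta> * real (Suc n)" using \<eta> by (simp add: field_simps)
  have "\<not> sampling_freq (regular_rule (sources Q) c) i (Suc n) \<omega> < c i - \<eta>" for \<omega> :: 'w
  proof -
    have "real (Suc n) * c i - 1 \<le> of_int \<lfloor>real (Suc n) * c i\<rfloor>" by linarith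
    also have "\<dots> = sample_count (regular_rule (sources Q) c) i (Suc n) \<omega>"
      unfolding sample_count_def by (rule regular_rule_count[where c = c, OF i c, symmetric])
    finally have "(c i - \<eta>) * real (Suc n) \<le> sample_count (regular_rule (sources Q) c) i (Suc n) \<omega>"
      using n by (simp only: left_diff_distrib mult.commute[of "real (Suc n)"])
    then have "c i - \<eta> \<le> sampling_freq (regular_rule (sources Q) c) i (Suc n) \<omega>"
      unfolding sampling_freq_eq by (subst pos_le_divide_eq) auto
    then show ?thesis by simp
  qed
  then show "measure (law Q B) {\<omega> \<in> space (outcomes Q). sampling_freq (regular_rule (sources Q) c) i (Suc n) \<omega> < c i - \<eta>} = 0"
    by simp
qed simp

lemma threshold_eq: "0 < \<alpha> \<Longrightarrow> \<alpha> < 1 \<Longrightarrow> threshold Q k \<alpha> = - ln \<alpha> + ln (real (num_sources Q choose k))"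
  by (simp add: threshold_def)

lemma threshold_nonneg: "0 < \<alpha> \<Longrightarrow> \<alpha> < 1 \<Longrightarrow> k \<le> num_sources Q \<Longrightarrow> 0 \<le> threshold Q k \<alpha>"
  unfolding threshold_def by (intro add_nonneg_nonneg ln_ge_zero) (auto simp: Suc_le_eq)

text \<open>
  The rule is tuned to \<open>A\<close>, but it stops under every configuration: a positive minimum over
  \<open>k\<close>-sets means that fewer than \<open>k\<close> coordinates of \<open>c\<close> vanish, and then the corresponding minimum
  for the information numbers of \<open>B\<close> is positive too.
\<close>

lemma regular_rule_admissible:
  assumes A: "A \<subseteq> sources Q" and k: "1 \<le> k" "k \<le> num_sources Q" and K: "0 < K"
    and c: "\<And>i. i \<in> sources Q \<Longrightarrow> 0 \<le> c i \<and> c i \<le> 1" and sum_c: "(\<Sum>i\<in>sources Q. c i) \<le> K"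
    and v: "0 < v" "\<And>U. U \<subseteq> sources Q \<Longrightarrow> card U = k \<Longrightarrow> v \<le> (\<Sum>i\<in>U. c i * strength Q A i)"
    and \<alpha>: "0 < \<alpha>" "\<alpha> < 1"
  defines "R \<equiv> regular_rule (sources Q) c :: 'w rule"
  shows "(R, T_si Q k (threshold Q k \<alpha>) R, D_si Q k (threshold Q k \<alpha>) R) \<in> admissible_policies Q \<alpha> k K"
proof -
  let ?T = "T_si Q k (threshold Q k \<alpha>) R" and ?D = "D_si Q k (threshold Q k \<alpha>) R"
  have R: "sampling_rule Q R" unfolding R_def by (rule sampling_rule_regular)
  have budget: "(R, ?T, ?D) \<in> budget_policies Q K"
  proof -
    have "(1 / real n) * (\<Sum>m=1..n. real (card (R m \<omega>))) \<le> K" for n \<omega>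
      unfolding R_def by (rule regular_rule_budget[OF c sum_c]) (use K in auto)
    then show ?thesis
      unfolding budget_policies_def mem_Collect_eq prod.case
      by (intro conjI allI impI AE_I2 T_si_policy[OF R k])
  qed
  have "measure (law Q B) {\<omega> \<in> space (outcomes Q). k \<le> card ((B - ?D \<omega>) \<union> (?D \<omega> - B))} \<le> \<alpha>"
    if B: "B \<subseteq> sources Q" for B
  proof -
    interpret PB: prob_space "law Q B" by (rule prob_law[OF B])
    let ?\<U> = "{U. U \<subseteq> sources Q \<and> card U = k}"
    define r where "r = (\<lambda>U. \<Sum>i\<in>U. c i * strength Q B i)"
    have fin: "finite ?\<U>" by (rule finite_subset[of _ "Pow (sources Q)"]) auto
    have "{1..k} \<in> ?\<U>" using k by auto
    then have ne: "?\<U> \<noteq> {}" by blast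
    have r_pos: "0 < r U" if U: "U \<in> ?\<U>" for U
    proof -
      have finU: "finite U" using U finite_subset by blast
      have "\<exists>i\<in>U. 0 < c i"
      proof (rule ccontr)
        assume "\<not> (\<exists>i\<in>U. 0 < c i)"
        then have "c i = 0" if "i \<in> U" for i
        proof -
          have "i \<in> sources Q" using that U by blast
          from c[OF this] \<open>\<not> (\<exists>i\<in>U. 0 < c i)\<close> that show ?thesis by force
        qed
        then have "(\<Sum>i\<in>U. c i * strength Q A i) = 0" by simp
        then show False using v(1) v(2)[of U] U by simp
      qed
      then obtain i where i: "i \<in> U" "0 < c i" by blast
      then have "0 < c i * strength Q B i" using U strength_pos by auto
      also have "\<dots> \<le> r U"
        unfolding r_def using U c i finU strength_pos
        by (intro member_le_sum) (auto intro!: mult_nonneg_nonneg less_imp_le[OF strength_pos])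
      finally show ?thesis .
    qed
    define w where "w = Min (r ` ?\<U>)"
    have w: "0 < w" unfolding w_def using fin ne r_pos by (subst Min_gr_iff) auto
    have wU: "w \<le> (\<Sum>i\<in>U. c i * strength Q B i)" if "U \<subseteq> sources Q" "card U = k" for U
      using that fin unfolding w_def r_def[symmetric] by (intro Min_le) auto
    have freq: "summable (\<lambda>n. measure (law Q B)
        {\<omega> \<in> space (outcomes Q). sampling_freq R i (Suc n) \<omega> < c i - \<eta>})"
      if "i \<in> sources Q" "0 < \<eta>" for i \<eta>
      unfolding R_def using regular_rule_freq[OF that(1) _ _ that(2)] c[OF that(1)] by blast
    have w2: "0 < w / 2" "w / 2 < w" using w by auto
    obtain C where "\<And>d. 0 \<le> d \<Longrightarrow> expected_time Q B (T_si Q k d R) \<le> ennreal ((d + C) / (w - w / 2))"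
      by (rule upper_bound[OF B R k wU freq w2]) blast+
    from this[OF threshold_nonneg[OF \<alpha> k(2)]]
    have "expected_time Q B ?T \<noteq> \<infinity>" by (metis ennreal_less_top infinity_ennreal_def leD)
    moreover have "?T \<in> measurable (law Q B) (count_space UNIV)"
    proof (rule measurable_count_space_eq_countable[THEN iffD2])
      show "countable (UNIV :: enat set)" by simp
    next
      have fin: "?T -` {enat n} \<inter> space (law Q B) \<in> PB.events" for n
      proof -
        have "?T -` {enat n} \<inter> space (law Q B) = {\<omega> \<in> space (outcomes Q). ?T \<omega> = enat n \<and> True}"
          by (auto simp: space_law[OF B])
        then show ?thesis
          using T_si_D_si_sets[OF R k, of "threshold Q k \<alpha>" n "\<lambda>_. True"] sets_history_subset[OF R]
          by (auto simp: sets_law[OF B])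
      qed
      have "?T -` {\<infinity>} \<inter> space (law Q B) = space (law Q B) - (\<Union>n. ?T -` {enat n} \<inter> space (law Q B))"
        by auto
      also have "\<dots> \<in> PB.events" using fin by (intro sets.Diff sets.countable_UN) auto
      finally have "?T -` {\<infinity>} \<inter> space (law Q B) \<in> PB.events" .
      with fin show "?T \<in> space (law Q B) \<rightarrow> UNIV \<and> (\<forall>a\<in>UNIV. ?T -` {a} \<inter> space (law Q B) \<in> PB.events)"
        by (metis UNIV_I funcsetI not_infinity_eq)
    qed
    then have "(\<lambda>\<omega>. ennreal_of_enat (?T \<omega>)) \<in> borel_measurable (law Q B)"
      by (rule measurable_compose) simp
    ultimately have "AE \<omega> in law Q B. ennreal_of_enat (?T \<omega>) \<noteq> \<infinity>"
      unfolding expected_time_def by (intro nn_integral_PInf_AE) auto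
    then have AE_fin: "AE \<omega> in law Q B. ?T \<omega> < \<infinity>"
      by (rule AE_mp) (auto intro!: AE_I2 simp: ennreal_of_enat_def split: enat.splits)
    let ?E = "{\<omega> \<in> space (outcomes Q). k \<le> card ((B - ?D \<omega>) \<union> (?D \<omega> - B))}"
    let ?E' = "{\<omega> \<in> space (outcomes Q). ?T \<omega> < \<infinity> \<and> k \<le> card ((B - ?D \<omega>) \<union> (?D \<omega> - B))}"
    have E': "?E' \<in> PB.events"
    proof -
      have "?E' = (\<Union>n. {\<omega> \<in> space (outcomes Q). ?T \<omega> = enat n \<and> k \<le> card ((B - ?D \<omega>) \<union> (?D \<omega> - B))})"
        by auto
      also have "\<dots> \<in> PB.events"
        using T_si_D_si_sets[OF R k, of "threshold Q k \<alpha>" _ "\<lambda>S. k \<le> card ((B - S) \<union> (S - B))"]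
          sets_history_subset[OF R] by (intro sets.countable_UN) (auto simp: sets_law[OF B])
      finally show ?thesis .
    qed
    have "measure (law Q B) ?E \<le> measure (law Q B) ?E'"
    proof (rule PB.finite_measure_mono_AE[OF _ E'])
      show "AE \<omega> in law Q B. \<omega> \<in> ?E \<longrightarrow> \<omega> \<in> ?E'" using AE_fin by (rule AE_mp) (auto intro!: AE_I2)
    qed
    also have "\<dots> \<le> real (num_sources Q choose k) * exp (- threshold Q k \<alpha>)"
      by (rule T_si_error[OF R k B])
    also have "\<dots> = \<alpha>" by (rule threshold_error[OF \<alpha> k])
    finally show ?thesis .
  qed
  with budget show ?thesis by (auto simp: admissible_policies_def)
qed

end

section \<open>Asymptotic optimality\<close>

theorem theoremV1:
  fixes Q :: "('s, 'w) anomaly_setup" and K :: real and k :: nat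
    and R :: "'w rule" and A :: "nat set" and \<sigma> :: "nat \<Rightarrow> nat"
  assumes "anomaly_model Q"
    and "0 < K" and "K \<le> real (num_sources Q)"
    and "k \<in> {1..num_sources Q}"
    and "(\<Sum>i=1..num_sources Q.
            \<integral>\<^sup>+x. ennreal (\<bar>llr Q i x\<bar> * log_plus \<bar>llr Q i x\<bar> * dens1 Q i x) \<partial>ref Q i) < \<infinity>"
    and "(\<Sum>i=1..num_sources Q.
            \<integral>\<^sup>+x. ennreal (\<bar>llr Q i x\<bar> * log_plus \<bar>llr Q i x\<bar> * dens0 Q i x) \<partial>ref Q i) < \<infinity>"
    and "\<forall>\<alpha>\<in>{0<..<1}.
           (R, T_si Q k (threshold Q k \<alpha>) R, D_si Q k (threshold Q k \<alpha>) R)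
             \<in> budget_policies Q K"
    and "A \<subseteq> {1..num_sources Q}"
    and "ranking Q A \<sigma>"
    and "\<forall>i\<in>{1..num_sources Q}. \<forall>\<epsilon>>0.
           summable (\<lambda>n. measure (law Q A)
             {\<omega> \<in> space (outcomes Q). sampling_freq R i (Suc n) \<omega> < c_star Q A k K \<sigma> i - \<epsilon>})"
  shows "((\<lambda>\<alpha>. expected_time Q A (T_si Q k (threshold Q k \<alpha>) R) / optimal_time Q A \<alpha> k K)
            \<longlongrightarrow> 1) (at_right 0)
       \<and> ((\<lambda>\<alpha>. optimal_time Q A \<alpha> k K /
               ennreal (\<bar>ln \<alpha>\<bar> / max_min_rate (num_sources Q) k K (F_list Q A)))
            \<longlongrightarrow> 1) (at_right 0)"
proof -
  interpret anomaly_model Q by fact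
  note A = \<open>A \<subseteq> sources Q\<close> and r = \<open>ranking Q A \<sigma>\<close> and K = \<open>0 < K\<close> \<open>K \<le> real (num_sources Q)\<close>
  have k: "1 \<le> k" "k \<le> num_sources Q" using assms(4) by auto
  define V where "V = max_min_rate (num_sources Q) k K (F_list Q A)"
  have V: "0 < V" unfolding V_def by (rule rate_pos[OF k K r])
  define lnC where "lnC = ln (real (num_sources Q choose k))"
  have thr: "threshold Q k \<alpha> = - ln \<alpha> + lnC" if "\<alpha> \<in> {0<..<1}" for \<alpha>
    using that threshold_eq[of \<alpha> k] by (simp add: lnC_def)
  have thr0: "0 \<le> threshold Q k \<alpha>" if "\<alpha> \<in> {0<..<1}" for \<alpha>
    using that threshold_nonneg k by simp
  have exp_ln: "exp (- (- ln \<alpha>)) = \<alpha>" if "\<alpha> \<in> {0<..<1}" for \<alpha> :: real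
    using that by simp
  define f where "f = (\<lambda>\<alpha>. expected_time Q A (T_si Q k (threshold Q k \<alpha>) R))"
  define J where "J = (\<lambda>\<alpha>. optimal_time Q A \<alpha> k K)"
  have R: "sampling_rule Q R"
    using assms(7)[rule_format, of "1/2"] by (auto simp: budget_policies_def policies_def)
  have f_lower: "\<exists>C. \<forall>\<alpha>\<in>{0<..<1}. ennreal (((1 - \<epsilon>) * (- ln \<alpha>) - C) / (V + \<epsilon>)) \<le> f \<alpha>"
    and J_lower: "\<exists>C. \<forall>\<alpha>\<in>{0<..<1}. ennreal (((1 - \<epsilon>) * (- ln \<alpha>) - C) / (V + \<epsilon>)) \<le> J \<alpha>"
    if \<epsilon>: "0 < \<epsilon>" "\<epsilon> < 1" for \<epsilon>
  proof -
    obtain C where C: "\<And>R T D a. (R, T, D) \<in> policies Q \<Longrightarrow>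
      (AE \<omega> in law Q A. \<forall>n. T \<omega> = enat n \<longrightarrow> (1 / real n) * (\<Sum>m=1..n. real (card (R m \<omega>))) \<le> K) \<Longrightarrow>
      0 < a \<Longrightarrow>
      (\<And>B. B \<subseteq> sources Q \<Longrightarrow> measure (law Q B) {\<omega> \<in> space (outcomes Q). T \<omega> < \<infinity> \<and>
          k \<le> card ((B - D \<omega>) \<union> (D \<omega> - B))} \<le> exp (- a)) \<Longrightarrow>
      ennreal (((1 - \<epsilon>) * a - C) / (V + \<epsilon>)) \<le> expected_time Q A T"
      using lower_bound[OF A k K r \<epsilon>] unfolding V_def by blast
    have "ennreal (((1 - \<epsilon>) * (- ln \<alpha>) - C) / (V + \<epsilon>)) \<le> f \<alpha>" if \<alpha>: "\<alpha> \<in> {0<..<1}" for \<alpha>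
      unfolding f_def
    proof (rule C)
      have b: "(R, T_si Q k (threshold Q k \<alpha>) R, D_si Q k (threshold Q k \<alpha>) R) \<in> budget_policies Q K"
        using assms(7) \<alpha> by blast
      then show "(R, T_si Q k (threshold Q k \<alpha>) R, D_si Q k (threshold Q k \<alpha>) R) \<in> policies Q"
        by (simp add: budget_policies_def)
      show "AE \<omega> in law Q A. \<forall>n. T_si Q k (threshold Q k \<alpha>) R \<omega> = enat n \<longrightarrow>
          (1 / real n) * (\<Sum>m=1..n. real (card (R m \<omega>))) \<le> K"
        using b A by (simp add: budget_policies_def)
      show "0 < - ln \<alpha>" using \<alpha> by simp
      show "measure (law Q B) {\<omega> \<in> space (outcomes Q). T_si Q k (threshold Q k \<alpha>) R \<omega> < \<infinity> \<and>
          k \<le> card ((B - D_si Q k (threshold Q k \<alpha>) R \<omega>) \<union> (D_si Q k (threshold Q k \<alpha>) R \<omega> - B))} \<le> exp (- (- ln \<alpha>))"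
        if B: "B \<subseteq> sources Q" for B
        using T_si_error[OF R k B, of "threshold Q k \<alpha>"] threshold_error[OF _ _ k, of \<alpha>] \<alpha> exp_ln[OF \<alpha>] by simp
    qed
    then show "\<exists>C. \<forall>\<alpha>\<in>{0<..<1}. ennreal (((1 - \<epsilon>) * (- ln \<alpha>) - C) / (V + \<epsilon>)) \<le> f \<alpha>" by blast
    have "ennreal (((1 - \<epsilon>) * (- ln \<alpha>) - C) / (V + \<epsilon>)) \<le> J \<alpha>" if \<alpha>: "\<alpha> \<in> {0<..<1}" for \<alpha>
      unfolding J_def optimal_time_def
    proof (rule INF_greatest, clarify)
      fix R' T D assume p: "(R', T, D) \<in> admissible_policies Q \<alpha> k K"
      then have b: "(R', T, D) \<in> budget_policies Q K"
        and err: "\<And>B. B \<subseteq> sources Q \<Longrightarrow> measure (law Q B)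
          {\<omega> \<in> space (outcomes Q). k \<le> card ((B - D \<omega>) \<union> (D \<omega> - B))} \<le> \<alpha>"
        by (auto simp: admissible_policies_def)
      have pol: "(R', T, D) \<in> policies Q" using b by (simp add: budget_policies_def)
      show "ennreal (((1 - \<epsilon>) * (- ln \<alpha>) - C) / (V + \<epsilon>)) \<le> expected_time Q A T"
      proof (rule C[OF pol])
        show "AE \<omega> in law Q A. \<forall>n. T \<omega> = enat n \<longrightarrow> (1 / real n) * (\<Sum>m=1..n. real (card (R' m \<omega>))) \<le> K"
          using b A by (simp add: budget_policies_def)
        show "0 < - ln \<alpha>" using \<alpha> by simp
        fix B assume B: "B \<subseteq> sources Q"
        interpret PB: prob_space "law Q B" by (rule prob_law[OF B])
        have "measure (law Q B) {\<omega> \<in> space (outcomes Q). T \<omega> < \<infinity> \<and> k \<le> card ((B - D \<omega>) \<union> (D \<omega> - B))}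
            \<le> measure (law Q B) {\<omega> \<in> space (outcomes Q). k \<le> card ((B - D \<omega>) \<union> (D \<omega> - B))}"
          using policy_decision_sets[OF pol, of "\<lambda>S. k \<le> card ((B - S) \<union> (S - B))"]
          by (intro PB.finite_measure_mono) (auto simp: sets_law[OF B])
        then show "measure (law Q B) {\<omega> \<in> space (outcomes Q). T \<omega> < \<infinity> \<and>
          k \<le> card ((B - D \<omega>) \<union> (D \<omega> - B))} \<le> exp (- (- ln \<alpha>))"
          using err[OF B] exp_ln[OF \<alpha>] by linarith
      qed
    qed
    then show "\<exists>C. \<forall>\<alpha>\<in>{0<..<1}. ennreal (((1 - \<epsilon>) * (- ln \<alpha>) - C) / (V + \<epsilon>)) \<le> J \<alpha>" by blast
  qed
  have f_upper: "\<exists>C. \<forall>\<alpha>\<in>{0<..<1}. f \<alpha> \<le> ennreal ((- ln \<alpha> + C) / (V - \<epsilon>))"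
    if \<epsilon>: "0 < \<epsilon>" "\<epsilon> < V" for \<epsilon>
  proof -
    have rate: "V \<le> (\<Sum>i\<in>U. c_star Q A k K \<sigma> i * strength Q A i)" if "U \<subseteq> sources Q" "card U = k" for U
      unfolding V_def by (rule c_star_rate[OF k K(1) r that])
    have freq: "summable (\<lambda>n. measure (law Q A)
        {\<omega> \<in> space (outcomes Q). sampling_freq R i (Suc n) \<omega> < c_star Q A k K \<sigma> i - \<eta>})"
      if "i \<in> sources Q" "0 < \<eta>" for i \<eta>
      using assms(10)[rule_format, OF that] .
    obtain C where C: "\<And>d. 0 \<le> d \<Longrightarrow> expected_time Q A (T_si Q k d R) \<le> ennreal ((d + C) / (V - \<epsilon>))"
      by (rule upper_bound[OF A R k rate freq \<epsilon>]) blast+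
    have "f \<alpha> \<le> ennreal ((- ln \<alpha> + (lnC + C)) / (V - \<epsilon>))" if "\<alpha> \<in> {0<..<1}" for \<alpha>
      using C[OF thr0[OF that]] unfolding f_def thr[OF that] by (simp add: algebra_simps)
    then show ?thesis by blast
  qed
  have J_upper: "\<exists>C. \<forall>\<alpha>\<in>{0<..<1}. J \<alpha> \<le> ennreal ((- ln \<alpha> + C) / (V - \<epsilon>))"
    if \<epsilon>: "0 < \<epsilon>" "\<epsilon> < V" for \<epsilon>
  proof -
    \<comment> \<open>Half of \<open>\<epsilon>\<close> pays for replacing the maximum by a nearly optimal budget vector.\<close>
    define v where "v = V - \<epsilon> / 2"
    have v: "0 < v" "v < V" "0 < \<epsilon> / 2" "\<epsilon> / 2 < v" using \<epsilon> by (auto simp: v_def)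
    obtain c where c: "\<And>i. i \<in> sources Q \<Longrightarrow> 0 \<le> c i \<and> c i \<le> 1" and sum_c: "(\<Sum>i\<in>sources Q. c i) \<le> K"
      and rate: "\<And>U. U \<subseteq> sources Q \<Longrightarrow> card U = k \<Longrightarrow> v \<le> (\<Sum>i\<in>U. c i * strength Q A i)"
      using rate_approx[OF k K(1) r, of v] v(2) unfolding V_def by blast
    define R' where "R' = (regular_rule (sources Q) c :: 'w rule)"
    have R': "sampling_rule Q R'" unfolding R'_def by (rule sampling_rule_regular)
    have freq: "summable (\<lambda>n. measure (law Q A)
        {\<omega> \<in> space (outcomes Q). sampling_freq R' i (Suc n) \<omega> < c i - \<eta>})"
      if "i \<in> sources Q" "0 < \<eta>" for i \<eta>
      unfolding R'_def using regular_rule_freq[OF that(1) _ _ that(2)] c[OF that(1)] by blast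
    obtain C where C: "\<And>d. 0 \<le> d \<Longrightarrow> expected_time Q A (T_si Q k d R') \<le> ennreal ((d + C) / (v - \<epsilon> / 2))"
      by (rule upper_bound[OF A R' k rate freq v(3,4)]) blast+
    have "J \<alpha> \<le> ennreal ((- ln \<alpha> + (lnC + C)) / (V - \<epsilon>))" if \<alpha>: "\<alpha> \<in> {0<..<1}" for \<alpha>
    proof -
      have "(R', T_si Q k (threshold Q k \<alpha>) R', D_si Q k (threshold Q k \<alpha>) R') \<in> admissible_policies Q \<alpha> k K"
        unfolding R'_def using \<alpha> by (intro regular_rule_admissible[OF A k K(1) c sum_c v(1) rate]) auto
      then have "J \<alpha> \<le> expected_time Q A (T_si Q k (threshold Q k \<alpha>) R')"
        unfolding J_def optimal_time_def by (rule INF_lower2) simp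
      also have "\<dots> \<le> ennreal ((threshold Q k \<alpha> + C) / (v - \<epsilon> / 2))" by (rule C[OF thr0[OF \<alpha>]])
      finally show ?thesis by (simp add: thr[OF \<alpha>] v_def algebra_simps)
    qed
    then show ?thesis by blast
  qed
  have f_asymp: "eventually (\<lambda>\<alpha>. f \<alpha> < \<infinity>) (at_right 0)"
      "((\<lambda>\<alpha>. enn2real (f \<alpha>) / (- ln \<alpha> / V)) \<longlongrightarrow> 1) (at_right 0)"
    by (rule log_asymptotics[OF V], erule (1) f_lower, erule (1) f_upper)+
  have J_asymp: "eventually (\<lambda>\<alpha>. J \<alpha> < \<infinity>) (at_right 0)"
      "((\<lambda>\<alpha>. enn2real (J \<alpha>) / (- ln \<alpha> / V)) \<longlongrightarrow> 1) (at_right 0)"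
    by (rule log_asymptotics[OF V], erule (1) J_lower, erule (1) J_upper)+
  let ?r = "\<lambda>g \<alpha>. enn2real (g \<alpha>) / (- ln \<alpha> / V)"
  have unit: "eventually (\<lambda>\<alpha>. \<alpha> \<in> {0<..<1}) (at_right (0::real))"
    by (rule eventually_at_right_real) simp
  have J_pos: "eventually (\<lambda>\<alpha>. 0 < ?r J \<alpha>) (at_right 0)"
    by (rule order_tendstoD(1)[OF J_asymp(2) zero_less_one])
  have "((\<lambda>\<alpha>. ?r f \<alpha> / ?r J \<alpha>) \<longlongrightarrow> 1 / 1) (at_right 0)"
    using f_asymp(2) J_asymp(2) by (intro tendsto_divide) auto
  then have "((\<lambda>\<alpha>. ennreal (?r f \<alpha> / ?r J \<alpha>)) \<longlongrightarrow> ennreal (1 / 1)) (at_right 0)" by (rule tendsto_ennrealI)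
  moreover have "eventually (\<lambda>\<alpha>. ennreal (?r f \<alpha> / ?r J \<alpha>) = f \<alpha> / J \<alpha>) (at_right 0)"
    using unit f_asymp(1) J_asymp(1) J_pos
  proof eventually_elim
    case (elim \<alpha>)
    have pos: "0 < - ln \<alpha> / V" using elim(1) V by (simp add: divide_neg_pos)
    have J0: "0 < enn2real (J \<alpha>)" using elim(4) pos unfolding zero_less_divide_iff[of "enn2real (J \<alpha>)"] by linarith
    have cancel: "x / p / (y / p) = x / y" if "0 < p" for x y p :: real using that by simp
    have "?r f \<alpha> / ?r J \<alpha> = enn2real (f \<alpha>) / enn2real (J \<alpha>)" by (rule cancel[OF pos])
    then have "ennreal (?r f \<alpha> / ?r J \<alpha>) = ennreal (enn2real (f \<alpha>)) / ennreal (enn2real (J \<alpha>))"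
      using J0 by (simp add: divide_ennreal)
    then show ?case using elim(2,3) by simp
  qed
  ultimately have first: "((\<lambda>\<alpha>. f \<alpha> / J \<alpha>) \<longlongrightarrow> 1) (at_right 0)" by (simp add: tendsto_cong)
  have "((\<lambda>\<alpha>. ennreal (?r J \<alpha>)) \<longlongrightarrow> ennreal 1) (at_right 0)"
    by (rule tendsto_ennrealI[OF J_asymp(2)])
  moreover have "eventually (\<lambda>\<alpha>. ennreal (?r J \<alpha>) = J \<alpha> / ennreal (\<bar>ln \<alpha>\<bar> / V)) (at_right 0)"
    using unit J_asymp(1)
  proof eventually_elim
    case (elim \<alpha>)
    have pos: "0 < - ln \<alpha> / V" using elim(1) V by (simp add: divide_neg_pos)
    have "\<bar>ln \<alpha>\<bar> = - ln \<alpha>" using elim(1) by simp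
    then have "ennreal (\<bar>ln \<alpha>\<bar> / V) = ennreal (- ln \<alpha> / V)" by simp
    moreover have "ennreal (?r J \<alpha>) = ennreal (enn2real (J \<alpha>)) / ennreal (- ln \<alpha> / V)"
      by (rule divide_ennreal[symmetric]) (use pos in auto)
    ultimately show ?case using elim(2) by simp
  qed
  ultimately have second: "((\<lambda>\<alpha>. J \<alpha> / ennreal (\<bar>ln \<alpha>\<bar> / V)) \<longlongrightarrow> 1) (at_right 0)" by (simp add: tendsto_cong)
  show ?thesis using first second by (simp add: f_def J_def V_def)
qed

end
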